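(* Let $k$ be a field, let $G$ be a simple graph with vertex set $V_G$, and let $S \subset V_G$. (i) If $S$ is a vertex cover of $G$, then $G \cup W(S)$ is sequentially Cohen-Macaulay (over $k$). (ii) If $G \backslash S$ is a forest, then $G \cup W(S)$ is sequentially Cohen-Macaulay (over $k$). (iii) If $G=C$ is a cycle, and $y$ is a vertex of $C$, then $C \cup W(y)$ is sequentially Cohen-Macaulay (over $k$).
   Context: A simple graph $G=(V_G,E_G)$ is a finite graph with no loops or multiple edges. A vertex cover of $G$ is a subset $V\subset V_G$ such that every edge of $G$ is incident to at least one vertex of $V$. For $S \subset V_G$, $G \backslash S$ denotes the subgraph obtained from $G$ by removing the vertices in $S$ and all edges incident to at least one of these vertices. If $S=\{y_1,\dots,y_n\}$, then $G \cup W(S)$ denotes the graph obtained from $G$ by adding a whisker at each vertex of $S$: one adds $n$ new distinct vertices $x_1,\dots,x_n$ and the edges $x_1y_1,\dots,x_ny_n$. For a single vertex $y$, $G\cup W(y)$ means $G\cup W(\{y\})$. The edge ideal of a graph $G$ on vertices $x_1,\dots,x_n$ is $\mathcal{I}(G)=(x_ix_j \mid \{x_i,x_j\}\in E_G)\subset R=k[x_1,\dots,x_n]$, where the vertices are identified with the variables. A finitely generated graded $R$-module $M$ is sequentially Cohen-Macaulay if there is a filtration $0=M_0\subset M_1\subset\cdots\subset M_r=M$ by graded $R$-modules such that each $M_i/M_{i-1}$ is Cohen-Macaulay and $\dim M_i/M_{i-1}<\dim M_{i+1}/M_i$ for all $i$ (Krull dimension). A graph $G$ is sequentially Cohen-Macaulay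 (over $k$) if $R/\mathcal{I}(G)$ is a sequentially Cohen-Macaulay $R$-module. *)

theory Defs
  imports
    "HOL-Algebra.Module"
    "HOL-Algebra.QuotRing"
    "HOL-Algebra.Algebraic_Closure_Type"
    "HOL-Library.Poly_Mapping"
    "HOL-Library.Extended_Nat"
begin

section \<open>Simple graphs\<close>

record 'v sgraph =
  vertices :: "'v set"
  edges :: "'v set set"

definition simple_graph :: "'v sgraph \<Rightarrow> bool" where
  "simple_graph G \<longleftrightarrow>
     finite (vertices G) \<and> (\<forall>e\<in>edges G. e \<subseteq> vertices G \<and> card e = 2)"

definition vertex_cover :: "'v sgraph \<Rightarrow> 'v set \<Rightarrow> bool" where
  "vertex_cover G S \<longleftrightarrow> S \<subseteq> vertices G \<and> (\<forall>e\<in>edges G. e \<inter> S \<noteq> {})"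

definition delete_vertices :: "'v sgraph \<Rightarrow> 'v set \<Rightarrow> 'v sgraph" where
  "delete_vertices G S =
     \<lparr>vertices = vertices G - S, edges = {e \<in> edges G. e \<inter> S = {}}\<rparr>"

text \<open>The old vertices are tagged with \<^const>\<open>Inl\<close>; the new vertex attached to
  \<open>y \<in> S\<close> is \<open>Inr y\<close>.\<close>

definition add_whiskers :: "'v sgraph \<Rightarrow> 'v set \<Rightarrow> ('v + 'v) sgraph" where
  "add_whiskers G S =
     \<lparr>vertices = Inl ` vertices G \<union> Inr ` S,
      edges = (\<lambda>e. Inl ` e) ` edges G \<union> {{Inr y, Inl y} | y. y \<in> S}\<rparr>"

definition cycle_edges :: "'v list \<Rightarrow> 'v set set" where
  "cycle_edges vs = {{vs ! i, vs ! (Suc i mod length vs)} | i. i < length vs}"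

definition cycle_graph :: "'v sgraph \<Rightarrow> bool" where
  "cycle_graph G \<longleftrightarrow>
     (\<exists>vs. 3 \<le> length vs \<and> distinct vs \<and> vertices G = set vs \<and> edges G = cycle_edges vs)"

definition forest_graph :: "'v sgraph \<Rightarrow> bool" where
  "forest_graph G \<longleftrightarrow>
     \<not> (\<exists>vs. 3 \<le> length vs \<and> distinct vs \<and> set vs \<subseteq> vertices G \<and> cycle_edges vs \<subseteq> edges G)"


section \<open>Modules: quotients, dimension, depth\<close>

definition regular_module :: "('a, 'b) ring_scheme \<Rightarrow> ('a, 'a) module" where
  "regular_module R =
     \<lparr>carrier = carrier R, monoid.mult = monoid.mult R, one = one R, zero = zero R,
      add = add R, module.smult = monoid.mult R\<rparr>"

text \<open>The record type of modules extends that of rings; the fields \<^const>\<open>monoid.mult\<close> and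
  \<^const>\<open>one\<close> play no role in a module and are left unspecified here.\<close>

definition quot_module :: "('a, 'm, 'b) module_scheme \<Rightarrow> 'm set \<Rightarrow> ('a, 'm set) module" where
  "quot_module M N =
     \<lparr>carrier = a_rcosets\<^bsub>M\<^esub> N, monoid.mult = undefined, one = undefined, zero = N,
      add = set_add M, module.smult = (\<lambda>a A. \<Union>x\<in>A. N +>\<^bsub>M\<^esub> (a \<odot>\<^bsub>M\<^esub> x))\<rparr>"

definition generated_submodule ::
  "('a, 'b) ring_scheme \<Rightarrow> ('a, 'm, 'c) module_scheme \<Rightarrow> 'm set \<Rightarrow> 'm set" where
  "generated_submodule R M A = \<Inter>{N. submodule N R M \<and> A \<subseteq> N}"

definition finitely_generated_module ::
  "('a, 'b) ring_scheme \<Rightarrow> ('a, 'm, 'c) module_scheme \<Rightarrow> bool" where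
  "finitely_generated_module R M \<longleftrightarrow>
     (\<exists>A. finite A \<and> A \<subseteq> carrier M \<and> generated_submodule R M A = carrier M)"

definition annihilator ::
  "('a, 'b) ring_scheme \<Rightarrow> ('a, 'm, 'c) module_scheme \<Rightarrow> 'a set" where
  "annihilator R M = {a \<in> carrier R. \<forall>x\<in>carrier M. a \<odot>\<^bsub>M\<^esub> x = \<zero>\<^bsub>M\<^esub>}"

text \<open>Since \<open>Sup {} = 0\<close> in \<^typ>\<open>enat\<close>, the zero ring and the zero module get dimension
  \<open>0\<close>. This is harmless below: the factors of a filtration are nonzero.\<close>

definition krull_dim :: "('a, 'b) ring_scheme \<Rightarrow> enat" where
  "krull_dim A =
     Sup {enat n | n. \<exists>P. (\<forall>i\<le>n. primeideal (P i) A) \<and> (\<forall>i<n. P i \<subset> P (Suc i))}"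

definition module_dim :: "('a, 'b) ring_scheme \<Rightarrow> ('a, 'm, 'c) module_scheme \<Rightarrow> enat" where
  "module_dim R M = krull_dim (R Quot annihilator R M)"

definition nonzerodivisor_on :: "'a \<Rightarrow> ('a, 'm, 'c) module_scheme \<Rightarrow> bool" where
  "nonzerodivisor_on a M \<longleftrightarrow> (\<forall>x\<in>carrier M. a \<odot>\<^bsub>M\<^esub> x = \<zero>\<^bsub>M\<^esub> \<longrightarrow> x = \<zero>\<^bsub>M\<^esub>)"

definition set_smult ::
  "('a, 'b) ring_scheme \<Rightarrow> ('a, 'm, 'c) module_scheme \<Rightarrow> 'a set \<Rightarrow> 'm set" where
  "set_smult R M A = generated_submodule R M {a \<odot>\<^bsub>M\<^esub> x | a x. a \<in> A \<and> x \<in> carrier M}"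

definition regular_sequence ::
  "('a, 'b) ring_scheme \<Rightarrow> ('a, 'm, 'c) module_scheme \<Rightarrow> 'a list \<Rightarrow> bool" where
  "regular_sequence R M rs \<longleftrightarrow>
     set rs \<subseteq> carrier R \<and>
     (\<forall>i<length rs. nonzerodivisor_on (rs ! i) (quot_module M (set_smult R M (set (take i rs))))) \<and>
     set_smult R M (set rs) \<noteq> carrier M"

definition module_depth ::
  "('a, 'b) ring_scheme \<Rightarrow> 'a set \<Rightarrow> ('a, 'm, 'c) module_scheme \<Rightarrow> enat" where
  "module_depth R I M = Sup {enat (length rs) | rs. set rs \<subseteq> I \<and> regular_sequence R M rs}"

text \<open>For a finitely generated graded module \<open>M\<close> over a standard graded polynomial ring with
  irrelevant maximal ideal \<open>\<mm>\<close>, being Cohen-Macaulay means that the depth of \<open>M\<close>, the maximal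
  length of an \<open>M\<close>-regular sequence in \<open>\<mm>\<close>, equals the Krull dimension of \<open>M\<close>. As usual, the zero
  module counts as Cohen-Macaulay.\<close>

definition cohen_macaulay ::
  "('a, 'b) ring_scheme \<Rightarrow> 'a set \<Rightarrow> ('a, 'm, 'c) module_scheme \<Rightarrow> bool" where
  "cohen_macaulay R \<mm> M \<longleftrightarrow> carrier M = {\<zero>\<^bsub>M\<^esub>} \<or> module_depth R \<mm> M = module_dim R M"


section \<open>Graded modules and sequential Cohen-Macaulayness\<close>

text \<open>\<open>f\<close> is a decomposition of \<open>x\<close> into components \<open>f d \<in> D d\<close>, almost all of them zero.\<close>

definition decomposes ::
  "('m, 'c) ring_scheme \<Rightarrow> (int \<Rightarrow> 'm set) \<Rightarrow> 'm \<Rightarrow> (int \<Rightarrow> 'm) \<Rightarrow> bool" where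
  "decomposes M D x f \<longleftrightarrow>
     (\<forall>d. f d \<in> D d) \<and> finite {d. f d \<noteq> \<zero>\<^bsub>M\<^esub>} \<and> x = (\<Oplus>\<^bsub>M\<^esub> d\<in>{d. f d \<noteq> \<zero>\<^bsub>M\<^esub>}. f d)"

text \<open>Here \<open>Rdeg d\<close> and \<open>Mdeg d\<close> are the homogeneous parts of degree \<open>d\<close> of \<open>R\<close> and \<open>M\<close>; the last
  condition says that \<open>M\<close> is the direct sum of its homogeneous parts.\<close>

definition graded_module ::
  "('a, 'b) ring_scheme \<Rightarrow> (int \<Rightarrow> 'a set) \<Rightarrow> ('a, 'm, 'c) module_scheme \<Rightarrow> (int \<Rightarrow> 'm set) \<Rightarrow> bool"
where
  "graded_module R Rdeg M Mdeg \<longleftrightarrow>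
     module R M \<and>
     (\<forall>d. additive_subgroup (Mdeg d) M) \<and>
     (\<forall>d e. \<forall>a\<in>Rdeg d. \<forall>x\<in>Mdeg e. a \<odot>\<^bsub>M\<^esub> x \<in> Mdeg (d + e)) \<and>
     (\<forall>x\<in>carrier M. \<exists>!f. decomposes M Mdeg x f)"

definition graded_submodule ::
  "('a, 'b) ring_scheme \<Rightarrow> ('a, 'm, 'c) module_scheme \<Rightarrow> (int \<Rightarrow> 'm set) \<Rightarrow> 'm set \<Rightarrow> bool" where
  "graded_submodule R M Mdeg N \<longleftrightarrow>
     submodule N R M \<and> (\<forall>x\<in>N. \<exists>f. decomposes M (\<lambda>d. N \<inter> Mdeg d) x f)"

definition sequentially_cohen_macaulay ::
  "('a, 'b) ring_scheme \<Rightarrow> (int \<Rightarrow> 'a set) \<Rightarrow> 'a set \<Rightarrow>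
   ('a, 'm, 'c) module_scheme \<Rightarrow> (int \<Rightarrow> 'm set) \<Rightarrow> bool" where
  "sequentially_cohen_macaulay R Rdeg \<mm> M Mdeg \<longleftrightarrow>
     graded_module R Rdeg M Mdeg \<and> finitely_generated_module R M \<and>
     (\<exists>r F. let Q = (\<lambda>i. quot_module (M\<lparr>carrier := F (Suc i)\<rparr>) (F i)) in
        F 0 = {\<zero>\<^bsub>M\<^esub>} \<and> F r = carrier M \<and>
        (\<forall>i\<le>r. graded_submodule R M Mdeg (F i)) \<and>
        (\<forall>i<r. F i \<subset> F (Suc i)) \<and>
        (\<forall>i<r. cohen_macaulay R \<mm> (Q i)) \<and>
        (\<forall>i. Suc i < r \<longrightarrow> module_dim R (Q i) < module_dim R (Q (Suc i))))"


section \<open>Polynomial rings and edge ideals\<close>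

text \<open>Monomials are finitely supported exponent functions \<^typ>\<open>'v \<Rightarrow>\<^sub>0 nat\<close>. The type
  \<^typ>\<open>('v \<Rightarrow>\<^sub>0 nat) \<Rightarrow>\<^sub>0 'k\<close> is the polynomial ring over \<open>'k\<close> with all of \<open>'v\<close> as variables;
  \<open>mpoly_ring V\<close> is its subring \<open>k[V]\<close>.\<close>

definition mpoly_ring :: "'v set \<Rightarrow> (('v \<Rightarrow>\<^sub>0 nat) \<Rightarrow>\<^sub>0 'k::field) ring" where
  "mpoly_ring V =
     ring_of_type_algebra\<lparr>carrier := {p. \<forall>m\<in>Poly_Mapping.keys p. Poly_Mapping.keys m \<subseteq> V}\<rparr>"

definition poly_var :: "'v \<Rightarrow> (('v \<Rightarrow>\<^sub>0 nat) \<Rightarrow>\<^sub>0 'k::field)" where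
  "poly_var v = Poly_Mapping.single (Poly_Mapping.single v 1) 1"

definition monomial_degree :: "('v \<Rightarrow>\<^sub>0 nat) \<Rightarrow> nat" where
  "monomial_degree m = (\<Sum>v\<in>Poly_Mapping.keys m. Poly_Mapping.lookup m v)"

definition poly_grading :: "'v set \<Rightarrow> int \<Rightarrow> (('v \<Rightarrow>\<^sub>0 nat) \<Rightarrow>\<^sub>0 'k::field) set" where
  "poly_grading V d =
     {p \<in> carrier (mpoly_ring V). \<forall>m\<in>Poly_Mapping.keys p. int (monomial_degree m) = d}"

definition irrelevant_ideal :: "'v set \<Rightarrow> (('v \<Rightarrow>\<^sub>0 nat) \<Rightarrow>\<^sub>0 'k::field) set" where
  "irrelevant_ideal V = Idl\<^bsub>mpoly_ring V\<^esub> (poly_var ` V)"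

definition edge_ideal :: "'v sgraph \<Rightarrow> (('v \<Rightarrow>\<^sub>0 nat) \<Rightarrow>\<^sub>0 'k::field) set" where
  "edge_ideal G =
     Idl\<^bsub>mpoly_ring (vertices G)\<^esub> {poly_var u * poly_var v | u v. {u, v} \<in> edges G}"

text \<open>The field \<open>k\<close> is passed as the type argument. \<open>M\<close> is \<open>R / I(G)\<close> as an \<open>R\<close>-module, graded by
  the images of the homogeneous parts of \<open>R = k[V\<^sub>G]\<close>.\<close>

definition graph_sequentially_cohen_macaulay :: "'k::field itself \<Rightarrow> 'v sgraph \<Rightarrow> bool" where
  "graph_sequentially_cohen_macaulay _ G \<longleftrightarrow>
     (let V = vertices G;
          R = mpoly_ring V :: (('v \<Rightarrow>\<^sub>0 nat) \<Rightarrow>\<^sub>0 'k) ring;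
          I = edge_ideal G;
          M = quot_module (regular_module R) I;
          Mdeg = (\<lambda>d. (\<lambda>p. I +>\<^bsub>R\<^esub> p) ` poly_grading V d)
      in sequentially_cohen_macaulay R (poly_grading V) (irrelevant_ideal V) M Mdeg)"

end

theory Submission
  imports Defs
begin

text \<open>
All three parts are instances of one statement: if \<open>G\<close> minus \<open>T\<close> is a forest, then adding a whisker
at every vertex of \<open>T\<close> makes the graph sequentially Cohen-Macaulay. (If \<open>T\<close> is a vertex cover, the
rest has no edges; a cycle minus a vertex is a path.) The proof goes through shellability.

Combinatorics. Let \<open>l\<close> be a leaf with neighbour \<open>y\<close>. A maximal independent set either consists of
\<open>y\<close> and a maximal independent set of the graph without \<open>y\<close> and its neighbours, or it is a
maximal independent set of the graph without \<open>y\<close>. Sets of the first kind, with \<open>y\<close> removed, can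
always be enlarged by \<open>l\<close>, so they are never maximal in the graph without \<open>y\<close>. This is exactly what
is needed to combine shellings of the two smaller graphs. Both inherit the hypothesis, since every
remaining vertex of \<open>T\<close> keeps its own whisker, and once \<open>T\<close> is exhausted a forest with an edge still
has a leaf (\<open>whiskered_shelling\<close>). The shellings list the larger facets first.

Algebra. The edge ideal is the intersection of the primes \<open>P F\<close> generated by the variables outside
\<open>F\<close>, for \<open>F\<close> a maximal independent set (\<open>edge_ideal_eq\<close>). Let \<open>I d\<close> be the intersection of the
\<open>P F\<close> with at least \<open>d\<close> elements in \<open>F\<close>. The submodules \<open>I d / I\<close> form the filtration that is
wanted, and its factors are \<open>I (d + 1) / I d\<close> for the sizes \<open>d\<close> that occur. Adding the facets of
size \<open>d\<close> one at a time in shelling order splits such a factor into cyclic pieces \<open>R / P F\<close> with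
\<open>F\<close> of size \<open>d\<close>.

Depth at least \<open>d\<close>: the elementary symmetric polynomials of degrees \<open>d, \<dots>, 1\<close> in all variables are
a regular sequence on each \<open>R / P F\<close>, hence on the factor (\<open>esyms_regular\<close>, \<open>shelling_regular\<close>).
These work over every field, whereas general linear forms need an infinite one. Modulo \<open>P F\<close> the
polynomial of degree \<open>d\<close> is the product of the variables in \<open>F\<close>, and killing it leaves the
Stanley-Reisner ring of the boundary of a simplex, which is shellable, so that induction applies.

Dimension and depth at most \<open>d\<close>: one lemma, \<open>chain_length_bound\<close>, bounds both. A chain of primes
and a regular sequence each give increasing ideals \<open>L i\<close> and elements \<open>r i \<in> L (i + 1)\<close> that are
nonzerodivisors modulo \<open>L i\<close>. Then the monomials in the \<open>r i\<close> are linearly independent modulo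
\<open>L 0\<close>, and counting monomials with bounded exponents bounds the length of the chain. Dimension at least
\<open>d\<close> comes from the primes \<open>P F\<close> for shrinking \<open>F\<close> (\<open>krull_dim_quot\<close>).
\<close>

section \<open>Shellings of independence complexes\<close>

definition independent_in :: "'v set set \<Rightarrow> 'v set \<Rightarrow> bool" where
  "independent_in E A \<longleftrightarrow> (\<forall>e\<in>E. \<not> e \<subseteq> A)"

definition max_independent :: "'v set set \<Rightarrow> 'v set \<Rightarrow> 'v set set" where
  "max_independent E U =
     {F. F \<subseteq> U \<and> independent_in E F \<and> (\<forall>v\<in>U - F. \<not> independent_in E (insert v F))}"

text \<open>Facets are listed by decreasing size; \<open>\<rho>\<close> only breaks ties. A rank function in place of a list
makes it easy to merge the orders of two complexes.\<close>

definition earlier :: "'v set set \<Rightarrow> ('v set \<Rightarrow> nat) \<Rightarrow> 'v set \<Rightarrow> 'v set set" where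
  "earlier \<F> \<rho> F = {F'\<in>\<F>. card F < card F' \<or> card F = card F' \<and> \<rho> F' < \<rho> F}"

text \<open>The set \<open>R\<close> is the restriction of the facet \<open>F\<close>: among the faces of \<open>F\<close>, those that are new when
\<open>F\<close> is added are the ones containing \<open>R\<close>. That there is a single minimal new face is equivalent to
the usual condition that \<open>F\<close> meets the earlier facets in codimension one.\<close>

definition shelling :: "'v set set \<Rightarrow> ('v set \<Rightarrow> nat) \<Rightarrow> bool" where
  "shelling \<F> \<rho> \<longleftrightarrow> inj_on \<rho> \<F> \<and>
     (\<forall>F\<in>\<F>. \<exists>R\<subseteq>F. \<forall>A\<subseteq>F. (\<forall>F'\<in>earlier \<F> \<rho> F. \<not> A \<subseteq> F') \<longleftrightarrow> R \<subseteq> A)"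

lemma independent_in_subset: "independent_in E B \<Longrightarrow> A \<subseteq> B \<Longrightarrow> independent_in E A"
  unfolding independent_in_def by blast

lemma finite_max_independent: "finite U \<Longrightarrow> finite (max_independent E U)"
  by (rule finite_subset[of _ "Pow U"]) (auto simp: max_independent_def)

lemma independent_extends:
  assumes "finite U" "A \<subseteq> U" "independent_in E A"
  shows "\<exists>F\<in>max_independent E U. A \<subseteq> F"
  using assms
proof (induction "card (U - A)" arbitrary: A rule: less_induct)
  case less
  show ?case
  proof (cases "\<exists>v\<in>U - A. independent_in E (insert v A)")
    case True
    then obtain v where v: "v \<in> U - A" "independent_in E (insert v A)" by blast
    have "card (U - insert v A) < card (U - A)"
      using v less.prems(1) by (intro psubset_card_mono) auto
    then show ?thesis using less.hyps[of "insert v A"] v less.prems by auto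
  next
    case False
    then show ?thesis using less.prems by (auto simp: max_independent_def)
  qed
qed

lemma max_independent_antichain:
  assumes "F \<in> max_independent E U" "independent_in E A" "F \<subseteq> A" "A \<subseteq> U"
  shows "F = A"
proof (rule ccontr)
  assume "F \<noteq> A"
  then obtain v where "v \<in> A" "v \<notin> F" using assms by blast
  then have "\<not> independent_in E (insert v F)" using assms by (auto simp: max_independent_def)
  then show False using independent_in_subset[OF assms(2), of "insert v F"] \<open>v \<in> A\<close> assms(3) by blast
qed

lemma max_independentD:
  assumes "F \<in> max_independent E U"
  shows "F \<subseteq> U" "independent_in E F"
  using assms by (auto simp: max_independent_def)

text \<open>A vertex \<open>l\<close> of degree one with its neighbour \<open>y\<close>. The vertex \<open>y\<close> will be shed: the independence
complex is the union of its deletion, living on \<open>D\<close>, and the cone from \<open>y\<close> over its link, living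
on \<open>L\<close>.\<close>

locale leaf_at =
  fixes E :: "'v set set" and U :: "'v set" and y l :: 'v
  assumes fin: "finite U"
    and card2: "\<And>e. e \<in> E \<Longrightarrow> card e = 2"
    and y: "y \<in> U" and l: "l \<in> U" and yl: "{y, l} \<in> E"
    and only: "\<And>z. z \<in> U \<Longrightarrow> {l, z} \<in> E \<Longrightarrow> z = y"
begin

definition "D = U - {y}"
definition "L = U - {y} - {z. {y, z} \<in> E}"

lemma l_ne: "l \<noteq> y" using card2[OF yl] by auto

lemma edge_split:
  assumes "e \<in> E" "e \<subseteq> insert v F" "\<not> e \<subseteq> F"
  obtains z where "e = {v, z}" "z \<in> F" "z \<noteq> v"
proof -
  obtain a b where "e = {a, b}" "a \<noteq> b" using card2[OF assms(1)] by (auto simp: card_2_iff)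
  then show thesis using assms(2,3) that by (cases "a = v") auto
qed

lemma add_leaf:
  assumes "F \<subseteq> D" "independent_in E F"
  shows "independent_in E (insert l F)"
  unfolding independent_in_def
proof (intro ballI notI)
  fix e assume e: "e \<in> E" "e \<subseteq> insert l F"
  then have "\<not> e \<subseteq> F" using assms(2) by (auto simp: independent_in_def)
  then obtain z where "e = {l, z}" "z \<in> F" using e edge_split by metis
  then show False using only e assms(1) by (auto simp: D_def)
qed

lemma add_y:
  assumes "F \<subseteq> L" "independent_in E F"
  shows "independent_in E (insert y F)"
  unfolding independent_in_def
proof (intro ballI notI)
  fix e assume e: "e \<in> E" "e \<subseteq> insert y F"
  then have "\<not> e \<subseteq> F" using assms(2) by (auto simp: independent_in_def)
  then obtain z where "e = {y, z}" "z \<in> F" using e edge_split by metis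
  then show False using e assms(1) by (auto simp: L_def)
qed

lemma independent_link:
  assumes "independent_in E (insert y A)" "A \<subseteq> D"
  shows "A \<subseteq> L"
  using assms by (auto simp: independent_in_def L_def D_def)

text \<open>A maximal set of the deletion must contain the leaf, which blocks \<open>y\<close>; so it stays maximal when
\<open>y\<close> is put back.\<close>

lemma max_independent_split:
  "max_independent E U = max_independent E D \<union> insert y ` max_independent E L"
proof (intro equalityI subsetI)
  fix F assume F: "F \<in> max_independent E U"
  show "F \<in> max_independent E D \<union> insert y ` max_independent E L"
  proof (cases "y \<in> F")
    case False
    then show ?thesis using F by (auto simp: max_independent_def D_def)
  next
    case True
    have "F - {y} \<subseteq> L"
      using independent_link[of "F - {y}"] True F
      by (auto simp: max_independent_def D_def insert_absorb)
    moreover have "\<not> independent_in E (insert v (F - {y}))" if v: "v \<in> L - (F - {y})" for v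
    proof
      assume "independent_in E (insert v (F - {y}))"
      then have "independent_in E (insert y (insert v (F - {y})))"
        using add_y[of "insert v (F - {y})"] v \<open>F - {y} \<subseteq> L\<close> by blast
      then have "independent_in E (insert v F)" by (rule independent_in_subset) auto
      then show False using F v by (auto simp: max_independent_def L_def)
    qed
    moreover have "independent_in E (F - {y})"
      using F independent_in_subset by (metis (no_types) Diff_subset max_independentD(2))
    ultimately have "F - {y} \<in> max_independent E L" by (auto simp: max_independent_def)
    moreover have "F = insert y (F - {y})" using True by auto
    ultimately show ?thesis by blast
  qed
next
  fix F assume "F \<in> max_independent E D \<union> insert y ` max_independent E L"
  then show "F \<in> max_independent E U"
  proof
    assume F: "F \<in> max_independent E D"
    then have FD: "F \<subseteq> D" and FI: "independent_in E F" by (auto simp: max_independent_def)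
    have "l \<in> F"
    proof (rule ccontr)
      assume "l \<notin> F"
      then have "l \<in> D - F" using l l_ne by (auto simp: D_def)
      then show False using F add_leaf[OF FD FI] by (auto simp: max_independent_def)
    qed
    then have "\<not> independent_in E (insert y F)"
      using yl unfolding independent_in_def by (intro notI) (drule (1) bspec, simp)
    then show ?thesis using F by (auto simp: max_independent_def D_def)
  next
    assume "F \<in> insert y ` max_independent E L"
    then obtain F' where F': "F' \<in> max_independent E L" "F = insert y F'" by blast
    have "\<not> independent_in E (insert v F)" if v: "v \<in> U - F" for v
    proof
      assume I: "independent_in E (insert v F)"
      then have "v \<in> L" using independent_link[of "{v}"] v F'(2) independent_in_subset[OF I, of "{y, v}"]
        by (auto simp: D_def)
      moreover have "independent_in E (insert v F')" using independent_in_subset[OF I] F'(2) by blast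
      ultimately show False using F' v by (auto simp: max_independent_def)
    qed
    then show ?thesis using F' add_y[of F'] y by (auto simp: max_independent_def L_def)
  qed
qed

text \<open>Since \<open>l\<close> is adjacent to \<open>y\<close> it lies outside the link, and it can be added to every independent
set of the link. This is the shedding condition.\<close>

lemma link_below_deletion:
  assumes "A \<in> max_independent E L"
  shows "\<exists>F\<in>max_independent E D. A \<subset> F"
proof -
  have A: "A \<subseteq> L" "independent_in E A" using assms by (auto simp: max_independent_def)
  have "L \<subseteq> D" by (auto simp: L_def D_def)
  then have "independent_in E (insert l A)" "insert l A \<subseteq> D"
    using add_leaf A l l_ne by (auto simp: D_def)
  then obtain F where "F \<in> max_independent E D" "insert l A \<subseteq> F"
    using independent_extends[of D "insert l A" E] fin by (auto simp: D_def)
  moreover have "l \<notin> A" using A yl by (auto simp: L_def)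
  ultimately show ?thesis by blast
qed

text \<open>Among facets of equal size, those of the deletion come before those through \<open>y\<close>. A facet \<open>K\<close> of
the link lies in a larger facet of the deletion, which therefore precedes \<open>insert y K\<close>; hence every
new face of \<open>insert y K\<close> contains \<open>y\<close>, and the restriction of \<open>insert y K\<close> is that of \<open>K\<close> with \<open>y\<close>
added. In the other direction, a facet through \<open>y\<close> that precedes a facet of the deletion is strictly
larger, and without \<open>y\<close> it lies in a still larger facet of the deletion, which also precedes.\<close>

lemma shelling_extend:
  assumes sD: "shelling (max_independent E D) \<rho>" and sL: "shelling (max_independent E L) \<sigma>"
  shows "\<exists>\<tau>. shelling (max_independent E U) \<tau>"
proof -
  let ?D = "max_independent E D" and ?L = "max_independent E L"
  let ?A = "?D \<union> insert y ` ?L"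
  have finD: "finite D" and finL: "finite L" using fin by (auto simp: D_def L_def)
  have DX: "F \<subseteq> D \<and> y \<notin> F \<and> finite F" if "F \<in> ?D" for F
    using that finD by (auto simp: max_independent_def D_def intro: finite_subset)
  have LX: "F \<subseteq> L \<and> y \<notin> F \<and> finite F" if "F \<in> ?L" for F
    using that finL by (auto simp: max_independent_def L_def intro: finite_subset)
  \<comment> \<open>The offset \<open>N\<close> ranks every facet through \<open>y\<close> after the facets of the deletion.\<close>
  define N where "N = Suc (Max (insert 0 (\<rho> ` ?D)))"
  have N: "\<rho> F < N" if "F \<in> ?D" for F
    unfolding N_def using finite_max_independent[OF finD] that by (auto simp: less_Suc_eq_le)
  define \<tau> where "\<tau> F = (if y \<in> F then N + \<sigma> (F - {y}) else \<rho> F)" for F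
  have \<tau>D: "\<tau> F = \<rho> F" if "F \<in> ?D" for F using DX[OF that] by (auto simp: \<tau>_def)
  have \<tau>L: "\<tau> (insert y F) = N + \<sigma> F" if "F \<in> ?L" for F using LX[OF that] by (auto simp: \<tau>_def)
  have inj: "inj_on \<tau> ?A"
  proof (rule inj_onI)
    fix A B assume AB: "A \<in> ?A" "B \<in> ?A" "\<tau> A = \<tau> B"
    have iD: "inj_on \<rho> ?D" and iL: "inj_on \<sigma> ?L" using sD sL by (auto simp: shelling_def)
    consider "A \<in> ?D" "B \<in> ?D" | K where "A \<in> ?D" "K \<in> ?L" "B = insert y K"
      | K where "B \<in> ?D" "K \<in> ?L" "A = insert y K"
      | K K' where "K \<in> ?L" "K' \<in> ?L" "A = insert y K" "B = insert y K'"
      using AB by blast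
    then show "A = B"
    proof cases
      case 1
      then show ?thesis using AB(3) \<tau>D inj_onD[OF iD] by simp
    next
      case 2
      then show ?thesis using AB(3) N[of A] \<tau>D[of A] \<tau>L[of K] by simp
    next
      case 3
      then show ?thesis using AB(3) N[of B] \<tau>D[of B] \<tau>L[of K] by simp
    next
      case 4
      then have "\<sigma> K = \<sigma> K'" using AB(3) \<tau>L[of K] \<tau>L[of K'] by simp
      then have "K = K'" using 4 inj_onD[OF iL, of K K'] by blast
      then show ?thesis using 4 by simp
    qed
  qed
  have cov: "\<exists>R\<subseteq>F. \<forall>A\<subseteq>F. (\<forall>F'\<in>earlier ?A \<tau> F. \<not> A \<subseteq> F') \<longleftrightarrow> R \<subseteq> A"
    if F: "F \<in> ?A" for F
    using F
  proof
    assume F: "F \<in> ?D"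
    then obtain R where R: "R \<subseteq> F" "\<And>A. A \<subseteq> F \<Longrightarrow> (\<forall>F'\<in>earlier ?D \<rho> F. \<not> A \<subseteq> F') \<longleftrightarrow> R \<subseteq> A"
      using sD unfolding shelling_def by meson
    have "(\<forall>F'\<in>earlier ?A \<tau> F. \<not> A \<subseteq> F') \<longleftrightarrow> R \<subseteq> A" if A: "A \<subseteq> F" for A
    proof -
      have "(\<exists>F'\<in>earlier ?D \<rho> F. A \<subseteq> F')" if F': "F' \<in> earlier ?A \<tau> F" "A \<subseteq> F'" for F'
      proof (cases "F' \<in> ?D")
        case True
        then show ?thesis using F' F \<tau>D by (auto simp: earlier_def)
      next
        case False
        then obtain K where K: "K \<in> ?L" "F' = insert y K" using F' by (auto simp: earlier_def)
        have "\<tau> F' \<ge> N" using \<tau>L K by simp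
        then have "card F < card F'" using F' N[OF F] \<tau>D[OF F] by (auto simp: earlier_def)
        then have "card F \<le> card K" using K LX[OF K(1)] by auto
        obtain F2 where F2: "F2 \<in> ?D" "K \<subset> F2" using link_below_deletion[OF K(1)] by blast
        then have "card F < card F2" using \<open>card F \<le> card K\<close> DX[OF F2(1)] psubset_card_mono[of F2 K] by linarith
        moreover have "A \<subseteq> F2" using F'(2) K A DX[OF F] F2 by blast
        ultimately show ?thesis using F2 by (auto simp: earlier_def)
      qed
      moreover have "earlier ?D \<rho> F \<subseteq> earlier ?A \<tau> F"
        using F \<tau>D by (auto simp: earlier_def)
      ultimately show ?thesis using R(2)[OF A] by blast
    qed
    then show ?thesis using R(1) by (intro exI[of _ R] conjI allI impI)
  next
    assume "F \<in> insert y ` ?L"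
    then obtain K where K: "K \<in> ?L" "F = insert y K" by blast
    then obtain R where R: "R \<subseteq> K" "\<And>A. A \<subseteq> K \<Longrightarrow> (\<forall>F'\<in>earlier ?L \<sigma> K. \<not> A \<subseteq> F') \<longleftrightarrow> R \<subseteq> A"
      using sL unfolding shelling_def by meson
    have yK: "y \<notin> K" "finite K" using LX[OF K(1)] by auto
    have "(\<forall>F'\<in>earlier ?A \<tau> F. \<not> A \<subseteq> F') \<longleftrightarrow> insert y R \<subseteq> A" if A: "A \<subseteq> F" for A
    proof (cases "y \<in> A")
      case False
      obtain F2 where F2: "F2 \<in> ?D" "K \<subset> F2" using link_below_deletion[OF K(1)] by blast
      then have "card K < card F2" using DX[OF F2(1)] psubset_card_mono[of F2 K] by blast
      then have "card F \<le> card F2" using K yK by auto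
      moreover have "\<tau> F2 < \<tau> F" using N[OF F2(1)] \<tau>D[OF F2(1)] \<tau>L[OF K(1)] K by auto
      ultimately have "F2 \<in> earlier ?A \<tau> F" using F2 by (auto simp: earlier_def)
      moreover have "A \<subseteq> F2" using F2 A False K by blast
      ultimately show ?thesis using False by blast
    next
      case True
      have 1: "insert y F' \<in> earlier ?A \<tau> F \<longleftrightarrow> F' \<in> earlier ?L \<sigma> K" if "F' \<in> ?L" for F'
        using that K \<tau>L LX[OF that] yK DX by (auto simp: earlier_def)
      have "(\<exists>F'\<in>earlier ?A \<tau> F. A \<subseteq> F') \<longleftrightarrow> (\<exists>F'\<in>earlier ?L \<sigma> K. A - {y} \<subseteq> F')"
      proof
        assume "\<exists>F'\<in>earlier ?A \<tau> F. A \<subseteq> F'"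
        then obtain F' where F': "F' \<in> earlier ?A \<tau> F" "A \<subseteq> F'" by blast
        then have "F' \<in> insert y ` ?L" using DX True by (auto simp: earlier_def)
        then obtain F2 where F2: "F2 \<in> ?L" "F' = insert y F2" by blast
        then show "\<exists>F'\<in>earlier ?L \<sigma> K. A - {y} \<subseteq> F'" using 1[OF F2(1)] F' by blast
      next
        assume "\<exists>F'\<in>earlier ?L \<sigma> K. A - {y} \<subseteq> F'"
        then obtain F' where F': "F' \<in> earlier ?L \<sigma> K" "A - {y} \<subseteq> F'" by blast
        moreover have "F' \<in> ?L" using F' by (auto simp: earlier_def)
        ultimately show "\<exists>F'\<in>earlier ?A \<tau> F. A \<subseteq> F'"
          using 1 by (intro bexI[of _ "insert y F'"]) auto
      qed
      moreover have "R \<subseteq> A - {y} \<longleftrightarrow> insert y R \<subseteq> A" using True R(1) yK by blast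
      moreover have "A - {y} \<subseteq> K" using A K by blast
      ultimately show ?thesis using R(2)[of "A - {y}"] by blast
    qed
    moreover have "insert y R \<subseteq> F" using R(1) K(2) by blast
    ultimately show ?thesis by (intro exI[of _ "insert y R"] conjI allI impI)
  qed
  show ?thesis unfolding max_independent_split shelling_def using inj cov by (intro exI[of _ \<tau>] conjI ballI)
qed

end

text \<open>Every nonempty set of vertices contains one with at most one neighbour in the set. For finite
simple graphs this means that there is no cycle; in this form it provides leaves directly.\<close>

definition forest_like :: "'v set set \<Rightarrow> 'v set \<Rightarrow> bool" where
  "forest_like E U \<longleftrightarrow>
     (\<forall>A\<subseteq>U. A \<noteq> {} \<longrightarrow> (\<exists>v\<in>A. \<forall>u\<in>A. \<forall>w\<in>A. {v, u} \<in> E \<longrightarrow> {v, w} \<in> E \<longrightarrow> u = w))"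

lemma forest_like_subset: "forest_like E U \<Longrightarrow> Y \<subseteq> U \<Longrightarrow> forest_like E Y"
  unfolding forest_like_def by blast

text \<open>The hypotheses pass to the deletion and the link of a vertex with a leaf, so induction on the number
of vertices applies. Whiskers of deleted vertices become isolated vertices, which is why the
hypothesis on the complement of \<open>S\<close> includes the whiskers.\<close>

theorem whiskered_shelling:
  assumes "finite U" and card2: "\<And>e. e \<in> E \<Longrightarrow> card e = 2" and "S \<subseteq> U"
    and "\<And>s. s \<in> S \<Longrightarrow> \<exists>l\<in>U - S. {s, l} \<in> E \<and> (\<forall>z\<in>U. {l, z} \<in> E \<longrightarrow> z = s)"
    and "forest_like E (U - S)"
  shows "\<exists>\<tau>. shelling (max_independent E U) \<tau>"
  using assms(1,3-)
proof (induction "card U" arbitrary: U S rule: less_induct)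
  case less
  note finX = less.prems(1) and SX = less.prems(2) and whisk = less.prems(3) and forest = less.prems(4)
  show ?case
  proof (cases "\<exists>u\<in>U. \<exists>v\<in>U. {u, v} \<in> E")
    case False
    have "independent_in E A" if "A \<subseteq> U" for A
      unfolding independent_in_def
    proof (intro ballI notI)
      fix e assume e: "e \<in> E" "e \<subseteq> A"
      obtain a b where "e = {a, b}" using card2[OF e(1)] by (auto simp: card_2_iff)
      then show False using e that False by auto
    qed
    then have "max_independent E U = {U}" by (auto simp: max_independent_def)
    then have "shelling (max_independent E U) (\<lambda>_. 0)"
      by (auto simp: shelling_def earlier_def)
    then show ?thesis by blast
  next
    case edge: True
    have "\<exists>T y l. T \<subseteq> U \<and> y \<in> T \<and> l \<in> U - T \<and> {y, l} \<in> E \<and> (\<forall>z\<in>U. {l, z} \<in> E \<longrightarrow> z = y) \<and>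
        (\<forall>s\<in>T. \<exists>l\<in>U - T. {s, l} \<in> E \<and> (\<forall>z\<in>U. {l, z} \<in> E \<longrightarrow> z = s)) \<and> forest_like E (U - T)"
    proof (cases "S = {}")
      case False
      then obtain y where y: "y \<in> S" by blast
      then obtain l where "l \<in> U - S" "{y, l} \<in> E" "\<forall>z\<in>U. {l, z} \<in> E \<longrightarrow> z = y" using whisk by meson
      then show ?thesis using y SX whisk forest
        by (intro exI[of _ S] exI[of _ y] exI[of _ l]) simp
    next
      case True
      \<comment> \<open>In a forest with an edge, a vertex of degree one among the non-isolated ones is a whisker.\<close>
      define A where "A = {v\<in>U. \<exists>u\<in>U. {v, u} \<in> E}"
      have "A \<noteq> {}" "A \<subseteq> U" using edge by (auto simp: A_def)
      then obtain v where v: "v \<in> A" "\<And>u w. u \<in> A \<Longrightarrow> w \<in> A \<Longrightarrow> {v, u} \<in> E \<Longrightarrow> {v, w} \<in> E \<Longrightarrow> u = w"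
        using forest True unfolding forest_like_def by (metis Diff_empty)
      have inA: "u \<in> A" if "u \<in> U" "{v, u} \<in> E" for u
        using v(1) that by (auto simp: A_def insert_commute)
      obtain u where u: "u \<in> U" "{v, u} \<in> E" using v(1) by (auto simp: A_def)
      have uv: "u \<noteq> v" using card2[OF u(2)] by auto
      have 1: "\<forall>z\<in>U. {v, z} \<in> E \<longrightarrow> z = u" using v(2) inA u by blast
      have "forest_like E (U - {u})" using forest forest_like_subset True by (metis Diff_empty Diff_subset)
      moreover have "{u, v} \<in> E" "v \<in> U" using u(2) v(1) by (auto simp: A_def insert_commute)
      ultimately have 2: "v \<in> U - {u} \<and> {u, v} \<in> E \<and> (\<forall>z\<in>U. {v, z} \<in> E \<longrightarrow> z = u)"
        using uv 1 by blast
      then have 3: "\<forall>s\<in>{u}. \<exists>l\<in>U - {u}. {s, l} \<in> E \<and> (\<forall>z\<in>U. {l, z} \<in> E \<longrightarrow> z = s)" by blast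
      have 4: "{u} \<subseteq> U" "u \<in> {u}" using u(1) by auto
      show ?thesis
        apply (rule exI[of _ "{u}"], rule exI[of _ u], rule exI[of _ v])
        using 2 3 4 \<open>forest_like E (U - {u})\<close> by (intro conjI) (assumption | (elim conjE, assumption))+
    qed
    then obtain T y l where T: "T \<subseteq> U" "y \<in> T" "l \<in> U - T" "{y, l} \<in> E" "\<forall>z\<in>U. {l, z} \<in> E \<longrightarrow> z = y"
        "\<And>s. s \<in> T \<Longrightarrow> \<exists>l\<in>U - T. {s, l} \<in> E \<and> (\<forall>z\<in>U. {l, z} \<in> E \<longrightarrow> z = s)" "forest_like E (U - T)"
      by blast
    interpret leaf_at E U y l
      using T card2 finX by unfold_locales auto
    have lt: "card D < card U" "card L < card U"
      using y finX unfolding D_def L_def by (intro psubset_card_mono; auto)+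
    have "\<exists>\<tau>. shelling (max_independent E D) \<tau>"
    proof (rule less.hyps[OF lt(1), of "T - {y}"])
      show "\<exists>l\<in>D - (T - {y}). {s, l} \<in> E \<and> (\<forall>z\<in>D. {l, z} \<in> E \<longrightarrow> z = s)" if "s \<in> T - {y}" for s
        using T(6)[of s] that T(2) by (fastforce simp: D_def)
      show "forest_like E (D - (T - {y}))" by (rule forest_like_subset[OF T(7)]) (auto simp: D_def)
    qed (use T finX in \<open>auto simp: D_def\<close>)
    moreover have "\<exists>\<tau>. shelling (max_independent E L) \<tau>"
    proof (rule less.hyps[OF lt(2), of "T \<inter> L"])
      show "\<exists>l\<in>L - (T \<inter> L). {s, l} \<in> E \<and> (\<forall>z\<in>L. {l, z} \<in> E \<longrightarrow> z = s)" if s: "s \<in> T \<inter> L" for s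
      proof -
        obtain m where m: "m \<in> U - T" "{s, m} \<in> E" "\<forall>z\<in>U. {m, z} \<in> E \<longrightarrow> z = s"
          using T(6)[of s] s by blast
        have "{y, m} \<notin> E" using m(3) s y by (auto simp: L_def insert_commute)
        then have "m \<in> L" using m T(2) by (auto simp: L_def)
        then show ?thesis using m by (auto simp: L_def)
      qed
      show "forest_like E (L - (T \<inter> L))" by (rule forest_like_subset[OF T(7)]) (auto simp: L_def)
    qed (use T finX in \<open>auto simp: L_def\<close>)
    ultimately show ?thesis using shelling_extend by blast
  qed
qed

section \<open>Whiskers, forests and cycles\<close>

lemma not_forest_likeE:
  assumes "\<not> forest_like E U"
  obtains A where "A \<subseteq> U" "A \<noteq> {}"
    "\<And>v. v \<in> A \<Longrightarrow> \<exists>u\<in>A. \<exists>w\<in>A. {v, u} \<in> E \<and> {v, w} \<in> E \<and> u \<noteq> w"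
proof -
  obtain A where A: "A \<subseteq> U" "A \<noteq> {}"
    "\<not> (\<exists>v\<in>A. \<forall>u\<in>A. \<forall>w\<in>A. {v, u} \<in> E \<longrightarrow> {v, w} \<in> E \<longrightarrow> u = w)"
    using assms by (auto simp only: forest_like_def)
  show thesis
  proof (rule that[OF A(1,2)])
    fix v assume "v \<in> A"
    then have "\<not> (\<forall>u\<in>A. \<forall>w\<in>A. {v, u} \<in> E \<longrightarrow> {v, w} \<in> E \<longrightarrow> u = w)" using A(3) by simp
    then show "\<exists>u\<in>A. \<exists>w\<in>A. {v, u} \<in> E \<and> {v, w} \<in> E \<and> u \<noteq> w"
      by (simp only: not_imp ball_simps(10))
  qed
qed

text \<open>If every vertex of a nonempty set had two neighbours in the set, all neighbours of the first vertex
of a longest path would lie on the path, and the one that is not second would close a cycle.\<close>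

lemma forest_like_if_forest_graph:
  assumes G: "simple_graph G" and forest: "forest_graph (delete_vertices G S)"
  shows "forest_like (edges G) (vertices G - S)"
proof (rule ccontr)
  let ?E = "edges G"
  assume "\<not> ?thesis"
  then obtain A where A: "A \<subseteq> vertices G - S" "A \<noteq> {}"
    and two: "\<And>v. v \<in> A \<Longrightarrow> \<exists>u\<in>A. \<exists>w\<in>A. {v, u} \<in> ?E \<and> {v, w} \<in> ?E \<and> u \<noteq> w"
    by (rule not_forest_likeE) (rule that)
  have finA: "finite A"
    using G by (intro finite_subset[OF A(1)]) (simp add: simple_graph_def)
  define path where "path vs \<longleftrightarrow> distinct vs \<and> set vs \<subseteq> A \<and> vs \<noteq> [] \<and>
      (\<forall>i. Suc i < length vs \<longrightarrow> {vs ! i, vs ! Suc i} \<in> ?E)" for vs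
  obtain a where "a \<in> A" using A(2) by blast
  then have single: "path [a]" by (simp add: path_def)
  have "\<forall>vs. path vs \<longrightarrow> length vs < Suc (card A)"
  proof (intro allI impI)
    fix vs assume "path vs"
    then have "distinct vs" "set vs \<subseteq> A" by (simp_all add: path_def)
    then have "length vs \<le> card A" using card_mono[OF finA] distinct_card by metis
    then show "length vs < Suc (card A)" by simp
  qed
  from ex_has_greatest_nat[of path, OF single this]
  obtain vs where vs: "path vs" and longest: "\<And>ws. path ws \<Longrightarrow> length ws \<le> length vs"
    by (elim exE conjE) metis
  obtain h ts where ht: "vs = h # ts" using vs by (cases vs) (auto simp: path_def)
  have h: "h \<in> A" using vs by (simp add: path_def ht)
  have nbr_in: "u \<in> set ts" if u: "u \<in> A" "{h, u} \<in> ?E" for u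
  proof (rule ccontr)
    assume n: "u \<notin> set ts"
    have "u \<noteq> h" using G u(2) by (auto simp: simple_graph_def)
    have "{(u # vs) ! i, (u # vs) ! Suc i} \<in> ?E" if "Suc i < length (u # vs)" for i
    proof (cases i)
      case 0
      have "{u, h} \<in> ?E" using u(2) by (simp add: insert_commute)
      then show ?thesis using 0 by (simp add: ht)
    next
      case (Suc k)
      then show ?thesis using that vs by (simp add: path_def)
    qed
    then have "path (u # vs)" using vs n u(1) \<open>u \<noteq> h\<close> by (auto simp: path_def ht)
    then show False using longest by fastforce
  qed
  obtain u w where uw: "u \<in> A" "w \<in> A" "{h, u} \<in> ?E" "{h, w} \<in> ?E" "u \<noteq> w" using two[OF h] by blast
  obtain j where j: "j < length ts" "{h, ts ! j} \<in> ?E" "j \<noteq> 0"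
  proof -
    obtain i k where ik: "i < length ts" "k < length ts" "u = ts ! i" "w = ts ! k"
      using nbr_in[OF uw(1,3)] nbr_in[OF uw(2,4)] by (metis in_set_conv_nth)
    then have "i \<noteq> 0 \<or> k \<noteq> 0" using uw(5) by metis
    then show thesis using that ik uw(3,4) by blast
  qed
  define cs where "cs = take (Suc (Suc j)) vs"
  have len: "length cs = Suc (Suc j)" using j(1) by (simp add: cs_def ht)
  have csA: "set cs \<subseteq> A" "distinct cs"
    using vs set_take_subset[of "Suc (Suc j)" vs] by (auto simp: cs_def path_def)
  have "cycle_edges cs \<subseteq> edges (delete_vertices G S)"
  proof
    fix e assume "e \<in> cycle_edges cs"
    then obtain i where i: "i < length cs" "e = {cs ! i, cs ! (Suc i mod length cs)}"
      by (auto simp: cycle_edges_def)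
    have "e \<in> ?E"
    proof (cases "i = Suc j")
      case True
      then have "e = {ts ! j, h}" using i(2) len by (simp add: cs_def ht)
      then show ?thesis using j(2) by (simp add: insert_commute)
    next
      case False
      then have "Suc i < length cs" using i(1) len by simp
      then have "cs ! i = vs ! i" "cs ! Suc i = vs ! Suc i" "Suc i < length vs" "Suc i mod length cs = Suc i"
        using len by (simp_all add: cs_def)
      then have "e = {vs ! i, vs ! Suc i}" "Suc i < length vs" using i(2) by simp_all
      then show ?thesis using vs by (simp add: path_def)
    qed
    moreover have "Suc i mod length cs < length cs" by (simp add: len)
    then have "e \<subseteq> set cs" using i by simp
    ultimately show "e \<in> edges (delete_vertices G S)" using csA A(1) by (auto simp: delete_vertices_def)
  qed
  moreover have "set cs \<subseteq> vertices (delete_vertices G S)" using csA A(1) by (auto simp: delete_vertices_def)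
  moreover have "3 \<le> length cs" using len j(3) by simp
  ultimately show False using forest csA(2) unfolding forest_graph_def by blast
qed

lemma forest_like_if_vertex_cover:
  assumes "vertex_cover G S"
  shows "forest_like (edges G) (vertices G - S)"
  unfolding forest_like_def
proof (intro allI impI)
  fix A assume A: "A \<subseteq> vertices G - S" "A \<noteq> {}"
  have no_edge: "{v, u} \<notin> edges G" if "v \<in> A" "u \<in> A" for v u
  proof
    assume "{v, u} \<in> edges G"
    then have "{v, u} \<inter> S \<noteq> {}" using assms unfolding vertex_cover_def by blast
    then show False using A(1) that by auto
  qed
  obtain v where "v \<in> A" using A(2) by blast
  then show "\<exists>v\<in>A. \<forall>u\<in>A. \<forall>w\<in>A. {v, u} \<in> edges G \<longrightarrow> {v, w} \<in> edges G \<longrightarrow> u = w"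
    using no_edge by (intro bexI[of _ v]) simp
qed

text \<open>A vertex of a cycle has only its predecessor and its successor as neighbours. A set in which every
vertex has two neighbours within the set is therefore closed under successors and so contains all vertices.\<close>

lemma forest_like_cycle_minus_vertex:
  assumes "cycle_graph G" "y \<in> vertices G"
  shows "forest_like (edges G) (vertices G - {y})"
proof (rule ccontr)
  assume "\<not> ?thesis"
  then obtain A where A: "A \<subseteq> vertices G - {y}" "A \<noteq> {}"
    and two: "\<And>v. v \<in> A \<Longrightarrow> \<exists>u\<in>A. \<exists>w\<in>A. {v, u} \<in> edges G \<and> {v, w} \<in> edges G \<and> u \<noteq> w"
    by (rule not_forest_likeE) (rule that)
  obtain vs where vs: "3 \<le> length vs" "distinct vs" "vertices G = set vs" "edges G = cycle_edges vs"
    using assms(1) by (auto simp: cycle_graph_def)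
  let ?n = "length vs" and ?next = "\<lambda>i. vs ! (Suc i mod length vs)"
  have n: "?n > 0" using vs(1) by linarith
  have nbr: "u = ?next i \<or> (\<exists>j<?n. u = vs ! j \<and> vs ! i = ?next j)"
    if i: "i < ?n" and u: "{vs ! i, u} \<in> edges G" for i u
  proof -
    obtain j where j: "j < ?n" "{vs ! i, u} = {vs ! j, ?next j}"
      using u vs(4) by (auto simp: cycle_edges_def)
    then consider "vs ! i = vs ! j" "u = ?next j" | "vs ! i = ?next j" "u = vs ! j"
      by (auto simp: doubleton_eq_iff)
    then show ?thesis
    proof cases
      case 1
      then have "i = j" using vs(2) i j(1) by (simp add: nth_eq_iff_index_eq)
      then show ?thesis using 1 by simp
    qed (use j(1) in blast)
  qed
  have prev_unique: "j = k" if "j < ?n" "k < ?n" "?next j = ?next k" for j k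
  proof -
    have "Suc j mod ?n = Suc k mod ?n"
      using that(3) vs(2) n by (simp add: nth_eq_iff_index_eq)
    then show ?thesis using that(1,2) by (auto simp: mod_Suc split: if_splits)
  qed
  have step: "?next i \<in> A" if i: "i < ?n" "vs ! i \<in> A" for i
  proof (rule ccontr)
    assume no: "?next i \<notin> A"
    obtain u w where uw: "u \<in> A" "w \<in> A" "{vs ! i, u} \<in> edges G" "{vs ! i, w} \<in> edges G" "u \<noteq> w"
      using two[OF i(2)] by blast
    obtain j k where "j < ?n" "u = vs ! j" "vs ! i = ?next j" "k < ?n" "w = vs ! k" "vs ! i = ?next k"
      using nbr[OF i(1) uw(3)] nbr[OF i(1) uw(4)] no uw(1,2) by blast
    then show False using prev_unique[of j k] uw(5) by simp
  qed
  obtain v where "v \<in> A" using A(2) by blast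
  then have "v \<in> set vs" using A(1) vs(3) by blast
  then obtain i where i: "i < ?n" "vs ! i \<in> A" using \<open>v \<in> A\<close> by (metis in_set_conv_nth)
  have iter: "vs ! ((i + t) mod ?n) \<in> A" for t
  proof (induction t)
    case (Suc t)
    then show ?case using step[of "(i + t) mod ?n"] n by (simp add: mod_Suc_eq)
  qed (use i in simp)
  obtain k where k: "k < ?n" "vs ! k = y" using assms(2) vs(3) by (auto simp: in_set_conv_nth)
  have "(i + (k + ?n - i)) mod ?n = k" using i(1) k(1) by simp
  then have "y \<in> A" using iter[of "k + ?n - i"] k(2) by simp
  then show False using A(1) by blast
qed

lemma add_whiskers_edges:
  fixes G :: "'v sgraph"
  shows "{Inl a, Inl b} \<in> edges (add_whiskers G S) \<longleftrightarrow> {a, b} \<in> edges G"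
    and "{Inr y, z} \<in> edges (add_whiskers G S) \<Longrightarrow> z = Inl y"
    and "y \<in> S \<Longrightarrow> {Inl y, Inr y} \<in> edges (add_whiskers G S)"
proof -
  show "{Inl a, Inl b} \<in> edges (add_whiskers G S) \<longleftrightarrow> {a, b} \<in> edges G"
  proof
    assume "{Inl a, Inl b} \<in> edges (add_whiskers G S)"
    then have "{Inl a, Inl b :: 'v + 'v} \<in> (\<lambda>e. Inl ` e) ` edges G"
      unfolding add_whiskers_def by (simp add: doubleton_eq_iff)
    then obtain e where e: "e \<in> edges G" "Inl ` {a, b} = (Inl ` e :: ('v + 'v) set)" by (elim imageE) simp
    then have "{a, b} = e" by (simp only: inj_image_eq_iff[OF inj_Inl])
    then show "{a, b} \<in> edges G" using e(1) by simp
  next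
    assume "{a, b} \<in> edges G"
    then have "Inl ` {a, b} \<in> edges (add_whiskers G S)"
      unfolding add_whiskers_def by (simp only: sgraph.simps) (rule UnI1, rule imageI)
    then show "{Inl a, Inl b} \<in> edges (add_whiskers G S)" by simp
  qed
  show "z = Inl y" if "{Inr y, z} \<in> edges (add_whiskers G S)"
    using that by (auto simp: add_whiskers_def doubleton_eq_iff)
  show "{Inl y, Inr y} \<in> edges (add_whiskers G S)" if "y \<in> S"
    using that by (auto simp: add_whiskers_def insert_commute)
qed

lemma simple_graph_add_whiskers:
  assumes "simple_graph G" "S \<subseteq> vertices G"
  shows "simple_graph (add_whiskers G S)"
proof -
  have "finite S" using assms finite_subset by (auto simp: simple_graph_def)
  then have "finite (vertices (add_whiskers G S))"
    using assms(1) by (simp add: add_whiskers_def simple_graph_def)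
  moreover have "e \<subseteq> vertices (add_whiskers G S) \<and> card e = 2" if "e \<in> edges (add_whiskers G S)" for e
    using that assms by (auto simp: add_whiskers_def simple_graph_def card_image)
  ultimately show ?thesis by (simp add: simple_graph_def)
qed

theorem add_whiskers_shelling:
  assumes G: "simple_graph G" "S \<subseteq> vertices G" and forest: "forest_like (edges G) (vertices G - S)"
  shows "\<exists>\<tau>. shelling (max_independent (edges (add_whiskers G S)) (vertices (add_whiskers G S))) \<tau>"
proof -
  let ?H = "add_whiskers G S"
  have H: "simple_graph ?H" by (rule simple_graph_add_whiskers[OF G])
  have V: "vertices ?H = Inl ` vertices G \<union> Inr ` S" by (simp add: add_whiskers_def)
  show ?thesis
  proof (rule whiskered_shelling[where S = "Inl ` S"])
    show "card e = 2" if "e \<in> edges ?H" for e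
      using H that by (auto simp: simple_graph_def)
    show "finite (vertices ?H)" using H by (simp add: simple_graph_def)
    show "Inl ` S \<subseteq> vertices ?H" using G(2) by (auto simp: V)
    show "\<exists>l\<in>vertices ?H - Inl ` S. {s, l} \<in> edges ?H \<and> (\<forall>z\<in>vertices ?H. {l, z} \<in> edges ?H \<longrightarrow> z = s)"
      if s: "s \<in> Inl ` S" for s
    proof -
      obtain y where y: "y \<in> S" "s = Inl y" using s by blast
      show ?thesis
      proof (intro bexI[of _ "Inr y"] conjI ballI impI)
        show "{s, Inr y} \<in> edges ?H" using add_whiskers_edges(3) y by simp
        show "z = s" if "{Inr y, z} \<in> edges ?H" for z using add_whiskers_edges(2)[OF that] y by simp
        show "Inr y \<in> vertices ?H - Inl ` S" using y by (auto simp: V)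
      qed
    qed
    show "forest_like (edges ?H) (vertices ?H - Inl ` S)"
      unfolding forest_like_def
    proof (intro allI impI)
      fix A assume A: "A \<subseteq> vertices ?H - Inl ` S" "A \<noteq> {}"
      show "\<exists>v\<in>A. \<forall>u\<in>A. \<forall>w\<in>A. {v, u} \<in> edges ?H \<longrightarrow> {v, w} \<in> edges ?H \<longrightarrow> u = w"
      proof (cases "\<exists>y. Inr y \<in> A")
        case True
        then obtain y where y: "Inr y \<in> A" by blast
        show ?thesis
        proof (rule bexI[OF _ y], intro ballI impI)
          fix u w assume "{Inr y, u} \<in> edges ?H" "{Inr y, w} \<in> edges ?H"
          then show "u = w" using add_whiskers_edges(2) by metis
        qed
      next
        case False
        define B where "B = {b. Inl b \<in> A}"
        have AB: "A = Inl ` B"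
        proof
          show "A \<subseteq> Inl ` B"
          proof
            fix x assume x: "x \<in> A"
            then show "x \<in> Inl ` B" using False by (cases x) (auto simp: B_def)
          qed
        qed (auto simp: B_def)
        have "B \<subseteq> vertices G - S" using A(1) by (auto simp: B_def V)
        moreover have "B \<noteq> {}" using A(2) AB by blast
        ultimately obtain v where v: "v \<in> B"
          "\<forall>u\<in>B. \<forall>w\<in>B. {v, u} \<in> edges G \<longrightarrow> {v, w} \<in> edges G \<longrightarrow> u = w"
          using forest unfolding forest_like_def by meson
        have "Inl v \<in> Inl ` B" using v(1) by (rule imageI)
        then show ?thesis unfolding AB
          by (rule bexI[rotated]) (use v(2) in \<open>simp only: ball_simps(9) add_whiskers_edges(1) sum.inject\<close>)
      qed
    qed
  qed
qed

section \<open>Regular sequences on quotients of ideals\<close>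

text \<open>The ideal \<open>K + r J\<close>; for \<open>r = 1\<close> this is the sum of two ideals.\<close>

definition add_mult :: "'a::comm_ring_1 set \<Rightarrow> 'a \<Rightarrow> 'a set \<Rightarrow> 'a set" where
  "add_mult K r J = {k + r * p | k p. k \<in> K \<and> p \<in> J}"

text \<open>Regular sequences on \<open>J / K\<close> without forming the quotient: dividing by \<open>r\<close> replaces \<open>K\<close> by
\<open>K + r J\<close>. The base case is the requirement that the last quotient be nonzero.\<close>

fun regular_on :: "'a::comm_ring_1 list \<Rightarrow> 'a set \<Rightarrow> 'a set \<Rightarrow> bool" where
  "regular_on [] J K \<longleftrightarrow> \<not> J \<subseteq> K"
| "regular_on (r # rs) J K \<longleftrightarrow>
     (\<forall>p\<in>J. r * p \<in> K \<longrightarrow> p \<in> K) \<and> regular_on rs J (add_mult K r J)"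

text \<open>The ring \<open>R\<close> is a subset of a ring type, as is \<open>k[V]\<close> inside the polynomials in all variables.\<close>

locale subring_set =
  fixes R :: "'a::comm_ring_1 set"
  assumes R_one: "1 \<in> R" and R_add: "a \<in> R \<Longrightarrow> b \<in> R \<Longrightarrow> a + b \<in> R"
    and R_uminus: "a \<in> R \<Longrightarrow> - a \<in> R" and R_mult: "a \<in> R \<Longrightarrow> b \<in> R \<Longrightarrow> a * b \<in> R"
begin

definition submod :: "'a set \<Rightarrow> bool" where
  "submod J \<longleftrightarrow> 0 \<in> J \<and> (\<forall>x\<in>J. \<forall>y\<in>J. x + y \<in> J) \<and> (\<forall>a\<in>R. \<forall>x\<in>J. a * x \<in> J)"

lemma submod_zero: "submod J \<Longrightarrow> 0 \<in> J"
  and submod_add: "submod J \<Longrightarrow> x \<in> J \<Longrightarrow> y \<in> J \<Longrightarrow> x + y \<in> J"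
  and submod_mult: "submod J \<Longrightarrow> a \<in> R \<Longrightarrow> x \<in> J \<Longrightarrow> a * x \<in> J"
  by (auto simp: submod_def)

lemma submod_uminus: "submod J \<Longrightarrow> x \<in> J \<Longrightarrow> - x \<in> J"
  using submod_mult[of J "- 1" x] R_uminus[OF R_one] by simp

lemma submod_diff: "submod J \<Longrightarrow> x \<in> J \<Longrightarrow> y \<in> J \<Longrightarrow> x - y \<in> J"
  using submod_add[of J x "- y"] submod_uminus by simp

lemma submod_R: "submod R"
  using R_one R_add R_mult R_uminus[OF R_one] R_add[OF R_one R_uminus[OF R_one]]
  by (auto simp: submod_def)

lemma submod_sum: "submod J \<Longrightarrow> (\<And>i. i \<in> A \<Longrightarrow> f i \<in> J) \<Longrightarrow> sum f A \<in> J"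
  by (induction A rule: infinite_finite_induct) (auto simp: submod_zero submod_add)

lemma submod_add_mult:
  assumes "submod K" "submod J"
  shows "submod (add_mult K r J)"
proof -
  have "0 \<in> add_mult K r J"
    unfolding add_mult_def using submod_zero[OF assms(1)] submod_zero[OF assms(2)] by force
  moreover have "x + y \<in> add_mult K r J" if x: "x \<in> add_mult K r J" and y: "y \<in> add_mult K r J" for x y
  proof -
    obtain k p k' p' where "x = k + r * p" "y = k' + r * p'" "k \<in> K" "k' \<in> K" "p \<in> J" "p' \<in> J"
      using x y by (auto simp: add_mult_def)
    then have "x + y = (k + k') + r * (p + p')" "k + k' \<in> K" "p + p' \<in> J"
      using submod_add assms by (auto simp: algebra_simps)
    then show ?thesis by (auto simp: add_mult_def)
  qed
  moreover have "a * x \<in> add_mult K r J" if x: "x \<in> add_mult K r J" and a: "a \<in> R" for x a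
  proof -
    obtain k p where "x = k + r * p" "k \<in> K" "p \<in> J"
      using x by (auto simp: add_mult_def)
    then have "a * x = a * k + r * (a * p)" "a * k \<in> K" "a * p \<in> J"
      using submod_mult assms a by (auto simp: algebra_simps)
    then show ?thesis by (auto simp: add_mult_def)
  qed
  ultimately show ?thesis by (auto simp: submod_def)
qed

lemma add_mult_supset: "submod J \<Longrightarrow> K \<subseteq> add_mult K r J"
  unfolding add_mult_def using submod_zero[of J] by force

lemma add_mult_mono: "K \<subseteq> K' \<Longrightarrow> add_mult K r J \<subseteq> add_mult K' r J"
  unfolding add_mult_def by blast

lemma add_multI: "k \<in> K \<Longrightarrow> p \<in> J \<Longrightarrow> k + r * p \<in> add_mult K r J"
  by (auto simp: add_mult_def)

lemma add_mult_subset: "submod J \<Longrightarrow> r \<in> R \<Longrightarrow> K \<subseteq> J \<Longrightarrow> add_mult K r J \<subseteq> J"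
  by (auto simp: add_mult_def submod_add submod_mult subset_iff)

text \<open>By the second isomorphism theorem \<open>K / (K \<inter> L)\<close> is isomorphic to \<open>(K + L) / L\<close>. In the induction
\<open>L\<close> becomes \<open>L + r K\<close>, which changes neither \<open>K + L\<close> nor, by the modular law, the shape of the
intersection.\<close>

lemma regular_on_iso:
  assumes "submod K" "submod L" "set rs \<subseteq> R" "regular_on rs K (K \<inter> L)"
  shows "regular_on rs (add_mult L 1 K) L"
  using assms(2-)
proof (induction rs arbitrary: L)
  case Nil
  then obtain k where "k \<in> K" "k \<notin> L" by auto
  then show ?case using add_multI[of 0 L k K 1] submod_zero[OF Nil.prems(1)] by auto
next
  case (Cons r rs)
  let ?L = "add_mult L r K"
  have L': "submod ?L" using Cons.prems assms(1) by (intro submod_add_mult) auto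
  have r: "r \<in> R" using Cons.prems by simp
  have sum: "add_mult ?L 1 K = add_mult L 1 K"
  proof (intro equalityI subsetI)
    fix x assume "x \<in> add_mult ?L 1 K"
    then obtain l k k' where "x = l + r * k + k'" "l \<in> L" "k \<in> K" "k' \<in> K"
      by (auto simp: add_mult_def)
    moreover from this have "x = l + 1 * (r * k + k')" by (simp add: algebra_simps)
    moreover have "r * k + k' \<in> K"
      using calculation r assms(1) submod_add submod_mult by blast
    ultimately show "x \<in> add_mult L 1 K" using add_multI by metis
  qed (use add_mult_mono[OF add_mult_supset[OF assms(1), of L r]] in blast)
  have int: "K \<inter> ?L = add_mult (K \<inter> L) r K"
  proof (intro equalityI subsetI)
    fix x assume "x \<in> K \<inter> ?L"
    then obtain l k where x: "x \<in> K" "x = l + r * k" "l \<in> L" "k \<in> K" by (auto simp: add_mult_def)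
    then have "l = x - r * k" by simp
    then have "l \<in> K" using x r assms(1) submod_diff submod_mult by blast
    then show "x \<in> add_mult (K \<inter> L) r K" using x by (auto simp: add_mult_def)
  next
    fix x assume "x \<in> add_mult (K \<inter> L) r K"
    then show "x \<in> K \<inter> ?L"
      using r assms(1) submod_add submod_mult by (auto simp: add_mult_def) 
  qed
  have "regular_on rs (add_mult ?L 1 K) ?L"
    using Cons.IH[OF L'] Cons.prems int by auto
  moreover have "add_mult L r (add_mult L 1 K) = ?L"
  proof (intro equalityI subsetI)
    fix x assume "x \<in> add_mult L r (add_mult L 1 K)"
    then obtain l l' k where "x = l + r * (l' + k)" "l \<in> L" "l' \<in> L" "k \<in> K"
      by (auto simp: add_mult_def)
    moreover from this have "x = (l + r * l') + r * k" by (simp add: algebra_simps)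
    moreover have "l + r * l' \<in> L"
      using calculation r Cons.prems(1) submod_add submod_mult by blast
    ultimately show "x \<in> ?L" using add_multI by metis
  next
    fix x assume "x \<in> ?L"
    then obtain l k where "x = l + r * (0 + 1 * k)" "l \<in> L" "k \<in> K" by (auto simp: add_mult_def)
    then show "x \<in> add_mult L r (add_mult L 1 K)"
      using add_multI submod_zero[OF Cons.prems(1)] by metis
  qed
  moreover have "p \<in> L" if p: "p \<in> add_mult L 1 K" "r * p \<in> L" for p
  proof -
    obtain l k where lk: "p = l + k" "l \<in> L" "k \<in> K" using p by (auto simp: add_mult_def)
    have "r * k = r * p - r * l" using lk by (simp add: algebra_simps)
    then have "r * k \<in> L" using p lk r Cons.prems(1) submod_diff submod_mult by metis
    then have "r * k \<in> K \<inter> L" using lk r assms(1) submod_mult by auto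
    then have "k \<in> L" using Cons.prems(3) lk(3) by auto
    then show ?thesis using lk Cons.prems(1) submod_add by auto
  qed
  ultimately show ?case using sum by simp
qed

text \<open>Regular sequences pass to extensions: from the submodule \<open>K / L\<close> and the quotient \<open>J / K\<close> to
\<open>J / L\<close>. Since \<open>r\<close> is a nonzerodivisor on \<open>J / K\<close>, the intersection of \<open>K\<close> with \<open>L + r J\<close> is only
\<open>L + r K\<close>, so that dividing by \<open>r\<close> keeps the sequence exact.\<close>

lemma regular_on_extension:
  assumes "submod J" "submod K" "submod L" "L \<subseteq> K" "K \<subseteq> J" "set rs \<subseteq> R"
    and "regular_on rs J K" "regular_on rs K L"
  shows "regular_on rs J L"
  using assms
proof (induction rs arbitrary: K L)
  case Nil
  then show ?case by auto
next
  case (Cons r rs)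
  note sJ = Cons.prems(1) and sK = Cons.prems(2) and sL = Cons.prems(3)
  have r: "r \<in> R" using Cons.prems by simp
  let ?K = "add_mult K r J" and ?L = "add_mult L r J"
  have nzd1: "p \<in> K" if "p \<in> J" "r * p \<in> K" for p using Cons.prems(7) that by auto
  have nzd2: "p \<in> L" if "p \<in> K" "r * p \<in> L" for p using Cons.prems(8) that by auto
  have sK': "submod ?K" and sL': "submod ?L" using submod_add_mult sJ sK sL by auto
  have int: "K \<inter> ?L = add_mult L r K"
  proof (intro equalityI subsetI)
    fix x assume "x \<in> K \<inter> ?L"
    then obtain l k where x: "x \<in> K" "x = l + r * k" "l \<in> L" "k \<in> J" by (auto simp: add_mult_def)
    moreover from this have "x - l = r * k" by simp
    ultimately have "r * k \<in> K" using Cons.prems(4) submod_diff[OF sK, of x l] by auto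
    then have "k \<in> K" using nzd1 x by simp
    then show "x \<in> add_mult L r K" using x by (auto simp: add_mult_def)
  next
    fix x assume "x \<in> add_mult L r K"
    then obtain l k where x: "x = l + r * k" "l \<in> L" "k \<in> K" by (auto simp: add_mult_def)
    then show "x \<in> K \<inter> ?L"
      using Cons.prems(4,5) submod_add[OF sK] submod_mult[OF sK r] by (auto simp: add_mult_def)
  qed
  have sum: "add_mult ?L 1 K = ?K"
  proof (intro equalityI subsetI)
    fix x assume "x \<in> add_mult ?L 1 K"
    then obtain l p k where x: "x = l + r * p + 1 * k" "l \<in> L" "p \<in> J" "k \<in> K"
      unfolding add_mult_def by blast
    then have "x = (l + k) + r * p" "l + k \<in> K"
      using Cons.prems(4) submod_add[OF sK] by (auto simp: algebra_simps)
    then show "x \<in> ?K" using x add_multI by metis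
  next
    fix x assume "x \<in> ?K"
    then obtain k p where x: "x = k + r * p" "k \<in> K" "p \<in> J" by (auto simp: add_mult_def)
    then have "x = (0 + r * p) + 1 * k" "0 + r * p \<in> ?L"
      using add_multI[of 0 L p J r] submod_zero[OF sL] by (auto simp: algebra_simps)
    then show "x \<in> add_mult ?L 1 K" using x add_multI by metis
  qed
  have "regular_on rs ?K ?L"
    using regular_on_iso[OF sK sL'] int sum Cons.prems by auto
  moreover have "regular_on rs J ?K" using Cons.prems by auto
  moreover have "?L \<subseteq> ?K" using Cons.prems(4) by (auto simp: add_mult_def)
  moreover have "?K \<subseteq> J" using add_mult_subset sJ r Cons.prems by auto
  ultimately have "regular_on rs J ?L"
    using Cons.IH[OF sJ sK' sL'] Cons.prems by auto
  then show ?case using nzd1 nzd2 Cons.prems(4) by auto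
qed

text \<open>Multiplication by \<open>x\<close> induces an isomorphism from \<open>R / (L : x)\<close> to the cyclic module
\<open>(x R + L) / L\<close>.\<close>

lemma regular_on_cyclic:
  assumes "submod L" "set rs \<subseteq> R" "regular_on rs R {p\<in>R. x * p \<in> L}"
  shows "regular_on rs (add_mult L x R) L"
  using assms
proof (induction rs arbitrary: L)
  case Nil
  then obtain p where "p \<in> R" "x * p \<notin> L" by auto
  then show ?case using add_multI[of 0 L p R x] submod_zero[OF Nil.prems(1)] by auto
next
  case (Cons r rs)
  note sL = Cons.prems(1)
  have r: "r \<in> R" using Cons.prems by simp
  let ?J = "add_mult L x R" and ?C = "{p\<in>R. x * p \<in> L}"
  let ?L = "add_mult L r ?J"
  have sJ: "submod ?J" using submod_add_mult sL submod_R by blast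
  have sL': "submod ?L" using submod_add_mult sL sJ by blast
  have L'iff: "y \<in> ?L \<longleftrightarrow> (\<exists>s\<in>R. y - r * (x * s) \<in> L)" for y
  proof
    assume "y \<in> ?L"
    then obtain l l' s where y: "y = l + r * (l' + x * s)" "l \<in> L" "l' \<in> L" "s \<in> R"
      by (auto simp: add_mult_def)
    then have "y - r * (x * s) = l + r * l'" by (simp add: algebra_simps)
    then show "\<exists>s\<in>R. y - r * (x * s) \<in> L" using y submod_add[OF sL] submod_mult[OF sL r] by metis
  next
    assume "\<exists>s\<in>R. y - r * (x * s) \<in> L"
    then obtain s where "s \<in> R" "y - r * (x * s) \<in> L" by blast
    moreover have "0 + x * s \<in> ?J" using \<open>s \<in> R\<close> add_multI submod_zero[OF sL] by metis
    ultimately show "y \<in> ?L" using add_multI[of "y - r * (x * s)" L "x * s" ?J r] by simp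
  qed
  have colon: "{p\<in>R. x * p \<in> ?L} = add_mult ?C r R"
  proof (intro equalityI subsetI)
    fix p assume "p \<in> {p\<in>R. x * p \<in> ?L}"
    then obtain s where s: "p \<in> R" "s \<in> R" "x * p - r * (x * s) \<in> L" using L'iff by auto
    then have "x * (p - r * s) \<in> L" by (simp add: algebra_simps)
    then have "p - r * s \<in> ?C" using s r R_mult submod_diff[OF submod_R] by auto
    then show "p \<in> add_mult ?C r R" using add_multI[of "p - r * s" ?C s R r] s by simp
  next
    fix p assume "p \<in> add_mult ?C r R"
    then obtain c s where cs: "p = c + r * s" "c \<in> R" "x * c \<in> L" "s \<in> R" by (auto simp: add_mult_def)
    then have "x * p - r * (x * s) \<in> L" by (simp add: algebra_simps)
    then show "p \<in> {p\<in>R. x * p \<in> ?L}" using cs L'iff r R_add R_mult by auto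
  qed
  have sum: "add_mult ?L x R = ?J"
  proof (intro equalityI subsetI)
    fix y assume "y \<in> add_mult ?L x R"
    then obtain u s where "y = u + x * s" "u \<in> ?L" "s \<in> R"
      unfolding add_mult_def[of ?L x R] by blast
    moreover have "?L \<subseteq> ?J" using add_mult_subset[OF sJ r] add_mult_supset[OF submod_R] by blast
    moreover have "0 + x * s \<in> ?J" using \<open>s \<in> R\<close> add_multI submod_zero[OF sL] by metis
    ultimately show "y \<in> ?J" using submod_add[OF sJ] by auto
  next
    fix y assume "y \<in> ?J"
    then show "y \<in> add_mult ?L x R" using add_mult_mono[OF add_mult_supset[OF sJ, of L r]] by blast
  qed
  have "regular_on rs ?J ?L"
    using Cons.IH[OF sL'] Cons.prems colon sum by auto
  moreover have "q \<in> L" if q: "q \<in> ?J" "r * q \<in> L" for q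
  proof -
    obtain l s where ls: "q = l + x * s" "l \<in> L" "s \<in> R" using q by (auto simp: add_mult_def)
    have "x * (r * s) = r * q - r * l" using ls by (simp add: algebra_simps)
    then have "x * (r * s) \<in> L" using q ls submod_diff[OF sL] submod_mult[OF sL r] by metis
    then have "r * s \<in> ?C" using ls r R_mult by auto
    then have "s \<in> ?C" using Cons.prems(3) ls by auto
    then show ?thesis using ls submod_add[OF sL] by auto
  qed
  ultimately show ?case by simp
qed

end

section \<open>Ideals of families of faces\<close>

type_synonym ('v, 'k) mpoly = "('v \<Rightarrow>\<^sub>0 nat) \<Rightarrow>\<^sub>0 'k"

abbreviation lookup :: "('a \<Rightarrow>\<^sub>0 'b::zero) \<Rightarrow> 'a \<Rightarrow> 'b" where "lookup \<equiv> Poly_Mapping.lookup"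
abbreviation supp :: "('v \<Rightarrow>\<^sub>0 nat) \<Rightarrow> 'v set" where "supp \<equiv> Poly_Mapping.keys"
abbreviation monoms :: "('v, 'k::zero) mpoly \<Rightarrow> ('v \<Rightarrow>\<^sub>0 nat) set" where "monoms \<equiv> Poly_Mapping.keys"
abbreviation monom :: "('v \<Rightarrow>\<^sub>0 nat) \<Rightarrow> 'k \<Rightarrow> ('v, 'k::zero) mpoly" where "monom \<equiv> Poly_Mapping.single"

text \<open>The intersection of the primes \<open>P F\<close>, \<open>F \<in> \<F>\<close>, where \<open>P F\<close> is generated by the variables outside
\<open>F\<close>: such a monomial ideal contains a polynomial if and only if it contains all its monomials. For
the facets of a complex it is the Stanley-Reisner ideal; the empty family gives the ring \<open>k[V]\<close>.\<close>

definition face_ideal :: "'v set \<Rightarrow> 'v set set \<Rightarrow> ('v, 'k::field) mpoly set" where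
  "face_ideal V \<F> = {p. \<forall>m\<in>monoms p. supp m \<subseteq> V \<and> (\<forall>F\<in>\<F>. \<not> supp m \<subseteq> F)}"

abbreviation polys :: "'v set \<Rightarrow> ('v, 'k::field) mpoly set" where
  "polys V \<equiv> face_ideal V {}"

definition sqfree :: "'v set \<Rightarrow> ('v \<Rightarrow>\<^sub>0 nat)" where
  "sqfree A = (\<Sum>v\<in>A. Poly_Mapping.single v 1)"

lemma supp_add: "supp (m + n) = supp m \<union> supp (n :: 'v \<Rightarrow>\<^sub>0 nat)"
  by (auto simp: in_keys_iff lookup_add)

lemma supp_sum: "finite A \<Longrightarrow> supp (sum f A) = (\<Union>a\<in>A. supp (f a :: 'v \<Rightarrow>\<^sub>0 nat))"
  by (induction A rule: finite_induct) (auto simp: supp_add)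

lemma supp_sqfree [simp]: "finite A \<Longrightarrow> supp (sqfree A) = A"
  by (auto simp: sqfree_def supp_sum)

lemma lookup_sqfree: "finite A \<Longrightarrow> lookup (sqfree A) v = (if v \<in> A then 1 else 0)"
  by (auto simp: sqfree_def lookup_sum lookup_single when_def sum.delta' cong: if_cong)

lemma sqfree_divides:
  assumes "finite A" "A \<subseteq> supp m"
  obtains n where "m = sqfree A + n"
proof
  show "m = sqfree A + (m - sqfree A)"
  proof (rule poly_mapping_eqI)
    fix v show "lookup m v = lookup (sqfree A + (m - sqfree A)) v"
      using assms by (auto simp: lookup_add lookup_minus lookup_sqfree in_keys_iff subset_iff)
  qed
qed

lemma monoms_mult: "m \<in> monoms (p * q) \<Longrightarrow> \<exists>a\<in>monoms p. \<exists>b\<in>monoms q. m = a + b"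
  using keys_mult[of p q] by blast

lemma monoms_add: "m \<in> monoms (p + q) \<Longrightarrow> m \<in> monoms p \<or> m \<in> monoms q"
  using keys_add[of p q] by auto

lemma monoms_uminus [simp]: "monoms (- p) = monoms (p :: ('v, 'k::field) mpoly)"
  by (auto simp: in_keys_iff)

lemma monoms_monom_mult:
  assumes "c \<noteq> 0"
  shows "monoms (monom m c * p) = (+) m ` monoms (p :: ('v, 'k::field) mpoly)"
proof -
  have 1: "lookup (monom m c * p) (m + n) = c * lookup p n" for n
    by (simp add: lookup_mult lookup_single when_mult)
  show ?thesis
    using monoms_mult[of _ "monom m c" p] 1 assms by (auto simp: in_keys_iff image_iff split: if_splits)
qed

lemma poly_sum_monoms: "p = (\<Sum>m\<in>monoms p. monom m (lookup p m))"
  by (rule poly_mapping_eqI)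
    (auto simp: lookup_sum lookup_single when_def sum.delta in_keys_iff)

lemma face_ideal_antimono: "\<F> \<subseteq> \<G> \<Longrightarrow> face_ideal V \<G> \<subseteq> face_ideal V \<F>"
  by (auto simp: face_ideal_def)

lemma monom_in_face_ideal:
  "monom m c \<in> face_ideal V \<F> \<longleftrightarrow> c = 0 \<or> supp m \<subseteq> V \<and> (\<forall>F\<in>\<F>. \<not> supp m \<subseteq> F)"
  by (auto simp: face_ideal_def)

lemma one_in_polys: "1 \<in> polys V"
  using monom_in_face_ideal[of 0 1 V "{}"] by simp

lemma face_ideal_subset_polys: "face_ideal V \<F> \<subseteq> polys V"
  by (auto simp: face_ideal_def)

lemma face_idealI:
  "(\<And>m. m \<in> monoms p \<Longrightarrow> supp m \<subseteq> V) \<Longrightarrow> (\<And>m F. m \<in> monoms p \<Longrightarrow> F \<in> \<F> \<Longrightarrow> \<not> supp m \<subseteq> F)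
    \<Longrightarrow> p \<in> face_ideal V \<F>"
  by (auto simp: face_ideal_def)

lemma face_idealD:
  assumes "p \<in> face_ideal V \<F>" "m \<in> monoms p"
  shows "supp m \<subseteq> V" "F \<in> \<F> \<Longrightarrow> \<not> supp m \<subseteq> F"
  using assms by (auto simp: face_ideal_def)

lemma subring_polys: "subring_set (polys V :: ('v, 'k::field) mpoly set)"
proof
  show "1 \<in> polys V" by (rule one_in_polys)
  fix a b :: "('v, 'k) mpoly" assume "a \<in> polys V" "b \<in> polys V"
  note ab = this
  show "a + b \<in> polys V" using ab monoms_add[of _ a b] by (auto simp: face_ideal_def)
  show "- a \<in> polys V" using ab by (simp add: face_ideal_def)
  show "a * b \<in> polys V"
  proof (rule face_idealI)
    fix m assume "m \<in> monoms (a * b)"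
    then obtain x y where "x \<in> monoms a" "y \<in> monoms b" "m = x + y" using monoms_mult by blast
    then show "supp m \<subseteq> V" using ab face_idealD(1) by (metis supp_add Un_least)
  qed simp
qed

text \<open>Closure under addition and under multiplication by \<open>k[V]\<close>; being contained in \<open>k[V]\<close> is a separate
condition.\<close>

abbreviation poly_ideal :: "'v set \<Rightarrow> ('v, 'k::field) mpoly set \<Rightarrow> bool" where
  "poly_ideal V \<equiv> subring_set.submod (polys V)"

lemma poly_ideal_face_ideal: "poly_ideal V (face_ideal V \<F>)"
proof -
  have "a * x \<in> face_ideal V \<F>" if "a \<in> polys V" "x \<in> face_ideal V \<F>" for a x
  proof (rule face_idealI)
    fix m assume "m \<in> monoms (a * x)"
    then obtain k l where kl: "k \<in> monoms a" "l \<in> monoms x" "m = k + l" using monoms_mult by blast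
    then show "supp m \<subseteq> V" using that face_idealD(1) by (metis supp_add Un_least)
    show "\<not> supp m \<subseteq> F" if "F \<in> \<F>" for F
      using face_idealD(2)[OF \<open>x \<in> face_ideal V \<F>\<close> kl(2) that] kl(3) by (auto simp: supp_add)
  qed
  moreover have "x + y \<in> face_ideal V \<F>" if "x \<in> face_ideal V \<F>" "y \<in> face_ideal V \<F>" for x y
    using that by (auto simp: face_ideal_def dest!: monoms_add)
  moreover have "0 \<in> face_ideal V \<F>" by (simp add: face_ideal_def)
  ultimately show ?thesis unfolding subring_set.submod_def[OF subring_polys] by blast
qed

lemma poly_ideal_by_monoms:
  assumes "poly_ideal V J" "\<And>m. m \<in> monoms p \<Longrightarrow> monom m (lookup p m) \<in> J"
  shows "p \<in> J"
  using subring_set.submod_sum[OF subring_polys assms(1), of "monoms p" "\<lambda>m. monom m (lookup p m)"] assms(2)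
    poly_sum_monoms[of p] by simp

lemma monom_sqfree_mult:
  assumes "finite A" "A \<subseteq> supp m"
  obtains n where "m = sqfree A + n" "supp n \<subseteq> supp m" "\<And>c. monom m c = monom (sqfree A) 1 * monom n (c :: 'k::field)"
proof -
  obtain n where "m = sqfree A + n" using sqfree_divides assms by blast
  then show thesis using that[of n] by (auto simp: mult_single supp_add)
qed

text \<open>Multiplying by the squarefree monomial of \<open>A\<close> enlarges the support of every monomial by \<open>A\<close>.\<close>

lemma colon_face_ideal:
  fixes V :: "'v set"
  assumes "finite A"
  shows "monom (sqfree A) (1::'k::field) * p \<in> face_ideal V \<F> \<longleftrightarrow>
    (\<forall>m\<in>monoms p. A \<union> supp m \<subseteq> V \<and> (\<forall>F\<in>\<F>. \<not> A \<union> supp m \<subseteq> F))"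
  using assms by (simp add: face_ideal_def monoms_monom_mult supp_add)

lemma monom_sqfree_in: "finite A \<Longrightarrow> A \<subseteq> V \<Longrightarrow> monom (sqfree A) 1 \<in> polys V"
  by (simp add: monom_in_face_ideal)

section \<open>Elementary symmetric polynomials on shellable quotients\<close>

text \<open>Adding one facet of a shelling: the monomials killed are those supported in \<open>F\<close> and containing the
restriction \<open>A\<close>, so the quotient is generated by the monomial of \<open>A\<close>, with annihilator the prime
of \<open>F\<close>.\<close>

lemma face_ideal_step:
  fixes V :: "'v set" and rs :: "('v, 'k::field) mpoly list"
  assumes V: "finite V" "F \<subseteq> V" and A: "A \<subseteq> F"
    and cond: "\<And>B. B \<subseteq> F \<Longrightarrow> (\<forall>F'\<in>\<A>. \<not> B \<subseteq> F') \<longleftrightarrow> A \<subseteq> B"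
    and rs: "set rs \<subseteq> polys V" "regular_on rs (polys V) (face_ideal V {F})"
  shows "regular_on rs (face_ideal V \<A>) (face_ideal V (insert F \<A>))"
proof -
  interpret subring_set "polys V :: ('v, 'k) mpoly set" by (rule subring_polys)
  let ?x = "monom (sqfree A) 1 :: ('v, 'k) mpoly" and ?L = "face_ideal V (insert F \<A>) :: ('v, 'k) mpoly set"
  have fA: "finite A" using V A by (meson finite_subset)
  have L: "poly_ideal V ?L" and K: "poly_ideal V (face_ideal V \<A> :: ('v, 'k) mpoly set)"
    by (rule poly_ideal_face_ideal)+
  have A': "\<not> A \<subseteq> F'" if "F' \<in> \<A>" for F' using cond[OF A] that by auto
  have colon: "{p \<in> polys V. ?x * p \<in> ?L} = face_ideal V {F}"
  proof (intro equalityI subsetI)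
    fix p assume p: "p \<in> {p \<in> polys V. ?x * p \<in> ?L}"
    show "p \<in> face_ideal V {F}"
    proof (rule face_idealI)
      fix m assume m: "m \<in> monoms p"
      have "A \<union> supp m \<subseteq> V \<and> \<not> A \<union> supp m \<subseteq> F"
        using p m unfolding mem_Collect_eq colon_face_ideal[OF fA] by simp
      then show "\<not> supp m \<subseteq> F'" if "F' \<in> {F}" for F' using that A by auto
      show "supp m \<subseteq> V" using \<open>A \<union> supp m \<subseteq> V \<and> \<not> A \<union> supp m \<subseteq> F\<close> by simp
    qed
  next
    fix p :: "('v, 'k) mpoly" assume p: "p \<in> face_ideal V {F}"
    have "A \<union> supp m \<subseteq> V \<and> (\<forall>F'\<in>insert F \<A>. \<not> A \<union> supp m \<subseteq> F')" if "m \<in> monoms p" for m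
      using face_idealD[OF p that] A A' V(2) by auto
    then have "?x * p \<in> ?L" unfolding colon_face_ideal[OF fA] by blast
    then show "p \<in> {p \<in> polys V. ?x * p \<in> ?L}" using p face_ideal_subset_polys by blast
  qed
  have "add_mult ?L ?x (polys V) = face_ideal V \<A>"
  proof (intro equalityI subsetI)
    fix p assume "p \<in> add_mult ?L ?x (polys V)"
    then obtain k q where "p = k + ?x * q" "k \<in> ?L" "q \<in> polys V" by (auto simp: add_mult_def)
    moreover have "?x * q \<in> face_ideal V \<A>"
      unfolding colon_face_ideal[OF fA]
      using A' A V(2) face_idealD(1)[OF \<open>q \<in> polys V\<close>] by blast
    moreover have "?L \<subseteq> face_ideal V \<A>" by (rule face_ideal_antimono) auto
    ultimately show "p \<in> face_ideal V \<A>" using submod_add[OF K] by blast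
  next
    fix p :: "('v, 'k) mpoly" assume p: "p \<in> face_ideal V \<A>"
    show "p \<in> add_mult ?L ?x (polys V)"
    proof (rule poly_ideal_by_monoms)
      show sub: "poly_ideal V (add_mult ?L ?x (polys V))" using submod_add_mult[OF L submod_R] .
      fix m assume m: "m \<in> monoms p"
      show "monom m (lookup p m) \<in> add_mult ?L ?x (polys V)"
      proof (cases "supp m \<subseteq> F")
        case False
        then have "monom m (lookup p m) \<in> ?L" using p m by (auto simp: face_ideal_def)
        then show ?thesis using add_mult_supset[OF submod_R] by blast
      next
        case True
        then have "A \<subseteq> supp m" using cond[OF True] p m by (auto simp: face_ideal_def)
        then obtain n where n: "supp n \<subseteq> supp m" "monom m (lookup p m) = ?x * monom n (lookup p m)"
          using monom_sqfree_mult[OF fA] by metis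
        moreover have "monom n (lookup p m) \<in> polys V"
          using n p m by (auto simp: face_ideal_def)
        ultimately show ?thesis using add_multI[of 0 ?L "monom n (lookup p m)" "polys V" ?x] submod_zero[OF L] by simp
      qed
    qed
  qed
  then show ?thesis using regular_on_cyclic[OF L rs(1), of ?x] colon rs(2) by simp
qed

text \<open>The faces in \<open>\<B>\<close> are present from the start; those in \<open>\<A>\<close> are added in the order of \<open>\<rho>\<close>, each
contributing a cyclic factor on which the sequence is regular.\<close>

lemma pure_shelling_regular:
  fixes V :: "'v set" and rs :: "('v, 'k::field) mpoly list"
  assumes "finite V" "finite \<A>" "\<A> \<noteq> {}" "inj_on \<rho> \<A>" and rs: "set rs \<subseteq> polys V"
    and "\<And>F. F \<in> \<A> \<Longrightarrow> F \<subseteq> V \<and> regular_on rs (polys V) (face_ideal V {F})"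
    and "\<And>F. F \<in> \<A> \<Longrightarrow> \<exists>R\<subseteq>F. \<forall>A\<subseteq>F. (\<forall>F'\<in>\<B> \<union> {F'\<in>\<A>. \<rho> F' < (\<rho> F :: nat)}. \<not> A \<subseteq> F') \<longleftrightarrow> R \<subseteq> A"
  shows "regular_on rs (face_ideal V \<B>) (face_ideal V (\<B> \<union> \<A>))"
  using assms(2-4,6-)
proof (induction "card \<A>" arbitrary: \<A>)
  case 0
  then show ?case by simp
next
  case (Suc n)
  interpret subring_set "polys V :: ('v, 'k) mpoly set" by (rule subring_polys)
  \<comment> \<open>The last facet gives the submodule of the extension, the others its quotient.\<close>
  obtain F where F: "F \<in> \<A>" "\<And>F'. F' \<in> \<A> \<Longrightarrow> \<rho> F' \<le> \<rho> F"
    using Suc.prems(1,2) Max_in[of "\<rho> ` \<A>"] Max_ge[of "\<rho> ` \<A>"] by (metis (no_types, lifting) finite_imageI image_iff image_is_empty)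
  let ?A = "\<A> - {F}"
  have lt: "{F'\<in>\<A>. \<rho> F' < \<rho> F} = ?A"
    using F Suc.prems(3) by (auto simp: inj_on_def order.strict_iff_order)
  obtain R where R: "R \<subseteq> F" "\<And>A. A \<subseteq> F \<Longrightarrow> (\<forall>F'\<in>\<B> \<union> ?A. \<not> A \<subseteq> F') \<longleftrightarrow> R \<subseteq> A"
    using Suc.prems(5)[OF F(1)] lt by metis
  have step: "regular_on rs (face_ideal V (\<B> \<union> ?A)) (face_ideal V (insert F (\<B> \<union> ?A)))"
    using face_ideal_step[OF assms(1) _ R rs] Suc.prems(4)[OF F(1)] by blast
  have eq: "insert F (\<B> \<union> ?A) = \<B> \<union> \<A>" using F by auto
  show ?case
  proof (cases "?A = {}")
    case True
    then show ?thesis using step eq by (metis Un_empty_right)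
  next
    case False
    have lt': "{F''\<in>?A. \<rho> F'' < \<rho> F'} = {F''\<in>\<A>. \<rho> F'' < \<rho> F'}" if "F' \<in> ?A" for F'
      using F that by force
    have "regular_on rs (face_ideal V \<B>) (face_ideal V (\<B> \<union> ?A))"
    proof (rule Suc.hyps(1))
      show "n = card ?A" using Suc F by simp
      show "inj_on \<rho> ?A" using Suc.prems(3) by (rule inj_on_diff)
      show "\<exists>R\<subseteq>F'. \<forall>A\<subseteq>F'. (\<forall>F''\<in>\<B> \<union> {F''\<in>?A. \<rho> F'' < \<rho> F'}. \<not> A \<subseteq> F'') \<longleftrightarrow> R \<subseteq> A" if "F' \<in> ?A" for F'
        using Suc.prems(5)[of F'] that lt'[OF that] by simp
    qed (use Suc.prems False in auto)
    then show ?thesis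
      using regular_on_extension[OF poly_ideal_face_ideal poly_ideal_face_ideal poly_ideal_face_ideal _ _ rs]
        step eq by (metis Un_upper1 Un_Diff_cancel face_ideal_antimono subset_insertI)
  qed
qed

text \<open>The elementary symmetric polynomial of degree \<open>k\<close> in all variables, including those outside any
given face.\<close>

definition esym :: "'v set \<Rightarrow> nat \<Rightarrow> ('v, 'k::field) mpoly" where
  "esym V k = (\<Sum>A | A \<subseteq> V \<and> card A = k. monom (sqfree A) 1)"

text \<open>Degrees run downwards: with the top degree first, each step only involves faces of one size less.\<close>

fun esyms :: "'v set \<Rightarrow> nat \<Rightarrow> ('v, 'k::field) mpoly list" where
  "esyms V 0 = []"
| "esyms V (Suc k) = esym V (Suc k) # esyms V k"

lemma length_esyms [simp]: "length (esyms V k) = k"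
  by (induction k) auto

lemma esym_in: "finite V \<Longrightarrow> esym V k \<in> polys V"
  unfolding esym_def
  by (intro subring_set.submod_sum[OF subring_polys poly_ideal_face_ideal] monom_sqfree_in)
    (auto intro: finite_subset)

lemma esyms_in: "finite V \<Longrightarrow> set (esyms V k) \<subseteq> polys V"
  by (induction k) (auto simp: esym_in)

text \<open>By induction on the size \<open>d\<close> of \<open>F\<close>. Modulo the prime of \<open>F\<close>, the only surviving term of the
symmetric polynomial of degree \<open>d\<close> is the product of the variables in \<open>F\<close>. It is a nonzerodivisor,
and dividing by it leaves the ideal of the boundary of the simplex \<open>F\<close>. The facets of the boundary
have size \<open>d - 1\<close>, and every order of them is a shelling.\<close>

lemma esyms_regular:
  fixes V :: "'v set"
  assumes V: "finite V"
  shows "F \<subseteq> V \<Longrightarrow> regular_on (esyms V (card F)) (polys V) (face_ideal V {F} :: ('v, 'k::field) mpoly set)"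
proof (induction "card F" arbitrary: F)
  case 0
  then have "F = {}" using V finite_subset by (metis card_0_eq)
  then have "1 \<notin> face_ideal V {F}" by (simp add: face_ideal_def)
  then show ?case using one_in_polys 0 by fastforce
next
  case (Suc d)
  interpret subring_set "polys V :: ('v, 'k) mpoly set" by (rule subring_polys)
  let ?I = "face_ideal V {F} :: ('v, 'k) mpoly set" and ?x = "monom (sqfree F) 1 :: ('v, 'k) mpoly"
  let ?e = "esym V (card F) :: ('v, 'k) mpoly"
  let ?A = "(\<lambda>v. F - {v}) ` F"
  have fF: "finite F" using Suc.prems V finite_subset by blast
  have I: "poly_ideal V ?I" by (rule poly_ideal_face_ideal)
  define r where "r = ?e - ?x"
  have rsum: "r = (\<Sum>A\<in>{A. A \<subseteq> V \<and> card A = card F} - {F}. monom (sqfree A) 1)"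
    unfolding r_def esym_def using V Suc.prems by (subst sum_diff1) auto
  have "monom (sqfree A) 1 \<in> ?I" if "A \<in> {A. A \<subseteq> V \<and> card A = card F} - {F}" for A
  proof -
    have "finite A" using that V finite_subset by blast
    then show ?thesis using that card_subset_eq[OF fF, of A] by (auto simp: monom_in_face_ideal)
  qed
  then have r: "r \<in> ?I" unfolding rsum by (intro submod_sum[OF I])
  have e: "?e = ?x + r" by (simp add: r_def)
  have rp: "r * p \<in> ?I" if "p \<in> polys V" for p
    using submod_mult[OF I that r] by (simp add: mult.commute)
  \<comment> \<open>Multiplication by the monomial of \<open>F\<close> neither creates nor destroys support outside \<open>F\<close>.\<close>
  have nzd: "p \<in> ?I" if p: "p \<in> polys V" "?e * p \<in> ?I" for p
  proof -
    have "?x * p = ?e * p - r * p" by (simp add: e algebra_simps)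
    then have "?x * p \<in> ?I" using submod_diff[OF I p(2) rp[OF p(1)]] by simp
    then have "\<forall>m\<in>monoms p. F \<union> supp m \<subseteq> V \<and> (\<forall>F'\<in>{F}. \<not> F \<union> supp m \<subseteq> F')"
      unfolding colon_face_ideal[OF fF] .
    then show ?thesis by (intro face_idealI) auto
  qed
  have quot: "add_mult ?I ?e (polys V) = face_ideal V ?A"
  proof (intro equalityI subsetI)
    fix p assume "p \<in> add_mult ?I ?e (polys V)"
    then obtain k q where p: "p = k + ?e * q" "k \<in> ?I" "q \<in> polys V" by (auto simp: add_mult_def)
    have "k \<in> face_ideal V ?A" using p(2) by (fastforce simp: face_ideal_def)
    moreover have "?e \<in> face_ideal V ?A"
      unfolding esym_def
    proof (intro submod_sum[OF poly_ideal_face_ideal])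
      fix B assume B: "B \<in> {A. A \<subseteq> V \<and> card A = card F}"
      then have "finite B" using V finite_subset by blast
      moreover have "\<not> B \<subseteq> F - {v}" if "v \<in> F" for v
        using card_mono[of "F - {v}" B] that fF B Suc.hyps(2) by auto
      ultimately show "monom (sqfree B) 1 \<in> face_ideal V ?A"
        using B by (auto simp: monom_in_face_ideal)
    qed
    ultimately show "p \<in> face_ideal V ?A"
      using p submod_add submod_mult[of _ q ?e] poly_ideal_face_ideal by (metis mult.commute)
  next
    fix p :: "('v, 'k) mpoly" assume p: "p \<in> face_ideal V ?A"
    show "p \<in> add_mult ?I ?e (polys V)"
    proof (rule poly_ideal_by_monoms)
      show sub: "poly_ideal V (add_mult ?I ?e (polys V))" using submod_add_mult[OF I submod_R] .
      fix m assume m: "m \<in> monoms p"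
      show "monom m (lookup p m) \<in> add_mult ?I ?e (polys V)"
      proof (cases "supp m \<subseteq> F")
        case False
        then have "monom m (lookup p m) \<in> ?I" using p m by (auto simp: face_ideal_def)
        then show ?thesis using add_mult_supset[OF submod_R] by blast
      next
        case True
        have "\<not> supp m \<subseteq> F - {v}" if "v \<in> F" for v using face_idealD(2)[OF p m] that by blast
        then have "F \<subseteq> supp m" using True by blast
        then obtain n where n: "supp n \<subseteq> supp m" "monom m (lookup p m) = ?x * monom n (lookup p m)"
          using monom_sqfree_mult[OF fF] by metis
        let ?n = "monom n (lookup p m)"
        have nV: "?n \<in> polys V"
          using n p m by (auto simp: face_ideal_def)
        have "monom m (lookup p m) = - (r * ?n) + ?e * ?n" using n(2) by (simp add: e algebra_simps)
        then show ?thesis using add_multI[of "- (r * ?n)" ?I ?n "polys V" ?e] nV rp submod_uminus[OF I] by simp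
      qed
    qed
  qed
  obtain \<rho> :: "'v set \<Rightarrow> nat" where \<rho>: "inj_on \<rho> ?A"
    using finite_imp_inj_to_nat_seg[of ?A] fF by auto
  have "regular_on (esyms V d) (face_ideal V {}) (face_ideal V ({} \<union> ?A) :: ('v, 'k) mpoly set)"
  proof (rule pure_shelling_regular[OF V _ _ \<rho> esyms_in[OF V]])
    show "finite ?A" using fF by simp
    show "?A \<noteq> {}" using Suc.hyps(2) by auto
    fix F' assume F': "F' \<in> ?A"
    then obtain v where v: "v \<in> F" "F' = F - {v}" by blast
    then show "F' \<subseteq> V \<and> regular_on (esyms V d) (polys V) (face_ideal V {F'} :: ('v, 'k) mpoly set)"
    proof -
      have "card F' = d" "F' \<subseteq> V" using v fF Suc.hyps(2) Suc.prems by auto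
      then show ?thesis using Suc.hyps(1)[of F'] by auto
    qed
    \<comment> \<open>A subset of \<open>F\<close> is not contained in \<open>F - {w}\<close> if and only if it contains \<open>w\<close>.\<close>
    let ?R = "{w\<in>F. \<rho> (F - {w}) < \<rho> F'}"
    show "\<exists>R\<subseteq>F'. \<forall>A\<subseteq>F'. (\<forall>F''\<in>{} \<union> {F''\<in>?A. \<rho> F'' < \<rho> F'}. \<not> A \<subseteq> F'') \<longleftrightarrow> R \<subseteq> A"
    proof (intro exI[of _ ?R] conjI allI impI)
      show "?R \<subseteq> F'" using v by auto
      fix A assume "A \<subseteq> F'"
      then show "(\<forall>F''\<in>{} \<union> {F''\<in>?A. \<rho> F'' < \<rho> F'}. \<not> A \<subseteq> F'') \<longleftrightarrow> ?R \<subseteq> A"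
        using v by auto
    qed
  qed
  then show ?case using nzd quot Suc.hyps(2)[symmetric] by simp
qed

theorem shelling_regular:
  fixes V :: "'v set"
  assumes "finite V" "finite \<F>" "shelling \<F> \<rho>" "\<And>F. F \<in> \<F> \<Longrightarrow> F \<subseteq> V" "F0 \<in> \<F>"
  shows "regular_on (esyms V (card F0)) (face_ideal V {F\<in>\<F>. card F0 < card F})
           (face_ideal V {F\<in>\<F>. card F0 \<le> card F} :: ('v, 'k::field) mpoly set)"
proof -
  let ?A = "{F\<in>\<F>. card F = card F0}" and ?B = "{F\<in>\<F>. card F0 < card F}"
  have eq: "{F\<in>\<F>. card F0 \<le> card F} = ?B \<union> ?A" by auto
  have "regular_on (esyms V (card F0)) (face_ideal V ?B) (face_ideal V (?B \<union> ?A) :: ('v, 'k) mpoly set)"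
  proof (rule pure_shelling_regular[OF assms(1)])
    show "inj_on \<rho> ?A" using assms(3) by (auto simp: shelling_def inj_on_def)
    fix F assume F: "F \<in> ?A"
    then show "F \<subseteq> V \<and> regular_on (esyms V (card F0)) (polys V) (face_ideal V {F} :: ('v, 'k) mpoly set)"
      using esyms_regular[OF assms(1), of F] assms(4) by auto
    have "?B \<union> {F'\<in>?A. \<rho> F' < \<rho> F} = earlier \<F> \<rho> F" using F by (auto simp: earlier_def)
    then show "\<exists>R\<subseteq>F. \<forall>A\<subseteq>F. (\<forall>F'\<in>?B \<union> {F'\<in>?A. \<rho> F' < \<rho> F}. \<not> A \<subseteq> F') \<longleftrightarrow> R \<subseteq> A"
      using assms(3) F unfolding shelling_def by simp
  next
    show "set (esyms V (card F0)) \<subseteq> (polys V :: ('v, 'k) mpoly set)" by (rule esyms_in[OF assms(1)])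
  qed (use assms in auto)
  then show ?thesis using eq by simp
qed

section \<open>A dimension bound by counting monomials\<close>

fun power_prod :: "'a::comm_ring_1 list \<Rightarrow> nat list \<Rightarrow> 'a" where
  "power_prod [] as = 1"
| "power_prod (r # rs) as = r ^ hd as * power_prod rs (tl as)"

lemma (in subring_set) R_power: "a \<in> R \<Longrightarrow> a ^ k \<in> R"
  by (induction k) (auto simp: R_one R_mult)

lemma (in subring_set) power_prod_in: "set rs \<subseteq> R \<Longrightarrow> power_prod rs as \<in> R"
  by (induction rs arbitrary: as) (auto simp: R_one R_mult R_power)

lemma (in subring_set) nzd_power:
  assumes "\<And>a. a \<in> R \<Longrightarrow> r * a \<in> L \<Longrightarrow> a \<in> L" "r \<in> R" "a \<in> R" "r ^ k * a \<in> L"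
  shows "a \<in> L"
  using assms(4)
proof (induction k)
  case (Suc k)
  then show ?case using assms(1)[of "r ^ k * a"] R_mult R_power assms(2,3) by (simp add: mult.assoc)
qed simp

text \<open>The family \<open>c\<close> consists of units, the nonzero constants in the application. Suppose a combination
lies in \<open>L 0\<close> and divide it by the lowest power of the first element that occurs. The terms still
divisible by that element lie in \<open>L 1\<close>; so the remaining terms, a combination of monomials in the
other elements, lie in \<open>L 1\<close> too. At the end a unit would lie in the last ideal.\<close>

lemma (in subring_set) power_prod_independent:
  assumes "finite A" "A \<noteq> {}" "\<And>as. as \<in> A \<Longrightarrow> length as = length rs"
    and "\<And>as. as \<in> A \<Longrightarrow> c as \<in> R \<and> (\<exists>u\<in>R. u * c as = 1)"
    and "\<And>i. i \<le> length rs \<Longrightarrow> submod (L i)"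
    and "\<And>i. i < length rs \<Longrightarrow> rs ! i \<in> R \<and> rs ! i \<in> L (Suc i) \<and> L i \<subseteq> L (Suc i)"
    and "\<And>i a. i < length rs \<Longrightarrow> a \<in> R \<Longrightarrow> rs ! i * a \<in> L i \<Longrightarrow> a \<in> L i"
    and "1 \<notin> L (length rs)"
  shows "(\<Sum>as\<in>A. c as * power_prod rs as) \<notin> L 0"
  using assms
proof (induction rs arbitrary: A L c)
  case Nil
  then have "A = {[]}" by auto
  moreover obtain u where "u \<in> R" "u * c [] = 1" using Nil calculation by auto
  ultimately show ?case using submod_mult[of "L 0" u "c []"] Nil by auto
next
  case (Cons r rs)
  define h where "h = Min (hd ` A)"
  have h: "h \<in> hd ` A" "\<And>as. as \<in> A \<Longrightarrow> h \<le> hd as"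
    using Cons.prems(1,2) by (auto simp: h_def intro!: Min_in)
  have r: "r \<in> R" "r \<in> L 1" "L 0 \<subseteq> L 1" using Cons.prems(6)[of 0] by auto
  have rs: "set rs \<subseteq> R"
    using Cons.prems(6)[of "Suc i" for i] by (auto simp: in_set_conv_nth)
  have L0: "submod (L 0)" and L1: "submod (L 1)" using Cons.prems(5)[of 0] Cons.prems(5)[of 1] by auto
  let ?P = "\<lambda>as. power_prod rs (tl as)"
  let ?B = "{as\<in>A. hd as = h}"
  have inj: "inj_on tl ?B"
    using Cons.prems(3) by (intro inj_onI) (metis (mono_tags, lifting) length_0_conv list.collapse list.size(3) mem_Collect_eq nat.simps(3) length_Cons)
  have nz: "as \<noteq> []" if "as \<in> A" for as using Cons.prems(3)[OF that] by auto
  have mem: "c as * ?P as \<in> R" if "as \<in> A" for as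
    using Cons.prems(4)[OF that] power_prod_in[OF rs] R_mult by auto
  show ?case
  proof
    assume sum0: "(\<Sum>as\<in>A. c as * power_prod (r # rs) as) \<in> L 0"
    let ?S = "\<Sum>as\<in>A. r ^ (hd as - h) * (c as * ?P as)"
    have "(\<Sum>as\<in>A. c as * power_prod (r # rs) as) = r ^ h * ?S"
      unfolding sum_distrib_left
    proof (rule sum.cong)
      fix as assume "as \<in> A"
      then have "r ^ hd as = r ^ h * r ^ (hd as - h)" using h(2) by (simp flip: power_add)
      then show "c as * power_prod (r # rs) as = r ^ h * (r ^ (hd as - h) * (c as * ?P as))"
        by (simp add: algebra_simps)
    qed simp
    moreover have "?S \<in> R" by (intro submod_sum[OF submod_R] R_mult[OF R_power[OF r(1)] mem])
    ultimately have "?S \<in> L 0"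
      using nzd_power[of r "L 0" ?S h] Cons.prems(7)[of 0] r(1) sum0 by auto
    then have S1: "?S \<in> L 1" using r(3) by blast
    have "?S = (\<Sum>as\<in>?B. r ^ (hd as - h) * (c as * ?P as)) + (\<Sum>as\<in>A - ?B. r ^ (hd as - h) * (c as * ?P as))"
      using Cons.prems(1) sum.subset_diff[of ?B A "\<lambda>as. r ^ (hd as - h) * (c as * ?P as)"]
      by (simp add: add.commute)
    moreover have "(\<Sum>as\<in>A - ?B. r ^ (hd as - h) * (c as * ?P as)) \<in> L 1"
    proof (intro submod_sum[OF L1])
      fix as assume as: "as \<in> A - ?B"
      then have "hd as - h = Suc (hd as - h - 1)" using h(2)[of as] by auto
      then obtain k where "hd as - h = Suc k" by blast
      moreover have "(r ^ k * (c as * ?P as)) * r \<in> L 1"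
        using submod_mult[OF L1 _ r(2)] as mem R_mult R_power r(1) by auto
      ultimately show "r ^ (hd as - h) * (c as * ?P as) \<in> L 1" by (simp add: algebra_simps)
    qed
    ultimately have "(\<Sum>as\<in>?B. r ^ (hd as - h) * (c as * ?P as)) \<in> L 1"
      using submod_diff[OF L1 S1] by (metis (no_types, lifting) add_diff_cancel_right')
    moreover have "(\<Sum>as\<in>?B. r ^ (hd as - h) * (c as * ?P as)) = (\<Sum>bs\<in>tl ` ?B. c (h # bs) * power_prod rs bs)"
      using nz by (subst sum.reindex[OF inj]) (auto intro!: sum.cong)
    moreover have "(\<Sum>bs\<in>tl ` ?B. c (h # bs) * power_prod rs bs) \<notin> L (Suc 0)"
    proof (rule Cons.IH[of "tl ` ?B" "\<lambda>bs. c (h # bs)" "\<lambda>i. L (Suc i)"])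
      show "finite (tl ` ?B)" "tl ` ?B \<noteq> {}" using Cons.prems(1) h(1) by auto
      show "length as = length rs" if "as \<in> tl ` ?B" for as using that Cons.prems(3) by auto
      show "c (h # as) \<in> R \<and> (\<exists>u\<in>R. u * c (h # as) = 1)" if as: "as \<in> tl ` ?B" for as
      proof -
        obtain bs where "bs \<in> A" "hd bs = h" "as = tl bs" using as by auto
        then have "h # as \<in> A" using nz[of bs] by (metis list.collapse)
        then show ?thesis using Cons.prems(4) by blast
      qed
      show "submod (L (Suc i))" if "i \<le> length rs" for i using that Cons.prems(5)[of "Suc i"] by auto
      show "rs ! i \<in> R \<and> rs ! i \<in> L (Suc (Suc i)) \<and> L (Suc i) \<subseteq> L (Suc (Suc i))" if "i < length rs" for i
        using that Cons.prems(6)[of "Suc i"] by auto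
      show "a \<in> L (Suc i)" if "i < length rs" "a \<in> R" "rs ! i * a \<in> L (Suc i)" for i a
        using that Cons.prems(7)[of "Suc i" a] by auto
      show "1 \<notin> L (Suc (length rs))" using Cons.prems(8) by auto
    qed
    ultimately show False by simp
  qed
qed

definition exps_le :: "nat \<Rightarrow> ('v, 'k::field) mpoly \<Rightarrow> bool" where
  "exps_le N p \<longleftrightarrow> (\<forall>m\<in>monoms p. \<forall>v. lookup m v \<le> N)"

lemma exps_le_mono: "exps_le M p \<Longrightarrow> M \<le> N \<Longrightarrow> exps_le N p"
  by (auto simp: exps_le_def intro: le_trans)

lemma exps_le_ex: "\<exists>N. exps_le N (p :: ('v, 'k::field) mpoly)"
proof -
  have "finite (\<Union>m\<in>monoms p. lookup m ` supp m)" by auto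
  then obtain N where N: "\<And>x. x \<in> (\<Union>m\<in>monoms p. lookup m ` supp m) \<Longrightarrow> x \<le> N"
    by (meson finite_nat_set_iff_bounded_le)
  have "exps_le N p" unfolding exps_le_def
  proof (intro ballI allI)
    fix m v assume m: "m \<in> monoms p"
    show "lookup m v \<le> N"
    proof (cases "v \<in> supp m")
      case True
      then show ?thesis using N[of "lookup m v"] m by blast
    qed (simp add: in_keys_iff)
  qed
  then show ?thesis by blast
qed

lemma exps_le_list: "\<exists>N. \<forall>p\<in>set ps. exps_le N (p :: ('v, 'k::field) mpoly)"
proof (induction ps)
  case (Cons p ps)
  then obtain N where "\<forall>p\<in>set ps. exps_le N p" by blast
  moreover obtain M where "exps_le M p" using exps_le_ex by blast
  ultimately have "\<forall>q\<in>set (p # ps). exps_le (M + N) q" by (auto intro: exps_le_mono)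
  then show ?case by blast
qed simp

lemma exps_le_mult:
  assumes "exps_le M p" "exps_le N q"
  shows "exps_le (M + N) (p * q :: ('v, 'k::field) mpoly)"
  using assms monoms_mult[of _ p q] unfolding exps_le_def by (fastforce simp: lookup_add add_mono)

lemma exps_le_power: "exps_le N p \<Longrightarrow> exps_le (k * N) (p ^ k :: ('v, 'k::field) mpoly)"
  by (induction k) (auto intro: exps_le_mult simp: exps_le_def[of 0])

lemma exps_le_power_prod:
  assumes "\<forall>r\<in>set rs. exps_le D r" "length as = length rs" "set as \<subseteq> {..t}"
  shows "exps_le (length rs * (t * D)) (power_prod rs as :: ('v, 'k::field) mpoly)"
  using assms
proof (induction rs arbitrary: as)
  case Nil
  then show ?case by (simp add: exps_le_def)
next
  case (Cons r rs)
  then obtain a bs where as: "as = a # bs" by (cases as) auto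
  have "exps_le (a * D) (r ^ a)" using exps_le_power Cons.prems by auto
  then have "exps_le (t * D) (r ^ a)" using Cons.prems as by (auto intro: exps_le_mono)
  moreover have "exps_le (length rs * (t * D)) (power_prod rs bs)" using Cons as by auto
  ultimately show ?case using exps_le_mult as by fastforce
qed

definition bounded_monomials :: "'v set set \<Rightarrow> nat \<Rightarrow> ('v \<Rightarrow>\<^sub>0 nat) set" where
  "bounded_monomials \<F> N = {m. (\<exists>F\<in>\<F>. supp m \<subseteq> F) \<and> (\<forall>v. lookup m v \<le> N)}"

lemma card_bounded_monomials:
  assumes "finite \<F>" "\<And>F. F \<in> \<F> \<Longrightarrow> finite F \<and> card F \<le> d"
  shows "finite (bounded_monomials \<F> N)" "card (bounded_monomials \<F> N) \<le> card \<F> * (N + 1) ^ d"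
proof -
  let ?B = "\<lambda>F. {m. supp m \<subseteq> F \<and> (\<forall>v. lookup m v \<le> N)} :: ('a \<Rightarrow>\<^sub>0 nat) set"
  have U: "bounded_monomials \<F> N = (\<Union>F\<in>\<F>. ?B F)" by (auto simp: bounded_monomials_def)
  have B: "finite (?B F) \<and> card (?B F) \<le> (N + 1) ^ d" if F: "F \<in> \<F>" for F
  proof -
    have fF: "finite F" using assms(2) F by blast
    have inj: "inj_on (\<lambda>m. restrict (lookup m) F) (?B F)"
    proof (intro inj_onI poly_mapping_eqI)
      fix m n v assume mn: "m \<in> ?B F" "n \<in> ?B F" "restrict (lookup m) F = restrict (lookup n) F"
      show "lookup m v = lookup n v"
      proof (cases "v \<in> F")
        case True
        then show ?thesis using mn(3) by (metis restrict_apply')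
      next
        case False
        then have "v \<notin> supp m" "v \<notin> supp n" using mn by auto
        then show ?thesis by (simp add: in_keys_iff)
      qed
    qed
    have sub: "(\<lambda>m. restrict (lookup m) F) ` ?B F \<subseteq> F \<rightarrow>\<^sub>E {..N}" by auto
    have fin: "finite (F \<rightarrow>\<^sub>E {..N})" using fF by (intro finite_PiE) auto
    have "card (?B F) \<le> card (F \<rightarrow>\<^sub>E {..N})" using card_inj_on_le[OF inj sub fin] .
    also have "\<dots> = (N + 1) ^ card F" using fF by (simp add: card_PiE)
    also have "\<dots> \<le> (N + 1) ^ d" using assms(2) F by (intro power_increasing) auto
    finally show ?thesis using inj_on_finite[OF inj sub fin] by blast
  qed
  show "finite (bounded_monomials \<F> N)" using U B assms(1) by simp
  have "card (\<Union>F\<in>\<F>. ?B F) \<le> (\<Sum>F\<in>\<F>. card (?B F))" by (rule card_UN_le[OF assms(1)])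
  also have "\<dots> \<le> (\<Sum>F\<in>\<F>. (N + 1) ^ d)" using B by (intro sum_mono) auto
  finally show "card (bounded_monomials \<F> N) \<le> card \<F> * (N + 1) ^ d" using U by simp
qed

text \<open>The normal form of a polynomial modulo \<open>face_ideal V \<F>\<close>.\<close>

definition restrict_faces :: "'v set set \<Rightarrow> ('v, 'k::field) mpoly \<Rightarrow> ('v, 'k) mpoly" where
  "restrict_faces \<F> p = (\<Sum>m\<in>{m\<in>monoms p. \<exists>F\<in>\<F>. supp m \<subseteq> F}. monom m (lookup p m))"

lemma restrict_faces_diff:
  assumes "p \<in> polys V"
  shows "p - restrict_faces \<F> p \<in> face_ideal V \<F>"
proof -
  have "p = (\<Sum>m\<in>monoms p - {m\<in>monoms p. \<exists>F\<in>\<F>. supp m \<subseteq> F}. monom m (lookup p m)) + restrict_faces \<F> p"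
    unfolding restrict_faces_def
    by (subst poly_sum_monoms, rule sum.subset_diff) auto
  then have "p - restrict_faces \<F> p = (\<Sum>m\<in>monoms p - {m\<in>monoms p. \<exists>F\<in>\<F>. supp m \<subseteq> F}. monom m (lookup p m))"
    by (simp add: diff_eq_eq)
  also have "\<dots> \<in> face_ideal V \<F>"
    using assms by (intro subring_set.submod_sum[OF subring_polys poly_ideal_face_ideal])
      (auto simp: face_ideal_def)
  finally show ?thesis .
qed

lemma vector_space_mpoly: "vector_space (\<lambda>(c::'k::field) (p :: ('v, 'k) mpoly). monom 0 c * p)"
  by unfold_locales (simp_all add: algebra_simps single_add mult_single flip: mult.assoc)

lemma growth_bound:
  fixes n d K C :: nat
  assumes "\<And>t. (t + 1) ^ n \<le> K * (n * (t * C) + 1) ^ d"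
  shows "n \<le> d"
proof (rule ccontr)
  assume "\<not> n \<le> d"
  define t where "t = K * (n * C + 1) ^ d"
  have "(t + 1) ^ (d + 1) \<le> (t + 1) ^ n" using \<open>\<not> n \<le> d\<close> by (intro power_increasing) auto
  also have "\<dots> \<le> K * (n * (t * C) + 1) ^ d" by (rule assms)
  also have "\<dots> \<le> K * ((n * C + 1) * (t + 1)) ^ d"
    by (intro mult_left_mono power_mono) (auto simp: algebra_simps)
  also have "\<dots> = (K * (n * C + 1) ^ d) * (t + 1) ^ d" by (simp only: power_mult_distrib mult.assoc)
  also have "\<dots> = t * (t + 1) ^ d" by (simp only: t_def)
  finally have "(t + 1) * (t + 1) ^ d \<le> t * (t + 1) ^ d" by simp
  then show False by simp
qed

text \<open>The monomials in \<open>rs\<close> with exponents at most \<open>t\<close> are linearly independent modulo \<open>L 0\<close>. Their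
normal forms lie in the span of the monomials supported in some \<open>F \<in> \<F>\<close> with exponents bounded by a
multiple of \<open>t\<close>. The first count is a polynomial of degree \<open>length rs\<close> in \<open>t\<close>, the second has
degree at most \<open>d\<close>.\<close>

theorem chain_length_bound:
  fixes V :: "'v set" and rs :: "('v, 'k::field) mpoly list"
  assumes "finite \<F>" "\<And>F. F \<in> \<F> \<Longrightarrow> finite F \<and> card F \<le> d"
    and L: "\<And>i. i \<le> length rs \<Longrightarrow> poly_ideal V (L i)"
    and rs: "\<And>i. i < length rs \<Longrightarrow> rs ! i \<in> polys V \<and> rs ! i \<in> L (Suc i) \<and> L i \<subseteq> L (Suc i)"
    and nzd: "\<And>i a. i < length rs \<Longrightarrow> a \<in> polys V \<Longrightarrow> rs ! i * a \<in> L i \<Longrightarrow> a \<in> L i"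
    and one: "1 \<notin> L (length rs)" and "face_ideal V \<F> \<subseteq> L 0"
  shows "length rs \<le> d"
proof -
  interpret R: subring_set "polys V :: ('v, 'k) mpoly set" by (rule subring_polys)
  interpret vector_space "\<lambda>(c::'k::field) (p :: ('v, 'k) mpoly). monom 0 c * p" by (rule vector_space_mpoly)
  define n where "n = length rs"
  obtain C where C: "\<forall>p\<in>set rs. exps_le C p" using exps_le_list by blast
  have bound: "(t + 1) ^ n \<le> card \<F> * (n * (t * C) + 1) ^ d" for t
  proof -
  let ?A = "{as. set as \<subseteq> {..t} \<and> length as = n}"
  define x where "x as = restrict_faces \<F> (power_prod rs as)" for as
  have finA: "finite ?A" and cardA: "card ?A = (t + 1) ^ n"
    using finite_lists_length_eq[of "{..t}" n] card_lists_length_eq[of "{..t}" n] by auto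
  have pp: "power_prod rs as \<in> polys V" for as
    using rs by (intro R.power_prod_in) (auto simp: in_set_conv_nth)
  have indep: "(\<Sum>as\<in>A. monom 0 (c as) * x as) \<noteq> 0"
    if A: "A \<subseteq> ?A" "A \<noteq> {}" "\<And>as. as \<in> A \<Longrightarrow> c as \<noteq> 0" for A c
  proof
    assume 0: "(\<Sum>as\<in>A. monom 0 (c as) * x as) = 0"
    have "(\<Sum>as\<in>A. monom 0 (c as) * power_prod rs as)
        = (\<Sum>as\<in>A. monom 0 (c as) * (power_prod rs as - x as))"
      using 0 by (simp add: algebra_simps sum_subtractf)
    also have "\<dots> \<in> face_ideal V \<F>"
      using restrict_faces_diff[OF pp] R.submod_mult[OF poly_ideal_face_ideal]
      by (intro R.submod_sum[OF poly_ideal_face_ideal]) (auto simp: x_def monom_in_face_ideal)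
    finally have "(\<Sum>as\<in>A. monom 0 (c as) * power_prod rs as) \<in> L 0" using assms(7) by blast
    moreover have "(\<Sum>as\<in>A. monom 0 (c as) * power_prod rs as) \<notin> L 0"
    proof (rule R.power_prod_independent)
      show "finite A" using A(1) finA finite_subset by blast
      show "monom 0 (c as) \<in> polys V \<and> (\<exists>u\<in>polys V. u * monom 0 (c as) = 1)" if "as \<in> A" for as
        using A(3)[OF that]
        by (auto simp: monom_in_face_ideal mult_single intro!: bexI[of _ "monom 0 (inverse (c as))"])
    qed (use A L rs nzd one in \<open>auto simp: n_def\<close>)
    ultimately show False by blast
  qed
  \<comment> \<open>Independence of the set of normal forms first needs that they are distinct.\<close>
  have inj: "inj_on x ?A"
  proof (rule inj_onI, rule ccontr)
    fix as bs assume ab: "as \<in> ?A" "bs \<in> ?A" "x as = x bs" "as \<noteq> bs"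
    have "(\<Sum>cs\<in>{as, bs}. monom 0 (if cs = as then 1 else - 1) * x cs) = 0"
      using ab by (simp add: single_uminus)
    moreover have "(if cs = as then 1 else - 1) \<noteq> (0 :: 'k)" for cs by simp
    ultimately show False
      using indep[of "{as, bs}" "\<lambda>cs. if cs = as then 1 else - 1"] ab(1,2) by blast
  qed
  have ind: "independent (x ` ?A)"
  proof
    assume "dependent (x ` ?A)"
    then obtain T u where T: "finite T" "T \<subseteq> x ` ?A" "(\<Sum>v\<in>T. monom 0 (u v) * v) = 0" "\<exists>v\<in>T. u v \<noteq> 0"
      unfolding dependent_explicit by blast
    define A where "A = {as\<in>?A. x as \<in> T \<and> u (x as) \<noteq> 0}"
    have "(\<Sum>as\<in>A. monom 0 (u (x as)) * x as) = (\<Sum>v\<in>x ` A. monom 0 (u v) * v)"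
      by (subst sum.reindex) (auto intro: inj_on_subset[OF inj] simp: A_def)
    also have "\<dots> = (\<Sum>v\<in>T. monom 0 (u v) * v)"
      using T(1,2) by (intro sum.mono_neutral_left) (auto simp: A_def)
    also have "\<dots> = 0" by (rule T(3))
    finally have "(\<Sum>as\<in>A. monom 0 (u (x as)) * x as) = 0" .
    moreover have "A \<subseteq> ?A" "A \<noteq> {}" using T(2,4) by (auto simp: A_def)
    moreover have "u (x as) \<noteq> 0" if "as \<in> A" for as using that by (simp add: A_def)
    ultimately show False using indep[of A "\<lambda>as. u (x as)"] by blast
  qed
  let ?B = "bounded_monomials \<F> (n * (t * C))"
  have "x ` ?A \<subseteq> span ((\<lambda>m. monom m 1) ` ?B)"
  proof (rule image_subsetI)
    fix as assume as: "as \<in> ?A"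
    have e: "exps_le (n * (t * C)) (power_prod rs as)"
      using exps_le_power_prod[OF C] as n_def by auto
    show "x as \<in> span ((\<lambda>m. monom m 1) ` ?B)"
      unfolding x_def restrict_faces_def
    proof (rule span_sum)
      fix m assume "m \<in> {m \<in> monoms (power_prod rs as). \<exists>F\<in>\<F>. supp m \<subseteq> F}"
      then have "m \<in> ?B" using e by (auto simp: bounded_monomials_def exps_le_def)
      then have "monom 0 c * monom m 1 \<in> span ((\<lambda>m. monom m 1) ` ?B)" for c
        by (intro span_scale span_base) auto
      then show "monom m (lookup (power_prod rs as) m) \<in> span ((\<lambda>m. monom m 1) ` ?B)"
        by (simp add: mult_single)
    qed
  qed
  then have "card (x ` ?A) \<le> card ((\<lambda>m. monom m (1::'k)) ` ?B)"
    using independent_span_bound[OF _ ind] card_bounded_monomials(1)[OF assms(1,2)] by blast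
  also have "\<dots> \<le> card ?B" by (rule card_image_le) (rule card_bounded_monomials(1)[OF assms(1,2)])
  also have "\<dots> \<le> card \<F> * (n * (t * C) + 1) ^ d" by (rule card_bounded_monomials(2)[OF assms(1,2)])
  finally show ?thesis using cardA card_image[OF inj] by simp
  qed
  then show ?thesis using growth_bound unfolding n_def by blast
qed

section \<open>The prime ideal of a face\<close>

text \<open>Kronecker substitution: reading exponents as digits in a large base \<open>B\<close> separates finitely many
exponent vectors by an additive weight. This replaces a monomial order, for which the variables
would have to be ordered.\<close>

lemma separating_weight:
  assumes "finite F" "finite K"
  shows "\<exists>c :: 'v \<Rightarrow> nat. \<forall>f\<in>K. \<forall>g\<in>K.
    (\<Sum>v\<in>F. c v * f v) = (\<Sum>v\<in>F. c v * g v) \<longrightarrow> (\<forall>v\<in>F. f v = (g v :: nat))"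
  using assms(1)
proof (induction F)
  case (insert u F)
  then obtain c where c: "\<And>f g. f \<in> K \<Longrightarrow> g \<in> K \<Longrightarrow> (\<Sum>v\<in>F. c v * f v) = (\<Sum>v\<in>F. c v * g v)
      \<Longrightarrow> \<forall>v\<in>F. f v = g v" by metis
  obtain B where B: "\<And>f. f \<in> K \<Longrightarrow> f u < B"
    using finite_nat_set_iff_bounded[of "(\<lambda>f. f u) ` K"] assms(2) by auto
  define c' where "c' v = (if v = u then 1 else B * c v)" for v
  have c': "(\<Sum>v\<in>insert u F. c' v * f v) = B * (\<Sum>v\<in>F. c v * f v) + f u" for f :: "'v \<Rightarrow> nat"
    using insert.hyps by (auto simp: c'_def sum_distrib_left mult.assoc intro!: sum.cong)
  show ?case
  proof (intro exI[of _ c'] ballI impI)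
    fix f g v assume fg: "f \<in> K" "g \<in> K"
      "(\<Sum>v\<in>insert u F. c' v * f v) = (\<Sum>v\<in>insert u F. c' v * g v)" "v \<in> insert u F"
    have eq: "B * (\<Sum>v\<in>F. c v * f v) + f u = B * (\<Sum>v\<in>F. c v * g v) + g u" using fg(3) c' by simp
    have "(B * (\<Sum>v\<in>F. c v * f v) + f u) mod B = f u" "(B * (\<Sum>v\<in>F. c v * g v) + g u) mod B = g u"
      using B fg(1,2) by auto
    then have u: "f u = g u" using eq by metis
    moreover have "B > 0" using B[OF fg(1)] by simp
    ultimately have "(\<Sum>v\<in>F. c v * f v) = (\<Sum>v\<in>F. c v * g v)" using eq by simp
    then show "f v = g v" using c[OF fg(1,2)] u fg(4) by auto
  qed
qed simp

text \<open>Leading terms: the product of the terms of highest weight among those supported in \<open>F\<close> cannot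
cancel.\<close>

lemma face_ideal_prime:
  fixes p q :: "('v, 'k::field) mpoly"
  assumes "finite F" "p \<in> polys V" "q \<in> polys V" "p * q \<in> face_ideal V {F}"
  shows "p \<in> face_ideal V {F} \<or> q \<in> face_ideal V {F}"
proof (rule ccontr)
  assume neg: "\<not> ?thesis"
  define P where "P = {m\<in>monoms p. supp m \<subseteq> F}"
  define Q where "Q = {m\<in>monoms q. supp m \<subseteq> F}"
  have "P \<noteq> {}" "Q \<noteq> {}" using neg assms(2,3) by (auto simp: P_def Q_def face_ideal_def)
  have fin: "finite P" "finite Q" by (auto simp: P_def Q_def)
  obtain c where c: "\<forall>f\<in>lookup ` (P \<union> Q). \<forall>g\<in>lookup ` (P \<union> Q).
    (\<Sum>v\<in>F. c v * f v) = (\<Sum>v\<in>F. c v * g v) \<longrightarrow> (\<forall>v\<in>F. f v = g v)"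
    using separating_weight[OF assms(1), of "lookup ` (P \<union> Q)"] fin by auto
  define w where "w m = (\<Sum>v\<in>F. c v * lookup m v)" for m
  have w_add: "w (m + n) = w m + w n" for m n by (simp add: w_def lookup_add algebra_simps sum.distrib)
  have w_inj: "m = n" if "m \<in> P \<union> Q" "n \<in> P \<union> Q" "w m = w n" "supp m \<subseteq> F" "supp n \<subseteq> F" for m n
  proof (rule poly_mapping_eqI)
    have eq: "\<forall>v\<in>F. lookup m v = lookup n v"
      using c that(1,2,3) unfolding w_def by blast
    fix v show "lookup m v = lookup n v"
    proof (cases "v \<in> F")
      case False
      then have "v \<notin> supp m" "v \<notin> supp n" using that by auto
      then show ?thesis by (simp add: in_keys_iff)
    qed (use eq in simp)
  qed
  obtain a where a: "a \<in> P" "\<And>m. m \<in> P \<Longrightarrow> w m \<le> w a"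
    using Max_in[of "w ` P"] Max_ge[of "w ` P"] fin \<open>P \<noteq> {}\<close>
    by (metis (no_types, lifting) finite_imageI image_eqI image_iff image_is_empty)
  obtain b where b: "b \<in> Q" "\<And>m. m \<in> Q \<Longrightarrow> w m \<le> w b"
    using Max_in[of "w ` Q"] Max_ge[of "w ` Q"] fin \<open>Q \<noteq> {}\<close>
    by (metis (no_types, lifting) finite_imageI image_eqI image_iff image_is_empty)
  have uniq: "m = a \<and> n = b" if mn: "m \<in> monoms p" "n \<in> monoms q" "m + n = a + b" for m n
  proof -
    have "supp (m + n) \<subseteq> F" using mn(3) a(1) b(1) by (auto simp: supp_add P_def Q_def)
    then have "m \<in> P" "n \<in> Q" using mn(1,2) supp_add[of m n] by (auto simp: P_def Q_def)
    moreover have "w m + w n = w a + w b" using mn(3) w_add by metis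
    ultimately have "w m = w a" "w n = w b" using a(2) b(2) by (metis add_le_cancel_left add_le_cancel_right antisym)+
    then show ?thesis using w_inj[of m a] w_inj[of n b] a(1) b(1) \<open>m \<in> P\<close> \<open>n \<in> Q\<close>
      by (auto simp: P_def Q_def)
  qed
  have "p * q = (\<Sum>m\<in>monoms p. \<Sum>n\<in>monoms q. monom (m + n) (lookup p m * lookup q n))"
    by (subst poly_sum_monoms[of p], subst poly_sum_monoms[of q]) (simp add: sum_product mult_single)
  then have "lookup (p * q) (a + b)
      = (\<Sum>m\<in>monoms p. \<Sum>n\<in>monoms q. lookup p m * lookup q n when m + n = a + b)"
    by (simp add: lookup_sum lookup_single)
  also have "\<dots> = (\<Sum>m\<in>monoms p. if m = a then lookup p a * lookup q b else 0)"
  proof (intro sum.cong refl)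
    fix m assume m: "m \<in> monoms p"
    have "(\<Sum>n\<in>monoms q. lookup p m * lookup q n when m + n = a + b)
        = (\<Sum>n\<in>monoms q. if n = b then (if m = a then lookup p a * lookup q b else 0) else 0)"
    proof (intro sum.cong refl)
      fix n assume n: "n \<in> monoms q"
      show "(lookup p m * lookup q n when m + n = a + b)
          = (if n = b then (if m = a then lookup p a * lookup q b else 0) else 0)"
        using uniq[OF m n] by (cases "m + n = a + b") auto
    qed
    also have "\<dots> = (if m = a then lookup p a * lookup q b else 0)" using b(1) by (simp add: Q_def)
    finally show "(\<Sum>n\<in>monoms q. lookup p m * lookup q n when m + n = a + b)
        = (if m = a then lookup p a * lookup q b else 0)" .
  qed
  also have "\<dots> = lookup p a * lookup q b" using a(1) by (simp add: P_def)
  finally have "a + b \<in> monoms (p * q)" using a(1) b(1) by (auto simp: P_def Q_def in_keys_iff)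
  then have "\<not> supp a \<union> supp b \<subseteq> F" using face_idealD(2)[OF assms(4)] by (metis supp_add singletonI)
  then show False using a(1) b(1) by (auto simp: P_def Q_def)
qed

section \<open>Quotient modules and quotients of ideals\<close>

lemma submodule_abelian_subgroup:
  assumes "module R M" "submodule N R M"
  shows "abelian_subgroup N M"
proof -
  interpret module R M by fact
  show ?thesis
    using assms(2) M.abelian_group_axioms
    by (intro abelian_subgroupI3 additive_subgroup.intro) (auto simp: submodule_def)
qed

locale quotient_module =
  fixes R :: "('a, 'b) ring_scheme" and M :: "('a, 'm, 'c) module_scheme" and N :: "'m set"
  assumes mod: "module R M" and sub: "submodule N R M"
begin

sublocale M: module R M by (rule mod)
sublocale N: abelian_subgroup N M by (rule submodule_abelian_subgroup[OF mod sub])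

abbreviation "Q \<equiv> quot_module M N"
abbreviation "coset x \<equiv> N +>\<^bsub>M\<^esub> x"

lemma quot_carrier: "carrier Q = coset ` carrier M"
  by (auto simp: quot_module_def A_RCOSETS_def')

lemma quot_zero: "\<zero>\<^bsub>Q\<^esub> = N"
  by (simp add: quot_module_def)

lemma quot_add: "x \<in> carrier M \<Longrightarrow> y \<in> carrier M \<Longrightarrow> coset x \<oplus>\<^bsub>Q\<^esub> coset y = coset (x \<oplus>\<^bsub>M\<^esub> y)"
  using N.a_rcos_sum by (simp add: quot_module_def)

lemma coset_eq: "x \<in> carrier M \<Longrightarrow> n \<in> N \<Longrightarrow> coset (n \<oplus>\<^bsub>M\<^esub> x) = coset x"
  using N.a_subset by (metis M.M.a_coset_add_assoc M.M.a_coset_join2 N.a_subgroup subset_iff)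

lemma in_coset: "x \<in> carrier M \<Longrightarrow> z \<in> coset x \<longleftrightarrow> (\<exists>n\<in>N. z = n \<oplus>\<^bsub>M\<^esub> x)"
  by (auto simp: a_r_coset_def')

lemma quot_smult:
  assumes "a \<in> carrier R" "x \<in> carrier M"
  shows "a \<odot>\<^bsub>Q\<^esub> coset x = coset (a \<odot>\<^bsub>M\<^esub> x)"
proof -
  have "coset (a \<odot>\<^bsub>M\<^esub> z) = coset (a \<odot>\<^bsub>M\<^esub> x)" if z: "z \<in> coset x" for z
  proof -
    obtain n where n: "n \<in> N" "z = n \<oplus>\<^bsub>M\<^esub> x" using z in_coset assms by auto
    have "a \<odot>\<^bsub>M\<^esub> z = a \<odot>\<^bsub>M\<^esub> n \<oplus>\<^bsub>M\<^esub> a \<odot>\<^bsub>M\<^esub> x"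
      using n assms N.a_subset M.smult_r_distr by auto
    moreover have "a \<odot>\<^bsub>M\<^esub> n \<in> N" using sub submodule.smult_closed assms(1) n(1) by metis
    ultimately show ?thesis using coset_eq assms by simp
  qed
  moreover have "x \<in> coset x" using N.a_rcos_self assms(2) .
  ultimately have "(\<Union>z\<in>coset x. coset (a \<odot>\<^bsub>M\<^esub> z)) = coset (a \<odot>\<^bsub>M\<^esub> x)" by blast
  then show ?thesis by (simp add: quot_module_def)
qed

lemma coset_zero_iff: "x \<in> carrier M \<Longrightarrow> coset x = N \<longleftrightarrow> x \<in> N"
  using N.a_rcos_self M.M.a_coset_join2[OF _ N.a_subgroup] by auto

lemma module_quot: "module R Q"
proof (rule moduleI)
  show "cring R" by (rule M.R.cring_axioms)
  show "abelian_group Q"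
  proof (rule abelian_groupI)
    show "\<zero>\<^bsub>Q\<^esub> \<in> carrier Q"
      using coset_zero_iff[of "\<zero>\<^bsub>M\<^esub>"] N.zero_closed by (auto simp: quot_carrier quot_zero)
    fix x assume x: "x \<in> carrier Q"
    then obtain u where u: "u \<in> carrier M" "x = coset u" by (auto simp: quot_carrier)
    have z: "\<zero>\<^bsub>Q\<^esub> = coset \<zero>\<^bsub>M\<^esub>" using coset_zero_iff[of "\<zero>\<^bsub>M\<^esub>"] by (simp add: quot_zero)
    show "\<zero>\<^bsub>Q\<^esub> \<oplus>\<^bsub>Q\<^esub> x = x" unfolding z u(2) using u(1) by (simp only: quot_add M.M.zero_closed M.M.l_zero)
    show "\<exists>y\<in>carrier Q. y \<oplus>\<^bsub>Q\<^esub> x = \<zero>\<^bsub>Q\<^esub>"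
      unfolding z u(2) quot_carrier using u(1) quot_add[of "\<ominus>\<^bsub>M\<^esub> u" u] M.M.l_neg[OF u(1)] by auto
  qed (auto simp: quot_carrier quot_add M.M.a_ac)
qed (auto simp: quot_carrier quot_add quot_smult M.smult_l_distr M.smult_r_distr M.smult_assoc1)

lemma nonzerodivisor_quot:
  assumes "a \<in> carrier R"
  shows "nonzerodivisor_on a Q \<longleftrightarrow> (\<forall>x\<in>carrier M. a \<odot>\<^bsub>M\<^esub> x \<in> N \<longrightarrow> x \<in> N)"
  using assms by (auto simp: nonzerodivisor_on_def quot_carrier quot_zero quot_smult coset_zero_iff)

end

lemma submodule_generated:
  assumes "module R M" "A \<subseteq> carrier M"
  shows "submodule (generated_submodule R M A) R M"
proof -
  interpret module R M by fact
  let ?S = "{N. submodule N R M \<and> A \<subseteq> N}"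
  have car: "carrier M \<in> ?S" using carrier_is_submodule assms(2) by auto
  show ?thesis unfolding generated_submodule_def
  proof (rule submoduleI)
    show "\<Inter>?S \<subseteq> carrier M" using car by blast
    show "\<zero>\<^bsub>M\<^esub> \<in> \<Inter>?S"
    proof
      fix N assume "N \<in> ?S"
      then show "\<zero>\<^bsub>M\<^esub> \<in> N" using submodule.axioms(1) subgroup.one_closed by fastforce
    qed
    fix a assume a: "a \<in> \<Inter>?S"
    show "\<ominus>\<^bsub>M\<^esub> a \<in> \<Inter>?S"
    proof
      fix N assume N: "N \<in> ?S"
      then show "\<ominus>\<^bsub>M\<^esub> a \<in> N" using submoduleE(3)[of N a] a by auto
    qed
    fix b assume b: "b \<in> \<Inter>?S"
    show "a \<oplus>\<^bsub>M\<^esub> b \<in> \<Inter>?S"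
    proof
      fix N assume N: "N \<in> ?S"
      then show "a \<oplus>\<^bsub>M\<^esub> b \<in> N" using submoduleE(5)[of N a b] a b by auto
    qed
  next
    fix a x assume a: "a \<in> carrier R" and x: "x \<in> \<Inter>?S"
    show "a \<odot>\<^bsub>M\<^esub> x \<in> \<Inter>?S"
    proof
      fix N assume N: "N \<in> ?S"
      then show "a \<odot>\<^bsub>M\<^esub> x \<in> N" using submoduleE(4)[of N a x] a x by auto
    qed
  qed
qed

lemma generated_minimal: "submodule N R M \<Longrightarrow> A \<subseteq> N \<Longrightarrow> generated_submodule R M A \<subseteq> N"
  by (auto simp: generated_submodule_def)

lemma generated_superset: "A \<subseteq> generated_submodule R M A"
  by (auto simp: generated_submodule_def)

lemma set_smult_facts:
  assumes "module R M" "A \<subseteq> carrier R"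
  shows "submodule (set_smult R M A) R M"
    and "a \<in> A \<Longrightarrow> x \<in> carrier M \<Longrightarrow> a \<odot>\<^bsub>M\<^esub> x \<in> set_smult R M A"
    and "submodule N R M \<Longrightarrow> (\<And>a x. a \<in> A \<Longrightarrow> x \<in> carrier M \<Longrightarrow> a \<odot>\<^bsub>M\<^esub> x \<in> N) \<Longrightarrow> set_smult R M A \<subseteq> N"
proof -
  interpret module R M by fact
  show "submodule (set_smult R M A) R M"
    unfolding set_smult_def using assms(2) by (intro submodule_generated[OF assms(1)]) auto
  show "a \<odot>\<^bsub>M\<^esub> x \<in> set_smult R M A" if "a \<in> A" "x \<in> carrier M"
    unfolding set_smult_def by (rule subsetD[OF generated_superset]) (use that in blast)
  show "set_smult R M A \<subseteq> N"
    if "submodule N R M" "\<And>a x. a \<in> A \<Longrightarrow> x \<in> carrier M \<Longrightarrow> a \<odot>\<^bsub>M\<^esub> x \<in> N"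
    unfolding set_smult_def using that by (intro generated_minimal) auto
qed

lemma mpoly_ring_simps [simp]:
  "carrier (mpoly_ring V) = polys V"
  "x \<otimes>\<^bsub>mpoly_ring V\<^esub> y = x * y" "x \<oplus>\<^bsub>mpoly_ring V\<^esub> y = x + y"
  "\<one>\<^bsub>mpoly_ring V\<^esub> = 1" "\<zero>\<^bsub>mpoly_ring V\<^esub> = 0"
  by (auto simp: mpoly_ring_def ring_of_type_algebra_def face_ideal_def)

lemma polys_facts:
  fixes p q :: "('v, 'k::field) mpoly"
  shows "p \<in> polys V \<Longrightarrow> q \<in> polys V \<Longrightarrow> p + q \<in> polys V"
    and "p \<in> polys V \<Longrightarrow> q \<in> polys V \<Longrightarrow> p * q \<in> polys V"
    and "p \<in> polys V \<Longrightarrow> - p \<in> polys V" and "0 \<in> (polys V :: ('v, 'k) mpoly set)"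
    and "1 \<in> (polys V :: ('v, 'k) mpoly set)"
  using subring_polys[of V, where 'k='k] subring_set.submod_zero[OF subring_polys subring_set.submod_R[OF subring_polys]]
  unfolding subring_set_def by blast+

lemma cring_mpoly: "cring (mpoly_ring V :: ('v, 'k::field) mpoly ring)"
proof (rule cringI)
  show "abelian_group (mpoly_ring V :: ('v, 'k) mpoly ring)"
    by (rule abelian_groupI) (auto simp: polys_facts algebra_simps intro: bexI[of _ "- x" for x])
  show "Group.comm_monoid (mpoly_ring V :: ('v, 'k) mpoly ring)"
    by (rule comm_monoidI) (auto simp: polys_facts algebra_simps)
qed (auto simp: algebra_simps)

lemma a_inv_mpoly [simp]: "x \<in> polys V \<Longrightarrow> \<ominus>\<^bsub>mpoly_ring V\<^esub> x = - x"
  by (rule abelian_group.minus_equality[OF ring.is_abelian_group[OF cring.axioms(1)[OF cring_mpoly]]])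
    (auto simp: polys_facts)

text \<open>Here \<open>\<phi>\<close> is a surjection from \<open>J\<close> onto \<open>Q\<close> with kernel \<open>K\<close>. The factors of a filtration of
\<open>R / I\<close> are sets of cosets of cosets; with such a map all questions about them become questions
about polynomials.\<close>

locale ideal_quotient =
  fixes V :: "'v set" and Q :: "(('v, 'k::field) mpoly, 'm, 'c) module_scheme"
    and \<phi> :: "('v, 'k) mpoly \<Rightarrow> 'm" and J K :: "('v, 'k) mpoly set"
  assumes modQ: "module (mpoly_ring V) Q"
    and J: "poly_ideal V J" "J \<subseteq> polys V" and K: "poly_ideal V K" "K \<subseteq> J"
    and \<phi>_carrier: "carrier Q = \<phi> ` J"
    and \<phi>_add: "p \<in> J \<Longrightarrow> q \<in> J \<Longrightarrow> \<phi> (p + q) = \<phi> p \<oplus>\<^bsub>Q\<^esub> \<phi> q"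
    and \<phi>_smult: "a \<in> polys V \<Longrightarrow> p \<in> J \<Longrightarrow> \<phi> (a * p) = a \<odot>\<^bsub>Q\<^esub> \<phi> p"
    and \<phi>_zero: "p \<in> J \<Longrightarrow> \<phi> p = \<zero>\<^bsub>Q\<^esub> \<longleftrightarrow> p \<in> K"
begin

sublocale R: subring_set "polys V :: ('v, 'k) mpoly set" by (rule subring_polys)
sublocale Q: module "mpoly_ring V" Q by (rule modQ)

lemma \<phi>_uminus: "p \<in> J \<Longrightarrow> \<phi> (- p) = \<ominus>\<^bsub>Q\<^esub> \<phi> p"
  using \<phi>_add[of "- p" p] \<phi>_zero[of 0] R.submod_zero[OF K(1)] R.submod_zero[OF J(1)] R.submod_uminus[OF J(1)]
  by (intro Q.M.minus_equality[symmetric]) (auto simp: \<phi>_carrier)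

text \<open>A submodule \<open>T\<close> that contains the kernel is saturated, so its image determines it.\<close>

lemma \<phi>_mem:
  assumes "poly_ideal V T" "K \<subseteq> T" "T \<subseteq> J" "p \<in> J"
  shows "\<phi> p \<in> \<phi> ` T \<longleftrightarrow> p \<in> T"
proof
  assume "\<phi> p \<in> \<phi> ` T"
  then obtain t where t: "t \<in> T" "\<phi> p = \<phi> t" by blast
  then have "\<phi> (p + - t) = \<phi> t \<oplus>\<^bsub>Q\<^esub> \<ominus>\<^bsub>Q\<^esub> \<phi> t"
    using \<phi>_add[of p "- t"] \<phi>_uminus[of t] R.submod_uminus[OF J(1)] assms by auto
  also have "\<dots> = \<zero>\<^bsub>Q\<^esub>" using t assms \<phi>_carrier by (intro Q.M.r_neg) auto
  finally have "p - t \<in> K" using \<phi>_zero[of "p - t"] R.submod_diff[OF J(1)] t assms by auto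
  then have "(p - t) + t \<in> T" using R.submod_add[OF assms(1), of "p - t" t] assms t by blast
  then show "p \<in> T" by simp
qed auto

lemma submodule_image:
  assumes "poly_ideal V T" "T \<subseteq> J"
  shows "submodule (\<phi> ` T) (mpoly_ring V) Q"
proof (rule Q.submoduleI)
  show "\<phi> ` T \<subseteq> carrier Q" using assms \<phi>_carrier by auto
  have "\<phi> 0 = \<zero>\<^bsub>Q\<^esub>" using \<phi>_zero[of 0] R.submod_zero[OF J(1)] R.submod_zero[OF K(1)] by simp
  then show "\<zero>\<^bsub>Q\<^esub> \<in> \<phi> ` T" using R.submod_zero[OF assms(1)] by force
  fix a assume "a \<in> \<phi> ` T"
  then obtain p where p: "p \<in> T" "a = \<phi> p" by blast
  show "\<ominus>\<^bsub>Q\<^esub> a \<in> \<phi> ` T"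
    using p \<phi>_uminus[of p] assms(2) R.submod_uminus[OF assms(1)] by (metis image_eqI subset_iff)
  show "a \<oplus>\<^bsub>Q\<^esub> b \<in> \<phi> ` T" if b: "b \<in> \<phi> ` T" for b
  proof -
    obtain q where q: "q \<in> T" "b = \<phi> q" using b by blast
    then have "a \<oplus>\<^bsub>Q\<^esub> b = \<phi> (p + q)" using p \<phi>_add[OF subsetD[OF assms(2) p(1)] subsetD[OF assms(2) q(1)]] by simp
    then show ?thesis using R.submod_add[OF assms(1) p(1) q(1)] by simp
  qed
next
  fix a x assume ax: "a \<in> carrier (mpoly_ring V :: ('v, 'k) mpoly ring)" "x \<in> \<phi> ` T"
  then obtain p where p: "p \<in> T" "x = \<phi> p" by blast
  then have "a \<odot>\<^bsub>Q\<^esub> x = \<phi> (a * p)" using ax(1) \<phi>_smult[of a p] assms(2) by auto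
  then show "a \<odot>\<^bsub>Q\<^esub> x \<in> \<phi> ` T" using R.submod_mult[OF assms(1), of a p] ax(1) p by simp
qed

text \<open>The ideal \<open>T + r\<^sub>1 J + \<dots> + r\<^sub>n J\<close>, accumulated in the order in which \<^const>\<open>regular_on\<close> divides.\<close>

primrec add_mults :: "('v, 'k) mpoly set \<Rightarrow> ('v, 'k) mpoly list \<Rightarrow> ('v, 'k) mpoly set" where
  "add_mults T [] = T"
| "add_mults T (r # rs) = add_mults (add_mult T r J) rs"

lemma add_mults_facts:
  assumes "set rs \<subseteq> polys V" "poly_ideal V T" "K \<subseteq> T" "T \<subseteq> J"
  shows "poly_ideal V (add_mults T rs)" "K \<subseteq> add_mults T rs" "add_mults T rs \<subseteq> J" "T \<subseteq> add_mults T rs"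
proof -
  have "poly_ideal V (add_mults T rs) \<and> T \<subseteq> add_mults T rs \<and> add_mults T rs \<subseteq> J"
    using assms
  proof (induction rs arbitrary: T)
    case (Cons r rs)
    have "poly_ideal V (add_mult T r J)" using Cons.prems J(1) R.submod_add_mult by blast
    moreover have "T \<subseteq> add_mult T r J" using R.add_mult_supset[OF J(1)] .
    moreover have "add_mult T r J \<subseteq> J" using R.add_mult_subset[OF J(1)] Cons.prems by simp
    ultimately show ?case using Cons.IH[of "add_mult T r J"] Cons.prems by auto
  qed simp
  then show "poly_ideal V (add_mults T rs)" "K \<subseteq> add_mults T rs" "add_mults T rs \<subseteq> J" "T \<subseteq> add_mults T rs"
    using assms by auto
qed

lemma mult_in_add_mults:
  assumes "set rs \<subseteq> polys V" "poly_ideal V T" "K \<subseteq> T" "T \<subseteq> J" "r \<in> set rs" "p \<in> J"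
  shows "r * p \<in> add_mults T rs"
  using assms(1-5)
proof (induction rs arbitrary: T)
  case (Cons s rs)
  have T': "poly_ideal V (add_mult T s J)" using Cons.prems J(1) R.submod_add_mult by blast
  have sub: "T \<subseteq> add_mult T s J" "add_mult T s J \<subseteq> J"
    using R.add_mult_supset[OF J(1)] R.add_mult_subset[OF J(1)] Cons.prems by auto
  show ?case
  proof (cases "r \<in> set rs")
    case True
    then show ?thesis using Cons.IH[OF _ T'] sub Cons.prems by auto
  next
    case False
    then have "r * p \<in> add_mult T s J"
      using Cons.prems(5) R.add_multI[of 0 T p J r] R.submod_zero[OF Cons.prems(2)] assms(6) by auto
    then show ?thesis using add_mults_facts(4)[of rs "add_mult T s J"] T' sub Cons.prems by auto
  qed
qed simp

lemma set_smult_eq: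
  assumes "set rs \<subseteq> polys V"
  shows "set_smult (mpoly_ring V) Q (set rs) = \<phi> ` add_mults K rs"
proof
  let ?N = "set_smult (mpoly_ring V) Q (set rs)"
  have rs: "set rs \<subseteq> carrier (mpoly_ring V)" using assms by simp
  note facts = add_mults_facts[OF assms K(1) order_refl K(2)]
  show "?N \<subseteq> \<phi> ` add_mults K rs"
  proof (rule set_smult_facts(3)[OF modQ rs])
    show "submodule (\<phi> ` add_mults K rs) (mpoly_ring V) Q" using facts by (intro submodule_image)
    fix a x assume ax: "a \<in> set rs" "x \<in> carrier Q"
    then obtain p where p: "p \<in> J" "x = \<phi> p" using \<phi>_carrier by auto
    then have "a \<odot>\<^bsub>Q\<^esub> x = \<phi> (a * p)" using \<phi>_smult[of a p] ax assms by auto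
    then show "a \<odot>\<^bsub>Q\<^esub> x \<in> \<phi> ` add_mults K rs"
      using mult_in_add_mults[OF assms K(1) order_refl K(2) ax(1) p(1)] by simp
  qed
  have N: "submodule ?N (mpoly_ring V) Q" using set_smult_facts(1)[OF modQ rs] .
  have "\<phi> ` add_mults T qs \<subseteq> ?N" if "set qs \<subseteq> set rs" "T \<subseteq> J" "\<phi> ` T \<subseteq> ?N" for T qs
    using that
  proof (induction qs arbitrary: T)
    case (Cons q qs)
    have q: "q \<in> set rs" "q \<in> polys V" using Cons.prems assms by auto
    have "\<phi> ` add_mult T q J \<subseteq> ?N"
    proof
      fix y assume "y \<in> \<phi> ` add_mult T q J"
      then obtain t p where tp: "y = \<phi> (t + q * p)" "t \<in> T" "p \<in> J" by (auto simp: add_mult_def)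
      then have "y = \<phi> t \<oplus>\<^bsub>Q\<^esub> q \<odot>\<^bsub>Q\<^esub> \<phi> p"
        using \<phi>_add[of t "q * p"] \<phi>_smult[of q p] q(2) R.submod_mult[OF J(1)] Cons.prems by auto
      moreover have "q \<odot>\<^bsub>Q\<^esub> \<phi> p \<in> ?N"
        using set_smult_facts(2)[OF modQ rs q(1)] tp \<phi>_carrier by auto
      ultimately show "y \<in> ?N" using Q.submoduleE(5)[OF N] Cons.prems tp by auto
    qed
    moreover have "add_mult T q J \<subseteq> J" using R.add_mult_subset[OF J(1)] q Cons.prems by auto
    ultimately show ?case using Cons.IH Cons.prems by auto
  qed simp
  moreover have "\<phi> ` K \<subseteq> ?N"
  proof
    fix y assume "y \<in> \<phi> ` K"
    then have "y = \<zero>\<^bsub>Q\<^esub>" using \<phi>_zero K(2) by auto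
    then show "y \<in> ?N" using submodule.axioms(1)[OF N] subgroup.one_closed by fastforce
  qed
  ultimately show "\<phi> ` add_mults K rs \<subseteq> ?N" using K(2) by blast
qed

lemma regular_on_unfold:
  assumes "regular_on rs J T"
  shows "\<forall>i<length rs. \<forall>p\<in>J. rs ! i * p \<in> add_mults T (take i rs) \<longrightarrow> p \<in> add_mults T (take i rs)"
    and "\<not> J \<subseteq> add_mults T rs"
proof -
  have "(\<forall>i<length rs. \<forall>p\<in>J. rs ! i * p \<in> add_mults T (take i rs) \<longrightarrow> p \<in> add_mults T (take i rs))
    \<and> \<not> J \<subseteq> add_mults T rs"
    using assms
  proof (induction rs arbitrary: T)
    case (Cons r rs)
    then have IH: "\<forall>i<length rs. \<forall>p\<in>J. rs ! i * p \<in> add_mults (add_mult T r J) (take i rs)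
        \<longrightarrow> p \<in> add_mults (add_mult T r J) (take i rs)" "\<not> J \<subseteq> add_mults (add_mult T r J) rs"
      by auto
    have "p \<in> add_mults T (take i (r # rs))"
      if "i < length (r # rs)" "p \<in> J" "(r # rs) ! i * p \<in> add_mults T (take i (r # rs))" for i p
      using that IH(1) Cons.prems by (cases i) auto
    then show ?case using IH(2) by auto
  qed simp
  then show "\<forall>i<length rs. \<forall>p\<in>J. rs ! i * p \<in> add_mults T (take i rs) \<longrightarrow> p \<in> add_mults T (take i rs)"
    "\<not> J \<subseteq> add_mults T rs" by blast+
qed

lemma regular_sequence_if_regular_on:
  assumes "set rs \<subseteq> polys V" "regular_on rs J K"
  shows "regular_sequence (mpoly_ring V) Q rs"
  unfolding regular_sequence_def
proof (intro conjI allI impI)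
  show "set rs \<subseteq> carrier (mpoly_ring V)" using assms(1) by simp
  have all: "\<phi> ` J = carrier Q" by (simp add: \<phi>_carrier)
  note facts = add_mults_facts[OF _ K(1) order_refl K(2)]
  show "set_smult (mpoly_ring V) Q (set rs) \<noteq> carrier Q"
  proof
    assume "set_smult (mpoly_ring V) Q (set rs) = carrier Q"
    then have "\<phi> ` add_mults K rs = \<phi> ` J" using set_smult_eq[OF assms(1)] \<phi>_carrier by simp
    then have "p \<in> add_mults K rs" if "p \<in> J" for p
      using \<phi>_mem[OF facts(1)[OF assms(1)] facts(2)[OF assms(1)] facts(3)[OF assms(1)] that] that by simp
    then show False using regular_on_unfold(2)[OF assms(2)] by blast
  qed
  fix i assume i: "i < length rs"
  have t: "set (take i rs) \<subseteq> polys V" using assms(1) set_take_subset by fast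
  let ?T = "add_mults K (take i rs)"
  have eq: "set_smult (mpoly_ring V) Q (set (take i rs)) = \<phi> ` ?T" using set_smult_eq[OF t] .
  interpret T: quotient_module "mpoly_ring V" Q "\<phi> ` ?T"
    using modQ submodule_image[OF facts(1)[OF t] facts(3)[OF t]] by (rule quotient_module.intro)
  have r: "rs ! i \<in> polys V" using assms(1) i by auto
  have "x \<in> \<phi> ` ?T" if x: "x \<in> carrier Q" "rs ! i \<odot>\<^bsub>Q\<^esub> x \<in> \<phi> ` ?T" for x
  proof -
    obtain p where p: "p \<in> J" "x = \<phi> p" using x(1) \<phi>_carrier by auto
    have "\<phi> (rs ! i * p) \<in> \<phi> ` ?T" using x(2) p \<phi>_smult[OF r] by simp
    then have "rs ! i * p \<in> ?T"
      using \<phi>_mem[OF facts(1)[OF t] facts(2)[OF t] facts(3)[OF t] R.submod_mult[OF J(1) r p(1)]] by simp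
    then have "p \<in> ?T" using regular_on_unfold(1)[OF assms(2)] i p(1) by simp
    then show ?thesis using p(2) by simp
  qed
  moreover have "rs ! i \<in> carrier (mpoly_ring V)" using r unfolding mpoly_ring_simps .
  ultimately show "nonzerodivisor_on (rs ! i) (quot_module Q (set_smult (mpoly_ring V) Q (set (take i rs))))"
    unfolding eq T.nonzerodivisor_quot[OF \<open>rs ! i \<in> carrier (mpoly_ring V)\<close>] by blast
qed

lemma annihilator_eq: "annihilator (mpoly_ring V) Q = {a \<in> polys V. \<forall>p\<in>J. a * p \<in> K}"
proof -
  have "a \<odot>\<^bsub>Q\<^esub> \<phi> p = \<zero>\<^bsub>Q\<^esub> \<longleftrightarrow> a * p \<in> K" if "a \<in> polys V" "p \<in> J" for a p
    using \<phi>_zero[OF R.submod_mult[OF J(1) that]] \<phi>_smult[OF that] by simp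
  then show ?thesis unfolding annihilator_def mpoly_ring_simps \<phi>_carrier ball_simps(9) by blast
qed

end

section \<open>Dimension and Cohen-Macaulayness\<close>

lemma face_ideal_smaller_face:
  assumes "S \<subseteq> F"
  shows "face_ideal V {F} \<subseteq> (face_ideal V {S} :: ('v, 'k::field) mpoly set)"
proof
  fix p :: "('v, 'k) mpoly" assume p: "p \<in> face_ideal V {F}"
  show "p \<in> face_ideal V {S}"
  proof (rule face_idealI)
    fix m assume m: "m \<in> monoms p"
    show "supp m \<subseteq> V" by (rule face_idealD(1)[OF p m])
    have "\<not> supp m \<subseteq> F" by (rule face_idealD(2)[OF p m]) simp
    then show "\<not> supp m \<subseteq> S'" if "S' \<in> {S}" for S' using that assms by blast
  qed
qed

lemma mpoly_subgroup:
  assumes "poly_ideal V I" "I \<subseteq> polys V"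
  shows "subgroup I (add_monoid (mpoly_ring V :: ('v, 'k::field) mpoly ring))"
proof -
  interpret R: subring_set "polys V :: ('v, 'k) mpoly set" by (rule subring_polys)
  interpret A: cring "mpoly_ring V :: ('v, 'k) mpoly ring" by (rule cring_mpoly)
  show ?thesis
  proof (rule A.add.subgroupI)
    show "I \<subseteq> carrier (mpoly_ring V :: ('v, 'k) mpoly ring)" using assms(2) by simp
    show "I \<noteq> {}" using R.submod_zero[OF assms(1)] by blast
    fix a assume a: "a \<in> I"
    have "\<ominus>\<^bsub>mpoly_ring V\<^esub> a = - a" using a assms(2) by (intro a_inv_mpoly) blast
    then show "\<ominus>\<^bsub>mpoly_ring V\<^esub> a \<in> I" using R.submod_uminus[OF assms(1) a] by simp
    fix b assume b: "b \<in> I"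
    then show "a \<oplus>\<^bsub>mpoly_ring V\<^esub> b \<in> I" using R.submod_add[OF assms(1) a b] by simp
  qed
qed

lemma ideal_mpoly:
  assumes "poly_ideal V I" "I \<subseteq> polys V"
  shows "ideal I (mpoly_ring V :: ('v, 'k::field) mpoly ring)"
proof (rule idealI)
  interpret R: subring_set "polys V :: ('v, 'k) mpoly set" by (rule subring_polys)
  show "ring (mpoly_ring V :: ('v, 'k) mpoly ring)" using cring_mpoly cring.axioms(1) by blast
  show "subgroup I (add_monoid (mpoly_ring V :: ('v, 'k) mpoly ring))" by (rule mpoly_subgroup[OF assms])
  fix a x assume "a \<in> I" "x \<in> carrier (mpoly_ring V :: ('v, 'k) mpoly ring)"
  then show "x \<otimes>\<^bsub>mpoly_ring V\<^esub> a \<in> I" "a \<otimes>\<^bsub>mpoly_ring V\<^esub> x \<in> I"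
    using R.submod_mult[OF assms(1), of x a] by (simp_all add: mult.commute)
qed

lemma mpoly_ideal:
  assumes "ideal I (mpoly_ring V :: ('v, 'k::field) mpoly ring)"
  shows "poly_ideal V I" "I \<subseteq> polys V"
proof -
  interpret I: ideal I "mpoly_ring V" by (rule assms)
  show "I \<subseteq> polys V" using I.a_subset by simp
  show "poly_ideal V I" unfolding subring_set.submod_def[OF subring_polys]
    using additive_subgroup.a_closed[OF I.additive_subgroup_axioms] I.I_l_closed additive_subgroup.zero_closed[OF I.additive_subgroup_axioms] by auto
qed

lemma primeideal_face_ideal:
  assumes "finite F"
  shows "primeideal (face_ideal V {F}) (mpoly_ring V :: ('v, 'k::field) mpoly ring)"
proof (rule primeidealI)
  show "ideal (face_ideal V {F}) (mpoly_ring V :: ('v, 'k) mpoly ring)"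
    by (rule ideal_mpoly[OF poly_ideal_face_ideal face_ideal_subset_polys])
  show "cring (mpoly_ring V :: ('v, 'k) mpoly ring)" by (rule cring_mpoly)
  have "1 \<in> polys V - (face_ideal V {F} :: ('v, 'k) mpoly set)"
    using one_in_polys by (simp add: face_ideal_def)
  then show "carrier (mpoly_ring V) \<noteq> (face_ideal V {F} :: ('v, 'k) mpoly set)" by auto
qed (use face_ideal_prime[OF assms] in auto)

lemma primeideal_quot:
  assumes "ideal A R" "primeideal P R" "A \<subseteq> P" "cring R"
  shows "primeideal ((+>\<^bsub>R\<^esub>) A ` P) (R Quot A)"
    and "x \<in> carrier R \<Longrightarrow> A +>\<^bsub>R\<^esub> x \<in> (+>\<^bsub>R\<^esub>) A ` P \<longleftrightarrow> x \<in> P"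
proof -
  interpret R: cring R by fact
  interpret A: ideal A R by fact
  interpret P: primeideal P R by fact
  show mem: "A +>\<^bsub>R\<^esub> x \<in> (+>\<^bsub>R\<^esub>) A ` P \<longleftrightarrow> x \<in> P" if x: "x \<in> carrier R" for x
  proof
    assume "A +>\<^bsub>R\<^esub> x \<in> (+>\<^bsub>R\<^esub>) A ` P"
    then obtain p where p: "p \<in> P" "A +>\<^bsub>R\<^esub> x = A +>\<^bsub>R\<^esub> p" by blast
    have pc: "p \<in> carrier R" using p(1) P.a_subset by blast
    have "x \<ominus>\<^bsub>R\<^esub> p \<in> P"
      using R.quotient_eq_iff_same_a_r_cos[OF assms(1) x pc] p(2) assms(3) by blast
    then have "(x \<ominus>\<^bsub>R\<^esub> p) \<oplus>\<^bsub>R\<^esub> p \<in> P" using p(1) by (rule P.a_closed)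
    moreover have "(x \<ominus>\<^bsub>R\<^esub> p) \<oplus>\<^bsub>R\<^esub> p = x" using x pc by (simp add: R.minus_eq R.a_assoc R.l_neg)
    ultimately show "x \<in> P" by simp
  qed blast
  have car: "carrier (R Quot A) = (+>\<^bsub>R\<^esub>) A ` carrier R" by (auto simp: FactRing_simps)
  show "primeideal ((+>\<^bsub>R\<^esub>) A ` P) (R Quot A)"
  proof (rule primeidealI)
    show "ideal ((+>\<^bsub>R\<^esub>) A ` P) (R Quot A)"
      by (rule R.ring_ideal_imp_quot_ideal[OF assms(1) P.ideal_axioms])
    show "cring (R Quot A)" by (rule A.quotient_is_cring[OF assms(4)])
    show "carrier (R Quot A) \<noteq> (+>\<^bsub>R\<^esub>) A ` P"
    proof
      assume "carrier (R Quot A) = (+>\<^bsub>R\<^esub>) A ` P"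
      then have "x \<in> P" if "x \<in> carrier R" for x using mem[OF that] car that by blast
      then show False using P.I_notcarr P.a_subset by blast
    qed
    fix U Z assume UZ: "U \<in> carrier (R Quot A)" "Z \<in> carrier (R Quot A)"
      "U \<otimes>\<^bsub>R Quot A\<^esub> Z \<in> (+>\<^bsub>R\<^esub>) A ` P"
    then obtain x y where xy: "x \<in> carrier R" "y \<in> carrier R" "U = A +>\<^bsub>R\<^esub> x" "Z = A +>\<^bsub>R\<^esub> y"
      using car by auto
    then have "A +>\<^bsub>R\<^esub> (x \<otimes>\<^bsub>R\<^esub> y) \<in> (+>\<^bsub>R\<^esub>) A ` P"
      using UZ(3) A.rcoset_mult_add by (simp add: FactRing_def)
    then have "x \<otimes>\<^bsub>R\<^esub> y \<in> P" using mem[of "x \<otimes>\<^bsub>R\<^esub> y"] xy by simp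
    then have "x \<in> P \<or> y \<in> P" using P.I_prime xy by blast
    then show "U \<in> (+>\<^bsub>R\<^esub>) A ` P \<or> Z \<in> (+>\<^bsub>R\<^esub>) A ` P" using xy by blast
  qed
qed

text \<open>The ideal \<open>A\<close> is squeezed between the ideal of a family of faces of size at most \<open>d\<close> and the prime
of one face \<open>F0\<close> of size \<open>d\<close>. Pulled back to \<open>k[V]\<close>, a chain of primes satisfies the hypotheses of
\<open>chain_length_bound\<close>, with \<open>r i\<close> any element of the next prime that is not in the present one.
Removing the vertices of \<open>F0\<close> one by one gives a chain of length \<open>d\<close>.\<close>

theorem krull_dim_quot:
  fixes A :: "('v, 'k::field) mpoly set"
  assumes V: "finite V" "F0 \<subseteq> V" and A: "ideal A (mpoly_ring V)"
    and \<F>: "finite \<F>" "\<And>F. F \<in> \<F> \<Longrightarrow> finite F \<and> card F \<le> card F0"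
    and bounds: "face_ideal V \<F> \<subseteq> A" "A \<subseteq> face_ideal V {F0}"
  shows "krull_dim (mpoly_ring V Quot A) = enat (card F0)"
proof -
  let ?R = "mpoly_ring V :: ('v, 'k) mpoly ring" and ?d = "card F0"
  interpret R: cring ?R by (rule cring_mpoly)
  interpret A: ideal A ?R by (rule A)
  have car: "carrier (?R Quot A) = (+>\<^bsub>?R\<^esub>) A ` polys V" by (auto simp: FactRing_def A_RCOSETS_def')
  let ?chain = "\<lambda>n P. (\<forall>i\<le>n. primeideal (P i) (?R Quot A)) \<and> (\<forall>i<n. P i \<subset> P (Suc i))"
  have upper: "n \<le> ?d" if ch: "?chain n P" for n P
  proof -
    define L where "L i = {r \<in> polys V. A +>\<^bsub>?R\<^esub> r \<in> P i}" for i
    have prime: "primeideal (L i) ?R" if "i \<le> n" for i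
    proof -
      have "ring_hom_ring ?R (?R Quot A) ((+>\<^bsub>?R\<^esub>) A)" by (rule A.rcos_ring_hom_ring)
      then have "primeideal {r \<in> carrier ?R. A +>\<^bsub>?R\<^esub> r \<in> P i} ?R"
        using ch that by (intro ring_hom_ring.primeideal_vimage[OF _ R.is_cring]) auto
      then show ?thesis by (simp add: L_def)
    qed
    have "\<exists>r. r \<in> L (Suc i) \<and> r \<notin> L i" if i: "i < n" for i
    proof -
      have "P i \<subset> P (Suc i)" using ch \<open>i < n\<close> by simp
      then obtain y where y: "y \<in> P (Suc i)" "y \<notin> P i" by blast
      have "P (Suc i) \<subseteq> carrier (?R Quot A)"
        using ch i by (intro additive_subgroup.a_subset ideal.axioms(1) primeideal.axioms(1)) simp
      then obtain r where "r \<in> polys V" "y = A +>\<^bsub>?R\<^esub> r" using y(1) car by blast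
      then show ?thesis using y by (auto simp: L_def)
    qed
    then obtain r where r: "\<And>i. i < n \<Longrightarrow> r i \<in> L (Suc i) \<and> r i \<notin> L i" by metis
    define rs where "rs = map r [0..<n]"
    have "length rs \<le> ?d"
    proof (rule chain_length_bound[OF \<F>, of rs V L])
      show "poly_ideal V (L i)" if "i \<le> length rs" for i
        using that by (intro mpoly_ideal(1) primeideal.axioms(1) prime) (simp add: rs_def)
      show "rs ! i \<in> polys V \<and> rs ! i \<in> L (Suc i) \<and> L i \<subseteq> L (Suc i)" if "i < length rs" for i
        using that r[of i] ch by (auto simp: rs_def L_def)
      show "a \<in> L i" if "i < length rs" "a \<in> polys V" "rs ! i * a \<in> L i" for i a
      proof -
        have "primeideal (L i) ?R" using prime that by (simp add: rs_def)
        then have "r i \<in> L i \<or> a \<in> L i"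
          using primeideal.I_prime[of "L i" ?R "r i" a] that r[of i] by (simp add: rs_def L_def)
        then show ?thesis using r[of i] that by (simp add: rs_def)
      qed
      have "primeideal (L n) ?R" using prime by simp
      then have "L n \<noteq> carrier ?R" using primeideal.I_notcarr by blast
      then show "1 \<notin> L (length rs)"
        using ideal.one_imp_carrier[OF primeideal.axioms(1)[OF \<open>primeideal (L n) ?R\<close>]] by (auto simp: rs_def)
      show "face_ideal V \<F> \<subseteq> L 0"
      proof
        fix x :: "('v, 'k) mpoly" assume "x \<in> face_ideal V \<F>"
        then have x: "x \<in> A" "x \<in> polys V" using bounds face_ideal_subset_polys by blast+
        have P0: "ideal (P 0) (?R Quot A)" using ch primeideal.axioms(1) by blast
        have "A +>\<^bsub>?R\<^esub> x = \<zero>\<^bsub>?R Quot A\<^esub>"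
          using R.a_rcos_zero[OF A x(1)] by (simp add: FactRing_def)
        then have "A +>\<^bsub>?R\<^esub> x \<in> P 0"
          using additive_subgroup.zero_closed[OF ideal.axioms(1)[OF P0]] by simp
        then show "x \<in> L 0" using x by (simp add: L_def)
      qed
    qed auto
    then show ?thesis by (simp add: rs_def)
  qed
  have "\<exists>P. ?chain ?d P"
  proof -
    have fF: "finite F0" using V finite_subset by blast
    then obtain f where f: "F0 = f ` {..<?d}" "inj_on f {..<?d}"
      using ex_bij_betw_nat_finite[OF fF] by (auto simp: bij_betw_def atLeast0LessThan)
    define S where "S i = f ` {i..<?d}" for i
    define P where "P i = (+>\<^bsub>?R\<^esub>) A ` face_ideal V {S i}" for i
    have S0: "S 0 = F0" using f(1) by (simp add: S_def atLeast0LessThan)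
    have SS: "S i \<subseteq> F0" "finite (S i)" for i using f(1) by (auto simp: S_def)
    have sub: "A \<subseteq> face_ideal V {S i}" for i
    proof -
      have "face_ideal V {F0} \<subseteq> (face_ideal V {S i} :: ('v, 'k) mpoly set)"
        by (rule face_ideal_smaller_face[OF SS(1)])
      then show ?thesis using bounds(2) by blast
    qed
    have pr: "primeideal (P i) (?R Quot A)" for i
      unfolding P_def using primeideal_quot(1)[OF A primeideal_face_ideal[OF SS(2)] sub R.is_cring] .
    have mem: "A +>\<^bsub>?R\<^esub> x \<in> P i \<longleftrightarrow> x \<in> face_ideal V {S i}" if "x \<in> polys V" for x i
      unfolding P_def using primeideal_quot(2)[OF A primeideal_face_ideal[OF SS(2)] sub R.is_cring] that by simp
    have "P i \<subset> P (Suc i)" if i: "i < ?d" for i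
    proof
      have "S (Suc i) \<subseteq> S i" by (auto simp: S_def)
      then have "face_ideal V {S i} \<subseteq> (face_ideal V {S (Suc i)} :: ('v, 'k) mpoly set)"
        by (rule face_ideal_smaller_face)
      then show "P i \<subseteq> P (Suc i)" by (auto simp: P_def)
      let ?x = "monom (Poly_Mapping.single (f i) 1) 1 :: ('v, 'k) mpoly"
      have fi: "f i \<in> S i" "f i \<notin> S (Suc i)" "f i \<in> V"
      proof -
        show "f i \<in> S i" using i by (simp add: S_def)
        show "f i \<in> V" using f(1) i V(2) by blast
        have "i = j" if "j < ?d" "f i = f j" for j using inj_onD[OF f(2) that(2)] i that(1) by simp
        then show "f i \<notin> S (Suc i)" by (fastforce simp: S_def)
      qed
      then have "?x \<in> face_ideal V {S (Suc i)}" "?x \<notin> face_ideal V {S i}" "?x \<in> polys V"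
        by (auto simp: monom_in_face_ideal)
      then show "P i \<noteq> P (Suc i)" using mem by blast
    qed
    then show ?thesis using pr by blast
  qed
  then have "enat ?d \<le> krull_dim (?R Quot A)"
    unfolding krull_dim_def by (intro Sup_upper) blast
  moreover have "krull_dim (?R Quot A) \<le> enat ?d"
    unfolding krull_dim_def by (rule Sup_least) (use upper in auto)
  ultimately show ?thesis by (rule antisym[OF _ _, rotated])
qed

context ideal_quotient
begin

text \<open>Choose \<open>u\<close> outside the submodule generated by the products with the whole sequence, and let \<open>L i\<close>
be the polynomials that multiply \<open>u\<close> into the submodule given by the first \<open>i\<close> elements.\<close>

lemma regular_sequence_length_le:
  assumes \<F>: "finite \<F>" "\<And>F. F \<in> \<F> \<Longrightarrow> finite F \<and> card F \<le> d"
    and ann: "face_ideal V \<F> \<subseteq> annihilator (mpoly_ring V) Q"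
    and rs: "regular_sequence (mpoly_ring V) Q rs"
  shows "length rs \<le> d"
proof -
  let ?R = "mpoly_ring V :: ('v, 'k) mpoly ring"
  let ?N = "\<lambda>i. set_smult ?R Q (set (take i rs))"
  have rsV: "set rs \<subseteq> carrier ?R" using rs by (simp add: regular_sequence_def)
  have t: "set (take i rs) \<subseteq> carrier ?R" for i using rsV set_take_subset by fast
  have N: "submodule (?N i) ?R Q" for i using set_smult_facts(1)[OF modQ t] .
  have "set_smult ?R Q (set rs) \<noteq> carrier Q" using rs by (simp add: regular_sequence_def)
  then obtain u where u: "u \<in> carrier Q" "u \<notin> ?N (length rs)"
    using Q.submoduleE(1)[OF N[of "length rs"]] by auto
  define L where "L i = {a \<in> polys V. a \<odot>\<^bsub>Q\<^esub> u \<in> ?N i}" for i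
  have mono: "?N i \<subseteq> ?N (Suc i)" for i
  proof (rule set_smult_facts(3)[OF modQ t N])
    fix a x assume "a \<in> set (take i rs)" "x \<in> carrier Q"
    moreover have "set (take i rs) \<subseteq> set (take (Suc i) rs)" by (rule set_take_subset_set_take) simp
    ultimately show "a \<odot>\<^bsub>Q\<^esub> x \<in> ?N (Suc i)" using set_smult_facts(2)[OF modQ t] by blast
  qed
  show ?thesis
  proof (rule chain_length_bound[OF \<F>, of rs V L])
    show "poly_ideal V (L i)" for i
    proof -
      have "(0 :: ('v, 'k) mpoly) \<odot>\<^bsub>Q\<^esub> u \<in> ?N i"
        using Q.smult_l_null[OF u(1)] subgroup.one_closed[OF submodule.axioms(1)[OF N[of i]]] by simp
      moreover have "(a + b) \<odot>\<^bsub>Q\<^esub> u \<in> ?N i"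
        if "a \<in> polys V" "b \<in> polys V" "a \<odot>\<^bsub>Q\<^esub> u \<in> ?N i" "b \<odot>\<^bsub>Q\<^esub> u \<in> ?N i" for a b
        using Q.smult_l_distr[of a b u] Q.submoduleE(5)[OF N that(3,4)] that u(1) by simp
      moreover have "(a * b) \<odot>\<^bsub>Q\<^esub> u \<in> ?N i" if "a \<in> polys V" "b \<in> polys V" "b \<odot>\<^bsub>Q\<^esub> u \<in> ?N i" for a b
        using Q.smult_assoc1[of a b u] Q.submoduleE(4)[OF N, of a] that u(1) by simp
      ultimately show ?thesis unfolding R.submod_def by (auto simp: L_def polys_facts)
    qed
    fix i assume i: "i < length rs"
    have ri: "rs ! i \<in> polys V" using rsV i by auto
    have "rs ! i \<in> set (take (Suc i) rs)" using i by (simp add: take_Suc_conv_app_nth)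
    then have "rs ! i \<odot>\<^bsub>Q\<^esub> u \<in> ?N (Suc i)" using set_smult_facts(2)[OF modQ t _ u(1)] by blast
    then show "rs ! i \<in> polys V \<and> rs ! i \<in> L (Suc i) \<and> L i \<subseteq> L (Suc i)"
      using ri mono[of i] by (auto simp: L_def)
    fix a assume a: "a \<in> polys V" "rs ! i * a \<in> L i"
    interpret T: quotient_module ?R Q "?N i" using modQ N by (rule quotient_module.intro)
    have "rs ! i \<odot>\<^bsub>Q\<^esub> (a \<odot>\<^bsub>Q\<^esub> u) \<in> ?N i"
      using a ri Q.smult_assoc1[of "rs ! i" a u] u(1) by (simp add: L_def)
    moreover have "nonzerodivisor_on (rs ! i) (quot_module Q (?N i))"
      using rs i by (simp add: regular_sequence_def)
    moreover have "rs ! i \<in> carrier ?R" "a \<odot>\<^bsub>Q\<^esub> u \<in> carrier Q"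
      using ri a(1) u(1) Q.smult_closed[of a u] by simp_all
    ultimately have "a \<odot>\<^bsub>Q\<^esub> u \<in> ?N i" using T.nonzerodivisor_quot[of "rs ! i"] by blast
    then show "a \<in> L i" using a(1) by (simp add: L_def)
  next
    show "1 \<notin> L (length rs)" using u Q.smult_one[OF u(1)] by (simp add: L_def)
    show "face_ideal V \<F> \<subseteq> L 0"
    proof
      fix a :: "('v, 'k) mpoly" assume a: "a \<in> face_ideal V \<F>"
      then have "a \<odot>\<^bsub>Q\<^esub> u = \<zero>\<^bsub>Q\<^esub>" using ann u(1) by (auto simp: annihilator_def)
      then show "a \<in> L 0"
        using a face_ideal_subset_polys[of V \<F>] subgroup.one_closed[OF submodule.axioms(1)[OF N[of 0]]]
        by (auto simp: L_def)
    qed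
  qed
qed

lemma ideal_annihilator: "ideal (annihilator (mpoly_ring V) Q) (mpoly_ring V)"
  unfolding annihilator_eq
proof (rule ideal_mpoly)
  let ?A = "{a \<in> polys V. \<forall>p\<in>J. a * p \<in> K}"
  show "poly_ideal V ?A"
    unfolding R.submod_def
  proof (intro conjI ballI)
    show "0 \<in> ?A" using R.submod_zero[OF K(1)] by (simp add: polys_facts)
    fix x assume x: "x \<in> ?A"
    show "x + y \<in> ?A" if "y \<in> ?A" for y
      using x that R.submod_add[OF K(1)] by (simp add: polys_facts distrib_right)
    show "a * x \<in> ?A" if "a \<in> polys V" for a
      using x that R.submod_mult[OF K(1)] by (simp add: polys_facts mult.assoc)
  qed
qed blast

theorem cohen_macaulay_of_dim:
  assumes "finite V" "F0 \<subseteq> V"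
    and \<F>: "finite \<F>" "\<And>F. F \<in> \<F> \<Longrightarrow> finite F \<and> card F \<le> card F0"
    and bounds: "face_ideal V \<F> \<subseteq> {a \<in> polys V. \<forall>p\<in>J. a * p \<in> K}"
      "{a \<in> polys V. \<forall>p\<in>J. a * p \<in> K} \<subseteq> face_ideal V {F0}"
    and rs: "set rs \<subseteq> \<mm>" "set rs \<subseteq> polys V" "length rs = card F0" "regular_on rs J K"
  shows "module_dim (mpoly_ring V) Q = enat (card F0)" "cohen_macaulay (mpoly_ring V) \<mm> Q"
proof -
  show dim: "module_dim (mpoly_ring V) Q = enat (card F0)"
    unfolding module_dim_def
    using krull_dim_quot[OF assms(1,2) ideal_annihilator \<F>] bounds by (simp add: annihilator_eq)
  have "enat (card F0) \<le> module_depth (mpoly_ring V) \<mm> Q"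
    unfolding module_depth_def
    using regular_sequence_if_regular_on[OF rs(2,4)] rs(1) unfolding rs(3)[symmetric]
    by (intro Sup_upper CollectI exI[of _ rs]) simp
  moreover have "module_depth (mpoly_ring V) \<mm> Q \<le> enat (card F0)"
    unfolding module_depth_def
    using regular_sequence_length_le[OF \<F>] bounds(1) by (intro Sup_least) (auto simp: annihilator_eq)
  ultimately show "cohen_macaulay (mpoly_ring V) \<mm> Q"
    unfolding cohen_macaulay_def dim by auto
qed

end

section \<open>Gradings\<close>

lemma (in ideal_quotient) \<phi>_0: "\<phi> 0 = \<zero>\<^bsub>Q\<^esub>"
  using \<phi>_zero[of 0] R.submod_zero[OF J(1)] R.submod_zero[OF K(1)] by simp

lemma (in ideal_quotient) \<phi>_in: "p \<in> J \<Longrightarrow> \<phi> p \<in> carrier Q"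
  by (simp add: \<phi>_carrier)

lemma (in ideal_quotient) \<phi>_eq_iff:
  assumes "p \<in> J" "q \<in> J"
  shows "\<phi> p = \<phi> q \<longleftrightarrow> p - q \<in> K"
proof -
  have d: "p - q \<in> J" using R.submod_diff[OF J(1) assms] .
  have "\<phi> p = \<phi> (p - q) \<oplus>\<^bsub>Q\<^esub> \<phi> q" using \<phi>_add[OF d assms(2)] by simp
  then show ?thesis
    using \<phi>_zero[OF d] Q.M.l_zero[OF \<phi>_in[OF assms(2)]]
      Q.M.add.r_cancel_one[OF \<phi>_in[OF d] \<phi>_in[OF assms(2)]]
    using Q.M.add.r_cancel_one' \<phi>_in assms(2) d by metis
qed

lemma (in ideal_quotient) \<phi>_sum:
  assumes "finite D" "\<And>d. d \<in> D \<Longrightarrow> g d \<in> J"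
  shows "(\<Oplus>\<^bsub>Q\<^esub>d\<in>D. \<phi> (g d)) = \<phi> (\<Sum>d\<in>D. g d)"
  using assms
proof (induction D rule: finite_induct)
  case empty
  then show ?case by (simp add: \<phi>_0)
next
  case (insert d D)
  have "(\<Oplus>\<^bsub>Q\<^esub>d\<in>insert d D. \<phi> (g d)) = \<phi> (g d) \<oplus>\<^bsub>Q\<^esub> (\<Oplus>\<^bsub>Q\<^esub>d\<in>D. \<phi> (g d))"
    using insert.hyps insert.prems \<phi>_in by (intro Q.M.finsum_insert) auto
  also have "\<dots> = \<phi> (g d) \<oplus>\<^bsub>Q\<^esub> \<phi> (\<Sum>d\<in>D. g d)" using insert by simp
  also have "\<dots> = \<phi> (g d + (\<Sum>d\<in>D. g d))"
    using insert.prems by (intro \<phi>_add[symmetric] R.submod_sum[OF J(1)]) auto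
  finally show ?case using insert.hyps by simp
qed

text \<open>Submodules and quotients of \<open>J / K\<close> are again quotients of ideals. Applied twice, starting from
\<open>R / I\<close>, this describes the factors of a filtration.\<close>

lemma (in ideal_quotient) ideal_quotient_sub:
  assumes T: "poly_ideal V T" "K \<subseteq> T" "T \<subseteq> J"
  shows "ideal_quotient V (Q\<lparr>carrier := \<phi> ` T\<rparr>) \<phi> T K"
proof (rule ideal_quotient.intro)
  show "module (mpoly_ring V) (Q\<lparr>carrier := \<phi> ` T\<rparr>)"
    by (rule submodule.submodule_is_module[OF submodule_image[OF T(1,3)] modQ])
  show "T \<subseteq> polys V" using T(3) J(2) by blast
  fix p q assume "p \<in> T" 
  then have p: "p \<in> J" using T(3) by blast
  show "\<phi> p = \<zero>\<^bsub>Q\<lparr>carrier := \<phi> ` T\<rparr>\<^esub> \<longleftrightarrow> p \<in> K" using \<phi>_zero[OF p] by simp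
  show "\<phi> (p + q) = \<phi> p \<oplus>\<^bsub>Q\<lparr>carrier := \<phi> ` T\<rparr>\<^esub> \<phi> q" if "q \<in> T"
    using \<phi>_add[OF p, of q] that T(3) by auto
  show "\<phi> (q * p) = q \<odot>\<^bsub>Q\<lparr>carrier := \<phi> ` T\<rparr>\<^esub> \<phi> p" if "q \<in> polys V"
    using \<phi>_smult[OF that p] by simp
qed (use T K in auto)

lemma (in ideal_quotient) ideal_quotient_quot:
  assumes T: "poly_ideal V T" "K \<subseteq> T" "T \<subseteq> J"
  shows "ideal_quotient V (quot_module Q (\<phi> ` T)) (\<lambda>p. \<phi> ` T +>\<^bsub>Q\<^esub> \<phi> p) J T"
proof -
  interpret T: quotient_module "mpoly_ring V" Q "\<phi> ` T"
    using modQ submodule_image[OF T(1,3)] by (rule quotient_module.intro)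
  show ?thesis
  proof (rule ideal_quotient.intro)
    show "module (mpoly_ring V) T.Q" by (rule T.module_quot)
    show "carrier T.Q = (\<lambda>p. \<phi> ` T +>\<^bsub>Q\<^esub> \<phi> p) ` J"
      using T.quot_carrier by (simp add: \<phi>_carrier image_image)
    fix p q assume p: "p \<in> J"
    show "T.coset (\<phi> p) = \<zero>\<^bsub>T.Q\<^esub> \<longleftrightarrow> p \<in> T"
      using T.coset_zero_iff[OF \<phi>_in[OF p]] \<phi>_mem[OF T p] by (simp add: T.quot_zero)
    show "T.coset (\<phi> (p + q)) = T.coset (\<phi> p) \<oplus>\<^bsub>T.Q\<^esub> T.coset (\<phi> q)" if "q \<in> J"
      using T.quot_add[OF \<phi>_in[OF p] \<phi>_in[OF that]] \<phi>_add[OF p that] by simp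
    show "T.coset (\<phi> (q * p)) = q \<odot>\<^bsub>T.Q\<^esub> T.coset (\<phi> p)" if "q \<in> polys V"
      using T.quot_smult[of q "\<phi> p"] \<phi>_in[OF p] \<phi>_smult[OF that p] that by simp
  qed (use T J in auto)
qed

lemma a_r_coset_regular: "a_r_coset (regular_module R) = a_r_coset R"
  by (intro ext) (simp add: a_r_coset_def' regular_module_def)

lemma regular_module_simps:
  "carrier (regular_module R) = carrier R" "x \<oplus>\<^bsub>regular_module R\<^esub> y = x \<oplus>\<^bsub>R\<^esub> y"
  "\<zero>\<^bsub>regular_module R\<^esub> = \<zero>\<^bsub>R\<^esub>" "a \<odot>\<^bsub>regular_module R\<^esub> x = a \<otimes>\<^bsub>R\<^esub> x"
  by (simp_all add: regular_module_def)

lemma ideal_quotient_regular: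
  "ideal_quotient V (regular_module (mpoly_ring V)) (\<lambda>p. p) (polys V) ({0} :: ('v, 'k::field) mpoly set)"
proof (rule ideal_quotient.intro)
  show "module (mpoly_ring V) (regular_module (mpoly_ring V :: ('v, 'k) mpoly ring))"
  proof (rule moduleI)
    show "abelian_group (regular_module (mpoly_ring V :: ('v, 'k) mpoly ring))"
      by (rule abelian_groupI)
        (auto simp: regular_module_simps polys_facts algebra_simps intro: bexI[of _ "- x" for x])
  qed (auto simp: cring_mpoly regular_module_simps polys_facts algebra_simps)
  show "poly_ideal V (polys V :: ('v, 'k) mpoly set)" by (rule poly_ideal_face_ideal)
  show "poly_ideal V ({0} :: ('v, 'k) mpoly set)"
    unfolding subring_set.submod_def[OF subring_polys] by simp
qed (auto simp: regular_module_simps polys_facts)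

lemma ideal_quotient_mpoly_quot:
  assumes "poly_ideal V I" "I \<subseteq> polys V"
  shows "ideal_quotient V (quot_module (regular_module (mpoly_ring V)) I)
    (\<lambda>p. I +>\<^bsub>mpoly_ring V\<^esub> p) (polys V) (I :: ('v, 'k::field) mpoly set)"
  using ideal_quotient.ideal_quotient_quot[OF ideal_quotient_regular assms(1) _ assms(2)]
    subring_set.submod_zero[OF subring_polys assms(1)] by (simp add: a_r_coset_regular)

lemma monomial_degree_superset:
  assumes "finite A" "supp m \<subseteq> A"
  shows "monomial_degree m = (\<Sum>v\<in>A. lookup m v)"
  unfolding monomial_degree_def using assms by (intro sum.mono_neutral_left) (auto simp: in_keys_iff)

lemma monomial_degree_add: "monomial_degree (m + n) = monomial_degree m + monomial_degree n"
proof -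
  have f: "finite (supp m \<union> supp n)" by simp
  show ?thesis
    using monomial_degree_superset[OF f, of m] monomial_degree_superset[OF f, of n]
      monomial_degree_superset[OF f, of "m + n"]
    by (simp add: supp_add lookup_add sum.distrib)
qed

definition hom_part :: "int \<Rightarrow> ('v, 'k::field) mpoly \<Rightarrow> ('v, 'k) mpoly" where
  "hom_part d p = (\<Sum>m\<in>{m\<in>monoms p. int (monomial_degree m) = d}. monom m (lookup p m))"

lemma lookup_hom_part: "lookup (hom_part d p) m = (if int (monomial_degree m) = d then lookup p m else 0)"
  by (auto simp: hom_part_def lookup_sum lookup_single when_def in_keys_iff sum.delta)

lemma monoms_hom_part: "monoms (hom_part d p) = {m\<in>monoms p. int (monomial_degree m) = d}"
  by (auto simp: in_keys_iff lookup_hom_part split: if_splits)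

lemma hom_part_in_face_ideal: "p \<in> face_ideal V \<F> \<Longrightarrow> hom_part d p \<in> face_ideal V \<F>"
  by (auto simp: face_ideal_def monoms_hom_part)

lemma hom_part_in_grading: "p \<in> polys V \<Longrightarrow> hom_part d p \<in> poly_grading V d"
  using hom_part_in_face_ideal[of p V "{}" d] by (auto simp: poly_grading_def monoms_hom_part)

lemma grading_in_polys: "p \<in> poly_grading V d \<Longrightarrow> p \<in> polys V"
  by (simp add: poly_grading_def)

locale graded_quotient = ideal_quotient V Q \<phi> "polys V" "face_ideal V \<F>"
  for V :: "'v set" and Q :: "(('v, 'k::field) mpoly, 'm, 'c) module_scheme"
    and \<phi> and \<F> :: "'v set set"
begin

abbreviation "Mdeg \<equiv> \<lambda>d. \<phi> ` poly_grading V d"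

text \<open>For use both with the graded pieces of the module and with those of a submodule, the pieces are an
arbitrary family \<open>T\<close>.\<close>

lemma decomposes_hom_part:
  assumes p: "p \<in> polys V" and T: "\<And>d. \<phi> (hom_part d p) \<in> T d"
  shows "decomposes Q T (\<phi> p) (\<lambda>d. \<phi> (hom_part d p))"
  unfolding decomposes_def
proof (intro conjI allI T)
  let ?D = "{d. \<phi> (hom_part d p) \<noteq> \<zero>\<^bsub>Q\<^esub>}"
  have hp: "hom_part d p \<in> polys V" for d using hom_part_in_face_ideal[OF p] .
  have D: "d \<in> ?D \<longleftrightarrow> hom_part d p \<notin> face_ideal V \<F>" for d using \<phi>_zero[OF hp] by simp
  have "?D \<subseteq> (\<lambda>m. int (monomial_degree m)) ` monoms p"
  proof
    fix d assume "d \<in> ?D"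
    then have "monoms (hom_part d p) \<noteq> {}" using D by (force simp: face_ideal_def)
    then show "d \<in> (\<lambda>m. int (monomial_degree m)) ` monoms p" by (auto simp: monoms_hom_part)
  qed
  then show fin: "finite ?D" by (rule finite_subset) simp
  have "p - (\<Sum>d\<in>?D. hom_part d p) \<in> face_ideal V \<F>"
  proof -
    have look: "lookup (p - (\<Sum>d\<in>?D. hom_part d p)) m
        = (if int (monomial_degree m) \<in> ?D then 0 else lookup p m)" for m
      using fin by (simp add: lookup_minus lookup_sum lookup_hom_part sum.delta')
    show ?thesis
    proof (rule face_idealI)
      fix m assume "m \<in> monoms (p - (\<Sum>d\<in>?D. hom_part d p))"
      then have m: "m \<in> monoms p" "int (monomial_degree m) \<notin> ?D"
        using look[of m] unfolding in_keys_iff by (simp_all split: if_splits)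
      then have "hom_part (int (monomial_degree m)) p \<in> face_ideal V \<F>" using D by blast
      moreover have "m \<in> monoms (hom_part (int (monomial_degree m)) p)" using m(1) by (simp add: monoms_hom_part)
      ultimately show "\<not> supp m \<subseteq> F" if "F \<in> \<F>" for F
        using face_idealD(2) that by blast
      show "supp m \<subseteq> V" by (rule face_idealD(1)[OF p m(1)])
    qed
  qed
  then have "\<phi> p = \<phi> (\<Sum>d\<in>?D. hom_part d p)"
    using \<phi>_eq_iff[OF p] R.submod_sum[OF R.submod_R, of ?D "\<lambda>d. hom_part d p"] hp by simp
  then show "\<phi> p = (\<Oplus>\<^bsub>Q\<^esub>d\<in>?D. \<phi> (hom_part d p))" using \<phi>_sum[OF fin, of "\<lambda>d. hom_part d p"] hp by simp
qed

text \<open>Lift both decompositions to homogeneous polynomials. Their sums differ by an element of a monomial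
ideal, so the homogeneous parts of the difference belong to the ideal as well.\<close>

lemma decomposition_unique:
  assumes f: "decomposes Q Mdeg x f" and g: "decomposes Q Mdeg x g"
  shows "f = g"
proof
  have *: "\<exists>p. (\<forall>d. p d \<in> poly_grading V d \<and> h d = \<phi> (p d)) \<and>
      (\<forall>E. finite E \<longrightarrow> {d. h d \<noteq> \<zero>\<^bsub>Q\<^esub>} \<subseteq> E \<longrightarrow> x = \<phi> (\<Sum>d\<in>E. p d))"
    if h: "decomposes Q Mdeg x h" for h
  proof -
    have "\<forall>d. \<exists>p. p \<in> poly_grading V d \<and> h d = \<phi> p" using h by (auto simp: decomposes_def)
    then obtain p where p: "\<And>d. p d \<in> poly_grading V d \<and> h d = \<phi> (p d)" by metis
    have pV: "p d \<in> polys V" for d using p grading_in_polys by blast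
    have "x = \<phi> (\<Sum>d\<in>E. p d)" if E: "finite E" "{d. h d \<noteq> \<zero>\<^bsub>Q\<^esub>} \<subseteq> E" for E
    proof -
      have "x = (\<Oplus>\<^bsub>Q\<^esub>d\<in>{d. h d \<noteq> \<zero>\<^bsub>Q\<^esub>}. h d)" using h by (simp add: decomposes_def)
      also have "\<dots> = (\<Oplus>\<^bsub>Q\<^esub>d\<in>E. h d)"
        using E p pV \<phi>_in by (intro Q.M.add.finprod_mono_neutral_cong_left) auto
      also have "\<dots> = (\<Oplus>\<^bsub>Q\<^esub>d\<in>E. \<phi> (p d))" using p by simp
      also have "\<dots> = \<phi> (\<Sum>d\<in>E. p d)" using \<phi>_sum[OF E(1)] pV by blast
      finally show ?thesis .
    qed
    then show ?thesis using p by blast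
  qed
  obtain p where p: "\<And>d. p d \<in> poly_grading V d \<and> f d = \<phi> (p d)"
    "\<And>E. finite E \<Longrightarrow> {d. f d \<noteq> \<zero>\<^bsub>Q\<^esub>} \<subseteq> E \<Longrightarrow> x = \<phi> (\<Sum>d\<in>E. p d)" using *[OF f] by metis
  obtain q where q: "\<And>d. q d \<in> poly_grading V d \<and> g d = \<phi> (q d)"
    "\<And>E. finite E \<Longrightarrow> {d. g d \<noteq> \<zero>\<^bsub>Q\<^esub>} \<subseteq> E \<Longrightarrow> x = \<phi> (\<Sum>d\<in>E. q d)" using *[OF g] by metis
  fix e
  \<comment> \<open>A common finite set of degrees; the degree \<open>e\<close> is included so that its part can be read off.\<close>
  define E where "E = insert e ({d. f d \<noteq> \<zero>\<^bsub>Q\<^esub>} \<union> {d. g d \<noteq> \<zero>\<^bsub>Q\<^esub>})"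
  have E: "finite E" using f g by (simp add: E_def decomposes_def)
  have pV: "p d \<in> polys V" and qV: "q d \<in> polys V" for d using p(1) q(1) grading_in_polys by blast+
  have "\<phi> (\<Sum>d\<in>E. p d) = \<phi> (\<Sum>d\<in>E. q d)" using p(2)[OF E] q(2)[OF E] by (auto simp: E_def)
  then have S: "(\<Sum>d\<in>E. p d) - (\<Sum>d\<in>E. q d) \<in> face_ideal V \<F>"
    using \<phi>_eq_iff[of "sum p E" "sum q E"] R.submod_sum[OF R.submod_R, of E p]
      R.submod_sum[OF R.submod_R, of E q] pV qV by simp
  have deg: "lookup s m = 0" if "s \<in> poly_grading V d" "int (monomial_degree m) \<noteq> d"
    for s :: "('v, 'k) mpoly" and d :: int and m :: "'v \<Rightarrow>\<^sub>0 nat"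
    using that by (force simp: poly_grading_def in_keys_iff)
  have look: "lookup (\<Sum>d\<in>E. r d) m = lookup (r e) m"
    if "\<And>d. r d \<in> poly_grading V d" "int (monomial_degree m) = e"
    for r :: "int \<Rightarrow> ('v, 'k) mpoly" and m :: "'v \<Rightarrow>\<^sub>0 nat"
  proof -
    have "lookup (\<Sum>d\<in>E. r d) m = (\<Sum>d\<in>E. if d = e then lookup (r e) m else 0)"
      unfolding lookup_sum using deg[OF that(1)] that(2) by (intro sum.cong) auto
    then show ?thesis using E by (simp add: E_def)
  qed
  have "p e - q e \<in> face_ideal V \<F>"
  proof -
    have "m \<in> monoms ((\<Sum>d\<in>E. p d) - (\<Sum>d\<in>E. q d))" if m: "m \<in> monoms (p e - q e)" for m
    proof -
      have nz: "lookup (p e) m - lookup (q e) m \<noteq> 0" using m by (simp add: in_keys_iff lookup_minus)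
      then have "int (monomial_degree m) = e" 
        using deg[of "p e" e m] deg[of "q e" e m] p(1) q(1) by force
      then show ?thesis 
        using nz look[of p m] look[of q m] p(1) q(1) by (simp add: in_keys_iff lookup_minus)
    qed
    then show ?thesis using S unfolding face_ideal_def by blast
  qed
  then show "f e = g e" using \<phi>_eq_iff[OF pV qV, of e e] p(1) q(1) by simp
qed

lemma graded: "graded_module (mpoly_ring V) (poly_grading V) Q Mdeg"
  unfolding graded_module_def
proof (intro conjI allI ballI)
  show "module (mpoly_ring V) Q" by (rule modQ)
  fix d
  show "additive_subgroup (Mdeg d) Q"
  proof (rule additive_subgroup.intro, rule Q.M.add.subgroupI)
    show "Mdeg d \<subseteq> carrier Q" using \<phi>_in grading_in_polys by blast
    have "0 \<in> poly_grading V d" by (simp add: poly_grading_def polys_facts)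
    then show "Mdeg d \<noteq> {}" by blast
    fix a assume "a \<in> Mdeg d"
    then obtain p where p: "p \<in> poly_grading V d" "a = \<phi> p" by blast
    have "- p \<in> poly_grading V d" using p(1) by (simp add: poly_grading_def polys_facts)
    then show "\<ominus>\<^bsub>Q\<^esub> a \<in> Mdeg d" using \<phi>_uminus[OF grading_in_polys[OF p(1)]] p(2) by (metis imageI)
    fix b assume "b \<in> Mdeg d"
    then obtain q where q: "q \<in> poly_grading V d" "b = \<phi> q" by blast
    have "p + q \<in> poly_grading V d"
      using p(1) q(1) monoms_add[of _ p q] by (auto simp: poly_grading_def polys_facts)
    then show "a \<oplus>\<^bsub>Q\<^esub> b \<in> Mdeg d"
      using \<phi>_add[OF grading_in_polys[OF p(1)] grading_in_polys[OF q(1)]] p(2) q(2) by (metis imageI)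
  qed
next
  fix d e x and a :: "('v, 'k) mpoly" assume a: "a \<in> poly_grading V d" and x: "x \<in> Mdeg e"
  obtain p where p: "p \<in> poly_grading V e" "x = \<phi> p" using x by blast
  have "a * p \<in> poly_grading V (d + e)"
    using a p(1) by (auto simp: poly_grading_def polys_facts monomial_degree_add dest!: monoms_mult)
  then show "a \<odot>\<^bsub>Q\<^esub> x \<in> Mdeg (d + e)"
    using \<phi>_smult[OF grading_in_polys[OF a] grading_in_polys[OF p(1)]] p(2) by (metis imageI)
next
  fix x assume "x \<in> carrier Q"
  then obtain p where p: "p \<in> polys V" "x = \<phi> p" using \<phi>_carrier by auto
  then have "decomposes Q Mdeg x (\<lambda>d. \<phi> (hom_part d p))"
    using decomposes_hom_part[of p Mdeg] hom_part_in_grading by blast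
  then show "\<exists>!f. decomposes Q Mdeg x f" using decomposition_unique by blast
qed

lemma graded_submodule_image:
  assumes "\<G> \<subseteq> \<F>"
  shows "graded_submodule (mpoly_ring V) Q Mdeg (\<phi> ` face_ideal V \<G>)"
  unfolding graded_submodule_def
proof (intro conjI ballI)
  show "submodule (\<phi> ` face_ideal V \<G>) (mpoly_ring V) Q"
    by (rule submodule_image[OF poly_ideal_face_ideal face_ideal_subset_polys])
  fix x assume "x \<in> \<phi> ` face_ideal V \<G>"
  then obtain p where p: "p \<in> face_ideal V \<G>" "x = \<phi> p" by blast
  have pV: "p \<in> polys V" using p face_ideal_subset_polys by blast
  have "\<phi> (hom_part d p) \<in> \<phi> ` face_ideal V \<G> \<inter> Mdeg d" for d
    using hom_part_in_face_ideal[OF p(1)] hom_part_in_grading[OF pV] by blast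
  then show "\<exists>f. decomposes Q (\<lambda>d. \<phi> ` face_ideal V \<G> \<inter> Mdeg d) x f"
    using decomposes_hom_part[OF pV, of "\<lambda>d. \<phi> ` face_ideal V \<G> \<inter> Mdeg d"] p(2) by blast
qed

lemma finitely_generated: "finitely_generated_module (mpoly_ring V) Q"
  unfolding finitely_generated_module_def
proof (intro exI[of _ "{\<phi> 1}"] conjI)
  let ?N = "generated_submodule (mpoly_ring V) Q {\<phi> 1}"
  show c: "{\<phi> 1} \<subseteq> carrier Q" using \<phi>_in[OF one_in_polys] by simp
  show "?N = carrier Q"
  proof
    show "?N \<subseteq> carrier Q"
      by (rule generated_minimal[OF Q.carrier_is_submodule c])
    show "carrier Q \<subseteq> ?N"
    proof
      fix x assume "x \<in> carrier Q"
      then obtain p where p: "p \<in> polys V" "x = \<phi> p" using \<phi>_carrier by auto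
      have "\<phi> 1 \<in> ?N"
        by (rule subsetD[OF generated_superset]) simp
      then have "p \<odot>\<^bsub>Q\<^esub> \<phi> 1 \<in> ?N"
        using Q.submoduleE(4)[OF submodule_generated[OF modQ c], of p] p(1) by simp
      then show "x \<in> ?N"
        using \<phi>_smult[OF p(1) one_in_polys] p(2) by simp
    qed
  qed
qed simp

end

section \<open>The filtration by dimension\<close>

lemma monom_split_sqfree:
  assumes "finite A" "A \<subseteq> supp m" "supp m \<subseteq> V"
  obtains q where "q \<in> polys V" "monom m (c :: 'k::field) = monom (sqfree A) 1 * q"
proof -
  obtain n where "supp n \<subseteq> supp m" "monom m c = monom (sqfree A) 1 * monom n c"
    using monom_sqfree_mult[OF assms(1,2)] by metis
  then show thesis using that[of "monom n c"] assms(3) by (auto simp: monom_in_face_ideal)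
qed

lemma poly_var_eq: "poly_var v = monom (sqfree {v}) 1"
  by (simp add: poly_var_def sqfree_def)

lemma poly_var_mult: "u \<noteq> v \<Longrightarrow> poly_var u * poly_var v = monom (sqfree {u, v}) 1"
  by (simp add: poly_var_def sqfree_def mult_single)

lemma poly_ideal_genideal:
  fixes A :: "('v, 'k::field) mpoly set"
  assumes "A \<subseteq> polys V"
  shows "poly_ideal V (Idl\<^bsub>mpoly_ring V\<^esub> A)" "A \<subseteq> Idl\<^bsub>mpoly_ring V\<^esub> A"
proof -
  interpret R: cring "mpoly_ring V :: ('v, 'k) mpoly ring" by (rule cring_mpoly)
  show "poly_ideal V (Idl\<^bsub>mpoly_ring V\<^esub> A)"
    by (rule mpoly_ideal(1)[OF R.genideal_ideal]) (use assms in simp)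
  show "A \<subseteq> Idl\<^bsub>mpoly_ring V\<^esub> A" by (rule R.genideal_self) (use assms in simp)
qed

text \<open>A monomial is divisible by an edge if and only if its support is not independent, that is, not
contained in a maximal independent set.\<close>

lemma edge_ideal_eq:
  assumes G: "simple_graph G"
  shows "edge_ideal G = (face_ideal (vertices G) (max_independent (edges G) (vertices G)) :: ('v, 'k::field) mpoly set)"
proof -
  let ?V = "vertices G" and ?E = "edges G"
  let ?F = "max_independent ?E ?V" and ?gens = "{poly_var u * poly_var v | u v. {u, v} \<in> ?E} :: ('v, 'k) mpoly set"
  let ?Id = "Idl\<^bsub>mpoly_ring ?V\<^esub> ?gens"
  interpret R: cring "mpoly_ring ?V :: ('v, 'k) mpoly ring" by (rule cring_mpoly)
  have E: "e \<subseteq> ?V" "card e = 2" if "e \<in> ?E" for e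
    using G that by (auto simp: simple_graph_def)
  have finV: "finite ?V" using G by (simp add: simple_graph_def)
  have gens: "?gens \<subseteq> face_ideal ?V ?F"
  proof
    fix p assume "p \<in> ?gens"
    then obtain u v where uv: "p = poly_var u * poly_var v" "{u, v} \<in> ?E" by blast
    then have "u \<noteq> v" using E(2)[of "{u, v}"] by auto
    then have "p = monom (sqfree {u, v}) 1" using uv(1) poly_var_mult by simp
    moreover have "\<not> {u, v} \<subseteq> F" if "F \<in> ?F" for F
      using max_independentD(2)[OF that] uv(2) unfolding independent_in_def by blast
    ultimately show "p \<in> face_ideal ?V ?F" using E(1)[OF uv(2)] by (simp add: monom_in_face_ideal)
  qed
  then have gensV: "?gens \<subseteq> polys ?V" using face_ideal_subset_polys by blast
  note Id = poly_ideal_genideal[OF gensV]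
  show ?thesis unfolding edge_ideal_def
  proof
    show "?Id \<subseteq> face_ideal ?V ?F"
      by (rule R.genideal_minimal[OF ideal_mpoly[OF poly_ideal_face_ideal face_ideal_subset_polys] gens])
    show "face_ideal ?V ?F \<subseteq> ?Id"
    proof
      fix p :: "('v, 'k) mpoly" assume p: "p \<in> face_ideal ?V ?F"
      show "p \<in> ?Id"
      proof (rule poly_ideal_by_monoms[OF Id(1)])
        fix m assume m: "m \<in> monoms p"
        have mV: "supp m \<subseteq> ?V" by (rule face_idealD(1)[OF p m])
        have "\<not> independent_in ?E (supp m)"
          using independent_extends[OF finV mV] face_idealD(2)[OF p m] by blast
        then obtain e where e: "e \<in> ?E" "e \<subseteq> supp m" by (auto simp: independent_in_def)
        obtain u v where uv: "e = {u, v}" "u \<noteq> v" using E(2)[OF e(1)] by (auto simp: card_2_iff)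
        then obtain q where q: "q \<in> polys ?V" "monom m (lookup p m) = monom (sqfree {u, v}) 1 * q"
          using monom_split_sqfree[of "{u, v}" m ?V "lookup p m"] e mV by auto
        have "poly_var u * poly_var v \<in> ?gens" using e(1) uv(1) by blast
        then have "monom (sqfree {u, v}) 1 \<in> ?Id"
          using Id(2) poly_var_mult[OF uv(2)] by (metis (no_types, lifting) subsetD)
        then show "monom m (lookup p m) \<in> ?Id"
          unfolding q(2)
          using subring_set.submod_mult[OF subring_polys Id(1) q(1), of "monom (sqfree {u, v}) 1"]
          by (simp add: mult.commute)
      qed
    qed
  qed
qed

lemma esyms_irrelevant:
  assumes "finite V"
  shows "set (esyms V k) \<subseteq> (irrelevant_ideal V :: ('v, 'k::field) mpoly set)"
proof -
  have vars: "poly_var ` V \<subseteq> (polys V :: ('v, 'k) mpoly set)"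
    by (auto simp: poly_var_eq monom_in_face_ideal)
  note Id = poly_ideal_genideal[OF vars]
  have "esym V (Suc k) \<in> (irrelevant_ideal V :: ('v, 'k) mpoly set)" for k
    unfolding esym_def irrelevant_ideal_def
  proof (rule subring_set.submod_sum[OF subring_polys Id(1)])
    fix A assume "A \<in> {A. A \<subseteq> V \<and> card A = Suc k}"
    then have A: "A \<subseteq> V" "finite A" "A \<noteq> {}" using assms finite_subset by auto
    then obtain v where v: "v \<in> A" by blast
    obtain q where q: "q \<in> polys V" "monom (sqfree A) (1::'k) = monom (sqfree {v}) 1 * q"
      using monom_split_sqfree[of "{v}" "sqfree A" V "1::'k"] A v by auto
    have "monom (sqfree {v}) (1::'k) \<in> Idl\<^bsub>mpoly_ring V\<^esub> (poly_var ` V)"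
      using Id(2) A(1) v by (auto simp: poly_var_eq)
    then show "monom (sqfree A) (1::'k) \<in> Idl\<^bsub>mpoly_ring V\<^esub> (poly_var ` V)"
      unfolding q(2)
      using subring_set.submod_mult[OF subring_polys Id(1) q(1), of "monom (sqfree {v}) 1"]
      by (simp add: mult.commute)
  qed
  then show ?thesis by (induction k) auto
qed

text \<open>Requiring sizes above the first \<open>i\<close> of the occurring sizes \<open>ds\<close> means at least the next one; with
this formulation the last step of the filtration needs no separate case.\<close>

lemma facets_by_size:
  fixes ds :: "nat list"
  assumes ds: "set ds = card ` \<F>" "sorted_wrt (<) ds" and i: "i < length ds"
  shows "\<exists>F0\<in>\<F>. card F0 = ds ! i \<and>
    {F\<in>\<F>. \<forall>d\<in>set (take i ds). d < card F} = {F\<in>\<F>. card F0 \<le> card F} \<and>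
    {F\<in>\<F>. \<forall>d\<in>set (take (Suc i) ds). d < card F} = {F\<in>\<F>. card F0 < card F}"
proof -
  have "ds ! i \<in> card ` \<F>" using ds(1) i nth_mem by metis
  then obtain F0 where F0: "F0 \<in> \<F>" "card F0 = ds ! i" by auto
  have lt: "ds ! j < ds ! k" if "j < k" "k < length ds" for j k
    using ds(2) that by (simp add: sorted_wrt_nth_less)
  have le: "(\<forall>d\<in>set (take i ds). d < card F) \<longleftrightarrow> ds ! i \<le> card F" if F: "F \<in> \<F>" for F
  proof
    assume L: "\<forall>d\<in>set (take i ds). d < card F"
    obtain j where j: "j < length ds" "card F = ds ! j"
      using F ds(1) by (metis image_eqI in_set_conv_nth)
    have "\<not> j < i"
    proof
      assume "j < i"
      then have "ds ! j \<in> set (take i ds)" using i by (auto simp: in_set_conv_nth)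
      then show False using L j by auto
    qed
    then show "ds ! i \<le> card F" using lt[of i j] j by (cases "i = j") auto
  next
    assume "ds ! i \<le> card F"
    then show "\<forall>d\<in>set (take i ds). d < card F"
      using lt[of _ i] i by (fastforce simp: in_set_conv_nth)
  qed
  have "(\<forall>d\<in>set (take (Suc i) ds). d < card F) \<longleftrightarrow> ds ! i < card F" if F: "F \<in> \<F>" for F
    using le[OF F] i by (auto simp: take_Suc_conv_app_nth)
  then show ?thesis using le F0 by (intro bexI[of _ F0]) auto
qed

text \<open>The \<open>i\<close>-th submodule \<open>N i\<close> is the image of the ideal \<open>J i\<close> of the facets that are larger than
the \<open>i\<close> smallest sizes. Factor \<open>i\<close> belongs to the facets of size \<open>ds ! i\<close>: their ideal
annihilates it, and the monomial of such a facet \<open>F0\<close> has the prime of \<open>F0\<close> as annihilator.\<close>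

theorem shellable_sequentially_cohen_macaulay:
  fixes V :: "'v set" and \<F> :: "'v set set"
  defines "R \<equiv> mpoly_ring V :: ('v, 'k::field) mpoly ring"
  defines "I \<equiv> face_ideal V \<F> :: ('v, 'k) mpoly set"
  assumes V: "finite V" and "finite \<F>" "\<F> \<noteq> {}" and sub: "\<And>F. F \<in> \<F> \<Longrightarrow> F \<subseteq> V"
    and anti: "\<And>F F'. F \<in> \<F> \<Longrightarrow> F' \<in> \<F> \<Longrightarrow> F \<subseteq> F' \<Longrightarrow> F = F'"
    and shell: "shelling \<F> \<rho>"
  shows "sequentially_cohen_macaulay R (poly_grading V) (irrelevant_ideal V)
    (quot_module (regular_module R) I) (\<lambda>d. (\<lambda>p. I +>\<^bsub>R\<^esub> p) ` poly_grading V d)"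
proof -
  let ?M = "quot_module (regular_module R) I" and ?\<phi> = "\<lambda>p. I +>\<^bsub>R\<^esub> p"
  interpret M: graded_quotient V ?M ?\<phi> \<F>
    unfolding R_def I_def
    by (intro graded_quotient.intro ideal_quotient_mpoly_quot poly_ideal_face_ideal face_ideal_subset_polys)
  define ds where "ds = sorted_list_of_set (card ` \<F>)"
  have ds: "set ds = card ` \<F>" "sorted_wrt (<) ds"
    using \<open>finite \<F>\<close> by (auto simp: ds_def)
  define \<G> where "\<G> i = {F\<in>\<F>. \<forall>d\<in>set (take i ds). d < card F}" for i
  define J where "J i = (face_ideal V (\<G> i) :: ('v, 'k) mpoly set)" for i
  define N where "N i = ?\<phi> ` J i" for i
  define Q where "Q i = quot_module (?M\<lparr>carrier := N (Suc i)\<rparr>) (N i)" for i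
  have J: "poly_ideal V (J i)" "J i \<subseteq> polys V" "I \<subseteq> J i" for i
    unfolding J_def I_def
    by (auto intro!: poly_ideal_face_ideal face_ideal_antimono simp: \<G>_def face_ideal_subset_polys)
  have J_mono: "J i \<subseteq> J (Suc i)" for i
    unfolding J_def using set_take_subset_set_take[of i "Suc i" ds]
    by (intro face_ideal_antimono) (auto simp: \<G>_def)
  have facets: "\<exists>F0\<in>\<F>. card F0 = ds ! i \<and> \<G> i = {F\<in>\<F>. card F0 \<le> card F} \<and> \<G> (Suc i) = {F\<in>\<F>. card F0 < card F}"
    if i: "i < length ds" for i
    unfolding \<G>_def by (rule facets_by_size[OF ds i])
  have J0: "J 0 = I" by (simp add: J_def I_def \<G>_def)
  have Jr: "J (length ds) = polys V"
  proof -
    have "\<G> (length ds) = {}" using ds(1) by (auto simp: \<G>_def)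
    then show ?thesis by (simp add: J_def)
  qed
  have finF: "finite F" if "F \<in> \<F>" for F using sub[OF that] V finite_subset by blast
  have main: "N i \<subset> N (Suc i) \<and> cohen_macaulay R (irrelevant_ideal V) (Q i) \<and> module_dim R (Q i) = enat (ds ! i)"
    if i: "i < length ds" for i
  proof -
    obtain F0 where F0: "F0 \<in> \<F>" "card F0 = ds ! i"
      and Gi: "\<G> i = {F\<in>\<F>. card F0 \<le> card F}" and GS: "\<G> (Suc i) = {F\<in>\<F>. card F0 < card F}"
      using facets[OF i] by blast
    let ?x = "monom (sqfree F0) (1::'k)"
    have "\<not> F0 \<subseteq> F" if "F \<in> \<F>" "card F0 < card F" for F using anti[OF F0(1) that(1)] that(2) by auto
    then have xJ: "?x \<in> J (Suc i)"
      using finF[OF F0(1)] sub[OF F0(1)] by (simp add: J_def GS monom_in_face_ideal)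
    have xn: "?x \<notin> J i" using finF[OF F0(1)] F0(1) by (auto simp: J_def Gi monom_in_face_ideal)
    have "N i \<subset> N (Suc i)"
    proof
      show "N i \<subseteq> N (Suc i)" using J_mono by (auto simp: N_def)
      have "?\<phi> ?x \<notin> N i"
        using M.\<phi>_mem[of "J i" ?x] J[of i] xn xJ J(2)[of "Suc i"] unfolding N_def I_def by blast
      then show "N i \<noteq> N (Suc i)" using xJ by (auto simp: N_def)
    qed
    interpret N: ideal_quotient V "?M\<lparr>carrier := N (Suc i)\<rparr>" ?\<phi> "J (Suc i)" I
      unfolding N_def using M.ideal_quotient_sub[of "J (Suc i)"] J[of "Suc i"] by (simp add: I_def)
    interpret Q: ideal_quotient V "Q i" "\<lambda>p. ?\<phi> ` J i +>\<^bsub>?M\<lparr>carrier := N (Suc i)\<rparr>\<^esub> ?\<phi> p" "J (Suc i)" "J i"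
      unfolding Q_def N_def[of i] using N.ideal_quotient_quot[of "J i"] J[of i] J_mono by simp
    let ?F = "{F\<in>\<F>. card F = card F0}"
    let ?A = "{a \<in> polys V. \<forall>p\<in>J (Suc i). a * p \<in> J i}"
    \<comment> \<open>The annihilator of the factor lies between the ideal of all facets of this size and a single prime.\<close>
    have b1: "face_ideal V ?F \<subseteq> ?A"
    proof
      fix a :: "('v, 'k) mpoly" assume a: "a \<in> face_ideal V ?F"
      have aV: "a \<in> polys V" using a face_ideal_subset_polys by blast
      have "a * p \<in> J i" if p: "p \<in> J (Suc i)" for p
        unfolding J_def
      proof (rule face_idealI)
        fix m assume "m \<in> monoms (a * p)"
        then obtain k l where kl: "k \<in> monoms a" "l \<in> monoms p" "m = k + l" using monoms_mult by blast
        have p': "p \<in> face_ideal V (\<G> (Suc i))" using p by (simp add: J_def)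
        show "supp m \<subseteq> V"
          using face_idealD(1)[OF a kl(1)] face_idealD(1)[OF p' kl(2)] by (simp add: kl(3) supp_add)
        show "\<not> supp m \<subseteq> F" if "F \<in> \<G> i" for F
        proof (cases "card F = card F0")
          case True
          then have "F \<in> ?F" using that by (simp add: Gi)
          then show ?thesis using face_idealD(2)[OF a kl(1)] by (simp add: kl(3) supp_add)
        next
          case False
          then have "F \<in> \<G> (Suc i)" using that by (simp add: Gi GS)
          then show ?thesis using face_idealD(2)[OF p' kl(2)] by (simp add: kl(3) supp_add)
        qed
      qed
      then show "a \<in> ?A" using aV by blast
    qed
    have b2: "?A \<subseteq> face_ideal V {F0}"
    proof
      fix a assume a: "a \<in> ?A"
      then have "a * ?x \<in> J i" using xJ by blast
      then have "?x * a \<in> J i" by (simp add: mult.commute)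
      then have "\<forall>m\<in>monoms a. F0 \<union> supp m \<subseteq> V \<and> (\<forall>F\<in>\<G> i. \<not> F0 \<union> supp m \<subseteq> F)"
        unfolding J_def colon_face_ideal[OF finF[OF F0(1)]] .
      then show "a \<in> face_ideal V {F0}" using F0(1) by (intro face_idealI) (auto simp: Gi)
    qed
    have reg: "regular_on (esyms V (card F0)) (J (Suc i)) (J i)"
      unfolding J_def Gi GS by (rule shelling_regular[OF V \<open>finite \<F>\<close> shell sub F0(1)])
    have "module_dim (mpoly_ring V) (Q i) = enat (card F0)"
      "cohen_macaulay (mpoly_ring V) (irrelevant_ideal V) (Q i)"
      by (rule Q.cohen_macaulay_of_dim[OF V sub[OF F0(1)] _ _ b1 b2 esyms_irrelevant[OF V] esyms_in[OF V] length_esyms reg];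
          use \<open>finite \<F>\<close> finF in simp)+
    then show ?thesis using \<open>N i \<subset> N (Suc i)\<close> F0(2) by (simp add: R_def)
  qed
  show ?thesis
    unfolding sequentially_cohen_macaulay_def Let_def
  proof (intro conjI exI[of _ "length ds"] exI[of _ N] allI impI)
    show "graded_module R (poly_grading V) ?M (\<lambda>d. ?\<phi> ` poly_grading V d)"
      using M.graded by (simp add: R_def)
    show "finitely_generated_module R ?M" using M.finitely_generated by (simp add: R_def)
    show "N 0 = {\<zero>\<^bsub>?M\<^esub>}"
    proof -
      have "?\<phi> p = \<zero>\<^bsub>?M\<^esub>" if "p \<in> I" for p
        using M.\<phi>_zero[of p] that face_ideal_subset_polys unfolding I_def by blast
      moreover have "0 \<in> I" using M.R.submod_zero[OF M.K(1)] by (simp add: I_def)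
      ultimately show ?thesis unfolding N_def J0 by auto
    qed
    show "N (length ds) = carrier ?M" unfolding N_def Jr M.\<phi>_carrier ..
    show "graded_submodule R ?M (\<lambda>d. ?\<phi> ` poly_grading V d) (N i)" for i
      unfolding N_def J_def using M.graded_submodule_image[of "\<G> i"] by (simp add: R_def \<G>_def)
    fix i
    show "N i \<subset> N (Suc i)" if "i < length ds" using main[OF that] by blast
    show "cohen_macaulay R (irrelevant_ideal V) (quot_module (?M\<lparr>carrier := N (Suc i)\<rparr>) (N i))"
      if "i < length ds" using main[OF that] by (simp add: Q_def)
    assume si: "Suc i < length ds"
    then have "ds ! i < ds ! Suc i" using ds(2) by (simp add: sorted_wrt_nth_less)
    then show "module_dim R (quot_module (?M\<lparr>carrier := N (Suc i)\<rparr>) (N i))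
        < module_dim R (quot_module (?M\<lparr>carrier := N (Suc (Suc i))\<rparr>) (N (Suc i)))"
      using main[of i] main[OF si] si by (simp add: Q_def)
  qed
qed

theorem graph_sequentially_cohen_macaulay_if_shelling:
  assumes G: "simple_graph G" and shell: "shelling (max_independent (edges G) (vertices G)) \<tau>"
  shows "graph_sequentially_cohen_macaulay TYPE('k::field) G"
proof -
  let ?F = "max_independent (edges G) (vertices G)"
  have fin: "finite (vertices G)" using G by (simp add: simple_graph_def)
  have "independent_in (edges G) {}" using G by (force simp: independent_in_def simple_graph_def)
  then have "?F \<noteq> {}" using independent_extends[OF fin, of "{}"] by blast
  moreover have "F = F'" if "F \<in> ?F" "F' \<in> ?F" "F \<subseteq> F'" for F F'
    using max_independent_antichain[OF that(1) _ that(3)] max_independentD[OF that(2)] by blast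
  ultimately show ?thesis
    unfolding graph_sequentially_cohen_macaulay_def Let_def edge_ideal_eq[OF G]
    by (intro shellable_sequentially_cohen_macaulay[OF fin finite_max_independent[OF fin] _ _ _ shell]
        max_independentD(1))
qed

theorem corollary3p4:
  fixes G :: "'v sgraph" and S :: "'v set"
  assumes "simple_graph G" and "S \<subseteq> vertices G"
  shows "(vertex_cover G S \<longrightarrow>
            graph_sequentially_cohen_macaulay TYPE('k::field) (add_whiskers G S)) \<and>
         (forest_graph (delete_vertices G S) \<longrightarrow>
            graph_sequentially_cohen_macaulay TYPE('k) (add_whiskers G S)) \<and>
         (\<forall>y\<in>vertices G. cycle_graph G \<longrightarrow>
            graph_sequentially_cohen_macaulay TYPE('k) (add_whiskers G {y}))"
proof -
  \<comment> \<open>A vertex cover leaves no edges, and a cycle minus a vertex is a path: all three parts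
    are about deleting \<open>T\<close> and finding a forest.\<close>
  have whiskers: "graph_sequentially_cohen_macaulay TYPE('k) (add_whiskers G T)"
    if T: "T \<subseteq> vertices G" "forest_like (edges G) (vertices G - T)" for T
  proof -
    obtain \<tau> where "shelling (max_independent (edges (add_whiskers G T)) (vertices (add_whiskers G T))) \<tau>"
      using add_whiskers_shelling[OF assms(1) T] by blast
    then show ?thesis
      by (rule graph_sequentially_cohen_macaulay_if_shelling[OF simple_graph_add_whiskers[OF assms(1) T(1)]])
  qed
  show ?thesis
  proof (intro conjI ballI impI)
    assume "vertex_cover G S"
    then show "graph_sequentially_cohen_macaulay TYPE('k) (add_whiskers G S)"
      by (intro whiskers assms(2) forest_like_if_vertex_cover)
  next
    assume "forest_graph (delete_vertices G S)"
    then show "graph_sequentially_cohen_macaulay TYPE('k) (add_whiskers G S)"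
      by (intro whiskers assms(2) forest_like_if_forest_graph[OF assms(1)])
  next
    fix y assume "y \<in> vertices G" "cycle_graph G"
    then show "graph_sequentially_cohen_macaulay TYPE('k) (add_whiskers G {y})"
      by (intro whiskers forest_like_cycle_minus_vertex) simp_all
  qed
qed

end
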